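(* Let $k\ge0$, $\tau>0$, $N\ge1$ and $\theta\in[0,1]$, and let $\Omega_h$ be a polygonal decomposition of $\Omega$ for which there is a constant $\rho>0$ such that every polygon $E\in\Omega_h$, with diameter $h_E$, is star-shaped with respect to a ball of radius $\ge\rho h_E$ and every edge $e$ of $E$ has length $h_e\ge\rho h_E$. Suppose $f=0$ and $\Gamma_R=\emptyset$. Let $(\boldsymbol{u}_{h,\tau}^n,p_{h,\tau}^n)\in\boldsymbol{V}_k\times Q_k$, $n=0,\dots,N$, be a solution of the $\theta$-method scheme: $(\boldsymbol{u}_{h,\tau}^0,p_{h,\tau}^0)=(\Pi_k^0\boldsymbol{u}_0,\Pi_k^0p_0)$ and, for $n=0,\dots,N-1$, $$m_h\Bigl(\frac{\boldsymbol{u}_{h,\tau}^{n+1}-\boldsymbol{u}_{h,\tau}^{n}}{\tau},\boldsymbol{v}_h\Bigr)+b\bigl(\boldsymbol{v}_h,\theta p_{h,\tau}^{n+1}+(1-\theta)p_{h,\tau}^n\bigr)=0\qquad\forall\,\boldsymbol{v}_h\in\boldsymbol{V}_k,$$ $$n\Bigl(\frac{p_{h,\tau}^{n+1}-p_{h,\tau}^n}{\tau},q_h\Bigr)-b\bigl(\theta\boldsymbol{u}_{h,\tau}^{n+1}+(1-\theta)\boldsymbol{u}_{h,\tau}^n,q_h\bigr)=0\qquad\forall\,q_h\in Q_k.$$ Then: (i) if $\theta=1/2$ (Crank–Nicolson), the discrete energy is conserved: for all $n=0,\dots,N$, $\|(\boldsymbol{u}_{h,\tau}^{n},p_{h,\tau}^{n})\|_{\mathcal{E}_h}=\|(\boldsymbol{u}_{h,\tau}^{0},p_{h,\tau}^{0})\|_{\mathcal{E}_h}=\|(\Pi_k^0\boldsymbol{u}_0,\Pi_k^0p_0)\|_{\mathcal{E}}$;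 (ii) if $1/2<\theta\le1$, then $\|(\boldsymbol{u}_{h,\tau}^{n+1},p_{h,\tau}^{n+1})\|_{\mathcal{E}_h}^2\le\|(\boldsymbol{u}_{h,\tau}^{n},p_{h,\tau}^{n})\|_{\mathcal{E}_h}^2$ for all $n=0,\dots,N-1$; (iii) if $0\le\theta<1/2$, then $\|(\boldsymbol{u}_{h,\tau}^{n+1},p_{h,\tau}^{n+1})\|_{\mathcal{E}_h}^2\ge\|(\boldsymbol{u}_{h,\tau}^{n},p_{h,\tau}^{n})\|_{\mathcal{E}_h}^2$ for all $n=0,\dots,N-1$.
   Context: **Setting.** $\Omega\subset\mathbb{R}^2$ is a polygonal domain with Lipschitz boundary and outward unit normal $\boldsymbol{n}$. $\partial\Omega$ is divided into three parts $\Gamma_D,\Gamma_N,\Gamma_R$ with mutually disjoint interiors; here $\Gamma_R=\emptyset$. $c$ is a positive piecewise constant function on $\Omega$. $(\cdot,\cdot)_\omega$ and $\|\cdot\|_{0,\omega}$ are the $L^2(\omega)$ inner product and norm. Set $\boldsymbol{V}=\{\boldsymbol{v}\in H(\mathrm{div},\Omega):\boldsymbol{v}\cdot\boldsymbol{n}=0\text{ on }\Gamma_N\}$ and $Q=L^2(\Omega)$. Initial data: $\boldsymbol{u}_0\in Q^2$, $p_0\in Q$. The source of the acoustic wave problem being discretized is $f=0$ and boundary data are homogeneous. Forms: $n(p,q)=(c^{-2}p,q)_\Omega$, $b(\boldsymbol{v},q)=(\mathrm{div}\,\boldsymbol{v},q)_\Omega$. **Meshes.** $\Omega_h$ is a decomposition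 of $\Omega$ into polygons $E$ with diameter $h_E$; $h_e$ is the length of an edge $e$; $\boldsymbol{n}_E^e$ is the unit normal to $e$ outward to $E$. Mesh regularity: there is $\rho>0$ such that every $E$ is star-shaped with respect to a ball of radius $\ge\rho h_E$ and every edge $e$ of $E$ satisfies $h_e\ge\rho h_E$. $\Omega_h$ matches the subdivision of $\partial\Omega$, and $c$ is constant on each $E\in\Omega_h$. **Projections.** $\mathbb{P}_n(\omega)$ is the space of polynomials of degree $\le n$ on $\omega$, $\mathbb{P}_{-1}(\omega)=\{0\}$. $\mathbb{P}_n(\Omega_h)=\{q\in L^2(\Omega): q|_E\in\mathbb{P}_n(E)\ \forall E\in\Omega_h\}$. $\Pi^{0,E}_k$ is the $L^2(E)$-orthogonal projection onto $\mathbb{P}_k(E)$ (componentwise on vectors), and $\Pi_k^0$ is its global elementwise version. **Virtual element spaces.** $\boldsymbol{V}_k(E)$ is the set of $\boldsymbol{v}\in H(\mathrm{div},E)\cap H(\mathrm{curl},E)$ with $\mathrm{div}\,\boldsymbol{v}\in\mathbb{P}_k(E)$, $\mathrm{curl}\,\boldsymbol{v}\in\mathbb{P}_{k-1}(E)$ and $(\boldsymbol{v}\cdot\boldsymbol{n}_E^e)|_e\in\mathbb{P}_k(e)$ for every edge $e$ of $E$ (here $\mathrm{curl}$ is the scalar curl). It contains $[\mathbb{P}_k(E)]^2$. Its degrees of freedom are: the moments $\int_E(\mathrm{div}\,\boldsymbol{w})\,p_k$ for $p_k\in\mathbb{P}_k(E)\setminus\mathbb{R}$ (i.e. polynomials modulo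 constants), the moments $\int_E\boldsymbol{w}\cdot(p_{k-1}\boldsymbol{x}^\perp)$ for $p_{k-1}\in\mathbb{P}_{k-1}(E)$ with $\boldsymbol{x}^\perp=(y,-x)^{T}$, and the edge moments $\int_e(\boldsymbol{w}\cdot\boldsymbol{n}_E^e)\,p_k$ for $p_k\in\mathbb{P}_k(e)$ and every edge $e$ of $E$. Global spaces: $\boldsymbol{V}_k=\{\boldsymbol{v}\in\boldsymbol{V}:\boldsymbol{v}|_E\in\boldsymbol{V}_k(E)\ \forall E\in\Omega_h\}$ and $Q_k=\mathbb{P}_k(\Omega_h)$. **Discrete form.** $m_h(\boldsymbol{v}_h,\boldsymbol{w}_h)=\sum_{E\in\Omega_h}m_h^E(\boldsymbol{v}_h,\boldsymbol{w}_h)$, where $$m_h^E(\boldsymbol{v}_h,\boldsymbol{w}_h)=\int_E(\Pi_k^{0,E}\boldsymbol{v}_h)\cdot(\Pi_k^{0,E}\boldsymbol{w}_h)\,dE+h_E^{2}\,S^E\bigl((I-\Pi_k^{0,E})\boldsymbol{v}_h,(I-\Pi_k^{0,E})\boldsymbol{w}_h\bigr),$$ and $S^E(\boldsymbol{v}_h,\boldsymbol{w}_h)=\vec{\boldsymbol{v}}_h\cdot\vec{\boldsymbol{w}}_h$ is the Euclidean product of the vectors of the (properly scaled) degrees of freedom in $\boldsymbol{V}_k(E)$. Under the mesh regularity condition stated above, $S^E$ satisfies the known bound $C_1\|\boldsymbol{v}_h\|_{0,E}^2\le h_E^2S^E(\boldsymbol{v}_h,\boldsymbol{v}_h)\le C_2\|\boldsymbol{v}_h\|_{0,E}^2$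 for all $\boldsymbol{v}_h\in\boldsymbol{V}_k(E)\cap\ker\Pi_k^{0,E}$, with $C_1,C_2>0$ depending only on $k$ and $\rho$. The form $m_h$ is used for all fields whose restriction to each $E$ lies in $\boldsymbol{V}_k(E)$. **Energy norms.** $\|(\boldsymbol{v},q)\|_{\mathcal{E}}^2=\|\boldsymbol{v}\|_{0,\Omega}^2+\|c^{-1}q\|_{0,\Omega}^2$ for $(\boldsymbol{v},q)\in[L^2(\Omega)]^2\times Q$, and $\|(\boldsymbol{v}_h,q_h)\|_{\mathcal{E}_h}^2=m_h(\boldsymbol{v}_h,\boldsymbol{v}_h)+\|c^{-1}q_h\|_{0,\Omega}^2$ for $(\boldsymbol{v}_h,q_h)\in(\boldsymbol{V}_k\cup[\mathbb{P}_k(\Omega_h)]^2)\times Q_k$. *)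

theory Defs
  imports "HOL-Analysis.Analysis"
begin

section \<open>Square-integrable fields\<close>

text \<open>Elements of \<open>L\<^sup>2\<close> are represented by functions on the whole space; only their values
  on \<open>\<omega>\<close>, up to null sets, matter.\<close>

definition L2 :: "'a::euclidean_space set \<Rightarrow> ('a \<Rightarrow> 'b::euclidean_space) set" where
  "L2 \<omega> = {f. f \<in> borel_measurable (lebesgue_on \<omega>) \<and>
                integrable (lebesgue_on \<omega>) (\<lambda>x. (norm (f x))\<^sup>2)}"

definition l2_inner :: "'a::euclidean_space set \<Rightarrow> ('a \<Rightarrow> 'b::euclidean_space) \<Rightarrow> ('a \<Rightarrow> 'b) \<Rightarrow> real" where
  "l2_inner \<omega> f g = (LINT x|lebesgue_on \<omega>. f x \<bullet> g x)"

definition l2_norm :: "'a::euclidean_space set \<Rightarrow> ('a \<Rightarrow> 'b::euclidean_space) \<Rightarrow> real" where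
  "l2_norm \<omega> f = sqrt (l2_inner \<omega> f f)"


section \<open>Weak divergence and weak curl\<close>

definition partial :: "2 \<Rightarrow> (real^2 \<Rightarrow> real) \<Rightarrow> real^2 \<Rightarrow> real" where
  "partial i \<phi> x = frechet_derivative \<phi> (at x) (axis i 1)"

definition grad :: "(real^2 \<Rightarrow> real) \<Rightarrow> real^2 \<Rightarrow> real^2" where
  "grad \<phi> x = (\<chi> i. partial i \<phi> x)"

definition perp :: "real^2 \<Rightarrow> real^2" where
  "perp x = vector [x $ 2, - (x $ 1)]"

text \<open>\<open>C\<^sup>\<infinity>\<close>: all iterated partial derivatives exist and are differentiable.\<close>

coinductive smooth :: "(real^2 \<Rightarrow> real) \<Rightarrow> bool" where
  "(\<And>x. \<phi> differentiable (at x)) \<Longrightarrow> (\<And>i. smooth (partial i \<phi>)) \<Longrightarrow> smooth \<phi>"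

definition test_functions :: "(real^2) set \<Rightarrow> (real^2 \<Rightarrow> real) set" where
  "test_functions \<omega> = {\<phi>. smooth \<phi> \<and> (\<exists>K. compact K \<and> K \<subseteq> \<omega> \<and> (\<forall>x. x \<notin> K \<longrightarrow> \<phi> x = 0))}"

definition has_weak_div :: "(real^2) set \<Rightarrow> (real^2 \<Rightarrow> real^2) \<Rightarrow> (real^2 \<Rightarrow> real) \<Rightarrow> bool" where
  "has_weak_div \<omega> v d \<longleftrightarrow> v \<in> L2 \<omega> \<and> d \<in> L2 \<omega> \<and>
     (\<forall>\<phi>\<in>test_functions \<omega>. l2_inner \<omega> d \<phi> = - l2_inner \<omega> v (grad \<phi>))"

text \<open>Weak form of \<open>curl v = \<partial>\<^sub>1 v\<^sub>2 - \<partial>\<^sub>2 v\<^sub>1\<close>; note that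
  \<open>perp (grad \<phi>) = (\<partial>\<^sub>2 \<phi>, - \<partial>\<^sub>1 \<phi>)\<close>.\<close>

definition has_weak_curl :: "(real^2) set \<Rightarrow> (real^2 \<Rightarrow> real^2) \<Rightarrow> (real^2 \<Rightarrow> real) \<Rightarrow> bool" where
  "has_weak_curl \<omega> v r \<longleftrightarrow> v \<in> L2 \<omega> \<and> r \<in> L2 \<omega> \<and>
     (\<forall>\<phi>\<in>test_functions \<omega>. l2_inner \<omega> r \<phi> = l2_inner \<omega> v (\<lambda>x. perp (grad \<phi> x)))"

definition Hdiv :: "(real^2) set \<Rightarrow> (real^2 \<Rightarrow> real^2) set" where
  "Hdiv \<omega> = {v. \<exists>d. has_weak_div \<omega> v d}"

definition Hcurl :: "(real^2) set \<Rightarrow> (real^2 \<Rightarrow> real^2) set" where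
  "Hcurl \<omega> = {v. \<exists>r. has_weak_curl \<omega> v r}"

definition wdiv :: "(real^2) set \<Rightarrow> (real^2 \<Rightarrow> real^2) \<Rightarrow> real^2 \<Rightarrow> real" where
  "wdiv \<omega> v = (SOME d. has_weak_div \<omega> v d)"


section \<open>Normal traces\<close>

text \<open>For \<open>v \<in> H(div,\<omega>)\<close> the trace \<open>v \<sqdot> n\<close> (outward normal) is the functional
  \<open>\<phi> \<mapsto> \<integral>\<^sub>\<omega> (div v) \<phi> + v \<sqdot> \<nabla>\<phi>\<close> on traces of \<open>\<phi>\<close> (Green's formula). Its restriction to a part
  \<open>\<Sigma>\<close> of the boundary is obtained from those \<open>\<phi>\<close> that vanish on the rest of the boundary.\<close>

definition normal_trace :: "(real^2) set \<Rightarrow> (real^2 \<Rightarrow> real^2) \<Rightarrow> (real^2 \<Rightarrow> real) \<Rightarrow> real" where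
  "normal_trace \<omega> v \<phi> = l2_inner \<omega> (wdiv \<omega> v) \<phi> + l2_inner \<omega> v (grad \<phi>)"

definition trace_tests :: "(real^2) set \<Rightarrow> (real^2) set \<Rightarrow> (real^2 \<Rightarrow> real) set" where
  "trace_tests \<omega> \<Sigma> = {\<phi>. smooth \<phi> \<and> (\<forall>x\<in>frontier \<omega> - \<Sigma>. \<phi> x = 0)}"

definition zero_normal_trace_on :: "(real^2) set \<Rightarrow> (real^2) set \<Rightarrow> (real^2 \<Rightarrow> real^2) \<Rightarrow> bool" where
  "zero_normal_trace_on \<omega> \<Sigma> v \<longleftrightarrow> (\<forall>\<phi>\<in>trace_tests \<omega> \<Sigma>. normal_trace \<omega> v \<phi> = 0)"

definition edge_integral :: "(real^2) \<times> (real^2) \<Rightarrow> (real^2 \<Rightarrow> real) \<Rightarrow> real" where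
  "edge_integral e f =
     dist (fst e) (snd e) * (LINT t|lebesgue_on {0..1}. f (linepath (fst e) (snd e) t))"

definition edge_set :: "(real^2) \<times> (real^2) \<Rightarrow> (real^2) set" where
  "edge_set e = closed_segment (fst e) (snd e)"

definition has_edge_trace ::
  "(real^2) set \<Rightarrow> (real^2 \<Rightarrow> real^2) \<Rightarrow> (real^2) \<times> (real^2) \<Rightarrow> (real^2 \<Rightarrow> real) \<Rightarrow> bool" where
  "has_edge_trace \<omega> v e g \<longleftrightarrow> g \<circ> linepath (fst e) (snd e) \<in> L2 {0..1} \<and>
     (\<forall>\<phi>\<in>trace_tests \<omega> (edge_set e). normal_trace \<omega> v \<phi> = edge_integral e (\<lambda>x. g x * \<phi> x))"

definition edge_trace ::
  "(real^2) set \<Rightarrow> (real^2 \<Rightarrow> real^2) \<Rightarrow> (real^2) \<times> (real^2) \<Rightarrow> real^2 \<Rightarrow> real" where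
  "edge_trace \<omega> v e = (SOME g. has_edge_trace \<omega> v e g)"


section \<open>Domains, polygons and meshes\<close>

definition lipschitz_boundary :: "(real^2) set \<Rightarrow> bool" where
  "lipschitz_boundary \<Omega> \<longleftrightarrow> (\<forall>x\<in>frontier \<Omega>. \<exists>d \<epsilon> L \<gamma>. norm d = 1 \<and> 0 < \<epsilon> \<and>
     L-lipschitz_on (UNIV::real set) \<gamma> \<and>
     (\<forall>y\<in>ball x \<epsilon>. y \<in> \<Omega> \<longleftrightarrow> (y - x) \<bullet> d > \<gamma> ((y - x) \<bullet> perp d)))"

definition polygonal_lipschitz_domain :: "(real^2) set \<Rightarrow> bool" where
  "polygonal_lipschitz_domain \<Omega> \<longleftrightarrow> \<Omega> \<noteq> {} \<and> open \<Omega> \<and> connected \<Omega> \<and> bounded \<Omega> \<and>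
     (\<exists>S. finite S \<and> frontier \<Omega> = (\<Union>e\<in>S. edge_set e)) \<and> lipschitz_boundary \<Omega>"

text \<open>A polygon is given by the cyclic list of its vertices, so that its edges are part of the
  data; angles of size \<open>\<pi>\<close> (hanging nodes) are allowed.\<close>

type_synonym polygon = "(real^2) list"

fun vertex_path :: "polygon \<Rightarrow> real \<Rightarrow> real^2" where
  "vertex_path [] = linepath 0 0"
| "vertex_path [a] = linepath a a"
| "vertex_path [a, b] = linepath a b"
| "vertex_path (a # b # c # xs) = linepath a b +++ vertex_path (b # c # xs)"

definition boundary_path :: "polygon \<Rightarrow> real \<Rightarrow> real^2" where
  "boundary_path E = vertex_path (E @ [hd E])"

definition simple_polygon :: "polygon \<Rightarrow> bool" where
  "simple_polygon E \<longleftrightarrow> 3 \<le> length E \<and> simple_path (boundary_path E)"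

definition region :: "polygon \<Rightarrow> (real^2) set" where
  "region E = inside (path_image (boundary_path E))"

definition edge :: "polygon \<Rightarrow> nat \<Rightarrow> (real^2) \<times> (real^2)" where
  "edge E i = (E ! i, E ! (Suc i mod length E))"

definition edges :: "polygon \<Rightarrow> ((real^2) \<times> (real^2)) set" where
  "edges E = edge E ` {..<length E}"

definition is_decomposition :: "(real^2) set \<Rightarrow> polygon set \<Rightarrow> bool" where
  "is_decomposition \<Omega> \<Omega>h \<longleftrightarrow> finite \<Omega>h \<and> (\<forall>E\<in>\<Omega>h. simple_polygon E \<and> region E \<subseteq> \<Omega>) \<and>
     (\<forall>E\<in>\<Omega>h. \<forall>F\<in>\<Omega>h. E \<noteq> F \<longrightarrow> region E \<inter> region F = {}) \<and>
     closure \<Omega> = (\<Union>E\<in>\<Omega>h. closure (region E))"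

definition star_shaped_wrt_ball :: "(real^2) set \<Rightarrow> real^2 \<Rightarrow> real \<Rightarrow> bool" where
  "star_shaped_wrt_ball S x\<^sub>0 r \<longleftrightarrow>
     ball x\<^sub>0 r \<subseteq> S \<and> (\<forall>y\<in>ball x\<^sub>0 r. \<forall>x\<in>S. closed_segment y x \<subseteq> S)"

definition mesh_regular :: "real \<Rightarrow> polygon set \<Rightarrow> bool" where
  "mesh_regular \<rho> \<Omega>h \<longleftrightarrow> (\<forall>E\<in>\<Omega>h.
     (\<exists>x\<^sub>0 r. r \<ge> \<rho> * diameter (region E) \<and> star_shaped_wrt_ball (region E) x\<^sub>0 r) \<and>
     (\<forall>e\<in>edges E. dist (fst e) (snd e) \<ge> \<rho> * diameter (region E)))"

definition boundary_partition ::
  "(real^2) set \<Rightarrow> (real^2) set \<Rightarrow> (real^2) set \<Rightarrow> (real^2) set \<Rightarrow> bool" where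
  "boundary_partition \<Omega> \<Gamma>D \<Gamma>N \<Gamma>R \<longleftrightarrow>
     closed \<Gamma>D \<and> closed \<Gamma>N \<and> closed \<Gamma>R \<and> \<Gamma>D \<union> \<Gamma>N \<union> \<Gamma>R = frontier \<Omega> \<and>
     (let int = (\<lambda>\<Gamma>. top_of_set (frontier \<Omega>) interior_of \<Gamma>) in
        int \<Gamma>D \<inter> int \<Gamma>N = {} \<and> int \<Gamma>D \<inter> int \<Gamma>R = {} \<and> int \<Gamma>N \<inter> int \<Gamma>R = {})"

definition mesh_matches :: "polygon set \<Rightarrow> (real^2) set \<Rightarrow> bool" where
  "mesh_matches \<Omega>h \<Gamma> \<longleftrightarrow> (\<exists>S \<subseteq> (\<Union>E\<in>\<Omega>h. edges E). \<Gamma> = (\<Union>e\<in>S. edge_set e))"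

definition positive_piecewise_constant ::
  "(real^2) set \<Rightarrow> polygon set \<Rightarrow> (real^2 \<Rightarrow> real) \<Rightarrow> bool" where
  "positive_piecewise_constant \<Omega> \<Omega>h c \<longleftrightarrow>
     (\<forall>x\<in>\<Omega>. 0 < c x) \<and> (\<forall>E\<in>\<Omega>h. c constant_on region E)"


section \<open>Polynomials and projections\<close>

text \<open>The degree is an integer so that \<open>polys (-1) = {0}\<close>. Polynomials on \<open>\<omega>\<close> (an element or an
  edge) are the restrictions of polynomials on the plane.\<close>

definition polys :: "int \<Rightarrow> (real^2 \<Rightarrow> real) set" where
  "polys n = {p. \<exists>a :: nat \<Rightarrow> nat \<Rightarrow> real.
     p = (\<lambda>x. \<Sum>(i, j) \<in> {(i, j). int (i + j) \<le> n}. a i j * (x $ 1) ^ i * (x $ 2) ^ j)}"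

definition proj :: "int \<Rightarrow> polygon \<Rightarrow> (real^2 \<Rightarrow> real) \<Rightarrow> real^2 \<Rightarrow> real" where
  "proj n E f = (THE q. q \<in> polys n \<and>
     (\<forall>p\<in>polys n. l2_inner (region E) (\<lambda>x. f x - q x) p = 0))"

definition vproj :: "int \<Rightarrow> polygon \<Rightarrow> (real^2 \<Rightarrow> real^2) \<Rightarrow> real^2 \<Rightarrow> real^2" where
  "vproj n E v x = (\<chi> i. proj n E (\<lambda>y. v y $ i) x)"

definition global_proj :: "int \<Rightarrow> polygon set \<Rightarrow> (real^2 \<Rightarrow> real) \<Rightarrow> real^2 \<Rightarrow> real" where
  "global_proj n \<Omega>h f x = (\<Sum>E\<in>\<Omega>h. indicator (region E) x * proj n E f x)"

definition global_vproj :: "int \<Rightarrow> polygon set \<Rightarrow> (real^2 \<Rightarrow> real^2) \<Rightarrow> real^2 \<Rightarrow> real^2" where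
  "global_vproj n \<Omega>h v x = (\<Sum>E\<in>\<Omega>h. indicator (region E) x *\<^sub>R vproj n E v x)"


section \<open>Discrete spaces\<close>

definition vem_local :: "nat \<Rightarrow> polygon \<Rightarrow> (real^2 \<Rightarrow> real^2) set" where
  "vem_local k E = {v. v \<in> Hdiv (region E) \<and> v \<in> Hcurl (region E) \<and>
     (\<exists>p\<in>polys (int k). has_weak_div (region E) v p) \<and>
     (\<exists>p\<in>polys (int k - 1). has_weak_curl (region E) v p) \<and>
     (\<forall>e\<in>edges E. \<exists>p\<in>polys (int k). has_edge_trace (region E) v e p)}"

definition V_space :: "(real^2) set \<Rightarrow> (real^2) set \<Rightarrow> (real^2 \<Rightarrow> real^2) set" where
  "V_space \<Omega> \<Gamma>N = {v \<in> Hdiv \<Omega>. zero_normal_trace_on \<Omega> \<Gamma>N v}"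

definition V_disc :: "nat \<Rightarrow> (real^2) set \<Rightarrow> (real^2) set \<Rightarrow> polygon set \<Rightarrow> (real^2 \<Rightarrow> real^2) set" where
  "V_disc k \<Omega> \<Gamma>N \<Omega>h = {v \<in> V_space \<Omega> \<Gamma>N. \<forall>E\<in>\<Omega>h. v \<in> vem_local k E}"

definition Q_disc :: "nat \<Rightarrow> (real^2) set \<Rightarrow> polygon set \<Rightarrow> (real^2 \<Rightarrow> real) set" where
  "Q_disc k \<Omega> \<Omega>h = {q \<in> L2 \<Omega>. \<forall>E\<in>\<Omega>h. \<exists>p\<in>polys (int k). AE x in lebesgue_on (region E). q x = p x}"


section \<open>Degrees of freedom and discrete forms\<close>

text \<open>The degrees of freedom of \<open>vem_local k E\<close> are the moments against bases of
  \<open>P\<^sub>k(E)\<close> modulo constants, of \<open>P\<^sub>k\<^sub>-\<^sub>1(E)\<close>, and of \<open>P\<^sub>k(e)\<close> for each edge \<open>e\<close>. Rescaling a degree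
  of freedom is rescaling a basis element, so a choice of bases includes a choice of scaling;
  results stated for every choice of bases hold for every scaling.\<close>

record dof_bases =
  div_basis :: "polygon \<Rightarrow> (real^2 \<Rightarrow> real) list"
  curl_basis :: "polygon \<Rightarrow> (real^2 \<Rightarrow> real) list"
  edge_basis :: "polygon \<Rightarrow> (real^2) \<times> (real^2) \<Rightarrow> (real^2 \<Rightarrow> real) list"

definition is_poly_basis :: "int \<Rightarrow> (real^2) set \<Rightarrow> (real^2 \<Rightarrow> real) list \<Rightarrow> bool" where
  "is_poly_basis n \<omega> ps \<longleftrightarrow> set ps \<subseteq> polys n \<and>
     (\<forall>p\<in>polys n. \<exists>!a :: real list. length a = length ps \<and>
        (\<forall>x\<in>\<omega>. p x = (\<Sum>i<length ps. a ! i * (ps ! i) x)))"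

definition is_dof_bases :: "nat \<Rightarrow> polygon set \<Rightarrow> dof_bases \<Rightarrow> bool" where
  "is_dof_bases k \<Omega>h B \<longleftrightarrow> (\<forall>E\<in>\<Omega>h.
     is_poly_basis (int k) (region E) ((\<lambda>x. 1) # div_basis B E) \<and>
     is_poly_basis (int k - 1) (region E) (curl_basis B E) \<and>
     (\<forall>e\<in>edges E. is_poly_basis (int k) (edge_set e) (edge_basis B E e)))"

definition dofs :: "dof_bases \<Rightarrow> polygon \<Rightarrow> (real^2 \<Rightarrow> real^2) \<Rightarrow> real list" where
  "dofs B E w =
     map (\<lambda>p. l2_inner (region E) (wdiv (region E) w) p) (div_basis B E) @
     map (\<lambda>p. l2_inner (region E) w (\<lambda>x. p x *\<^sub>R perp x)) (curl_basis B E) @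
     concat (map (\<lambda>i. map (\<lambda>p. edge_integral (edge E i)
                                 (\<lambda>x. edge_trace (region E) w (edge E i) x * p x))
                            (edge_basis B E (edge E i))) [0..<length E])"

definition stab :: "dof_bases \<Rightarrow> polygon \<Rightarrow> (real^2 \<Rightarrow> real^2) \<Rightarrow> (real^2 \<Rightarrow> real^2) \<Rightarrow> real" where
  "stab B E v w = sum_list (map2 (*) (dofs B E v) (dofs B E w))"

definition m_local :: "nat \<Rightarrow> dof_bases \<Rightarrow> polygon \<Rightarrow> (real^2 \<Rightarrow> real^2) \<Rightarrow> (real^2 \<Rightarrow> real^2) \<Rightarrow> real" where
  "m_local k B E v w =
     l2_inner (region E) (vproj (int k) E v) (vproj (int k) E w) +
     (diameter (region E))\<^sup>2 *
       stab B E (\<lambda>x. v x - vproj (int k) E v x) (\<lambda>x. w x - vproj (int k) E w x)"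

definition m_form :: "nat \<Rightarrow> dof_bases \<Rightarrow> polygon set \<Rightarrow> (real^2 \<Rightarrow> real^2) \<Rightarrow> (real^2 \<Rightarrow> real^2) \<Rightarrow> real" where
  "m_form k B \<Omega>h v w = (\<Sum>E\<in>\<Omega>h. m_local k B E v w)"

definition n_form :: "(real^2) set \<Rightarrow> (real^2 \<Rightarrow> real) \<Rightarrow> (real^2 \<Rightarrow> real) \<Rightarrow> (real^2 \<Rightarrow> real) \<Rightarrow> real" where
  "n_form \<Omega> c p q = l2_inner \<Omega> (\<lambda>x. p x / (c x)\<^sup>2) q"

definition b_form :: "(real^2) set \<Rightarrow> (real^2 \<Rightarrow> real^2) \<Rightarrow> (real^2 \<Rightarrow> real) \<Rightarrow> real" where
  "b_form \<Omega> v q = l2_inner \<Omega> (wdiv \<Omega> v) q"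

definition energy_norm ::
  "(real^2) set \<Rightarrow> (real^2 \<Rightarrow> real) \<Rightarrow> (real^2 \<Rightarrow> real^2) \<Rightarrow> (real^2 \<Rightarrow> real) \<Rightarrow> real" where
  "energy_norm \<Omega> c v q = sqrt ((l2_norm \<Omega> v)\<^sup>2 + (l2_norm \<Omega> (\<lambda>x. q x / c x))\<^sup>2)"

definition disc_energy_norm ::
  "nat \<Rightarrow> dof_bases \<Rightarrow> (real^2) set \<Rightarrow> polygon set \<Rightarrow> (real^2 \<Rightarrow> real) \<Rightarrow>
   (real^2 \<Rightarrow> real^2) \<Rightarrow> (real^2 \<Rightarrow> real) \<Rightarrow> real" where
  "disc_energy_norm k B \<Omega> \<Omega>h c v q =
     sqrt (m_form k B \<Omega>h v v + (l2_norm \<Omega> (\<lambda>x. q x / c x))\<^sup>2)"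


section \<open>The \<open>\<theta>\<close>-method\<close>

definition theta_initial ::
  "nat \<Rightarrow> (real^2) set \<Rightarrow> polygon set \<Rightarrow> (real^2 \<Rightarrow> real^2) \<Rightarrow> (real^2 \<Rightarrow> real) \<Rightarrow>
   (real^2 \<Rightarrow> real^2) \<Rightarrow> (real^2 \<Rightarrow> real) \<Rightarrow> bool" where
  "theta_initial k \<Omega> \<Omega>h u\<^sub>0 p\<^sub>0 u p \<longleftrightarrow>
     (AE x in lebesgue_on \<Omega>. u x = global_vproj (int k) \<Omega>h u\<^sub>0 x) \<and>
     (AE x in lebesgue_on \<Omega>. p x = global_proj (int k) \<Omega>h p\<^sub>0 x)"

definition theta_step ::
  "nat \<Rightarrow> dof_bases \<Rightarrow> (real^2) set \<Rightarrow> (real^2) set \<Rightarrow> polygon set \<Rightarrow> (real^2 \<Rightarrow> real) \<Rightarrow> real \<Rightarrow> real \<Rightarrow>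
   (real^2 \<Rightarrow> real^2) \<Rightarrow> (real^2 \<Rightarrow> real) \<Rightarrow> (real^2 \<Rightarrow> real^2) \<Rightarrow> (real^2 \<Rightarrow> real) \<Rightarrow> bool" where
  "theta_step k B \<Omega> \<Gamma>N \<Omega>h c \<tau> \<theta> u p u' p' \<longleftrightarrow>
     (\<forall>v\<in>V_disc k \<Omega> \<Gamma>N \<Omega>h.
        m_form k B \<Omega>h (\<lambda>x. (1 / \<tau>) *\<^sub>R (u' x - u x)) v
          + b_form \<Omega> v (\<lambda>x. \<theta> * p' x + (1 - \<theta>) * p x) = 0) \<and>
     (\<forall>q\<in>Q_disc k \<Omega> \<Omega>h.
        n_form \<Omega> c (\<lambda>x. (p' x - p x) / \<tau>) q
          - b_form \<Omega> (\<lambda>x. \<theta> *\<^sub>R u' x + (1 - \<theta>) *\<^sub>R u x) q = 0)"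

end

theory Submission
  imports Defs
begin

text \<open>
  Testing the scheme with the \<open>\<theta>\<close>-averages of velocity and pressure makes the two
  coupling terms cancel and leaves
  \<open>\<E>\<^sub>h(n+1)\<^sup>2 - \<E>\<^sub>h(n)\<^sup>2 = - (2\<theta> - 1) \<delta>\<close>,
  where \<open>\<delta> \<ge> 0\<close> is the squared discrete energy of the increment (\<open>theta_step_energy\<close>). The sign of
  \<open>2\<theta> - 1\<close> decides between conservation, decay and growth. The identity of the
  initial energies holds because the stabilisation sees only the residual of the projection, which
  vanishes for piecewise polynomial data (\<open>initial_m_form\<close>).

  The algebra requires \<open>m\<^sub>h\<close> to be bilinear, and here lies the work: the weak divergence
  and the edge traces that enter the degrees of freedom are arbitrary choices among
  representatives. Their moments against polynomials are nevertheless well defined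
  (\<open>l2_inner_wdiv\<close>, \<open>edge_moment_unique\<close>), because smooth cut-off functions exhausting an open set
  (\<open>smooth_exhaustion\<close>) turn polynomials into admissible tests and dominated convergence removes
  the cut-off. The argument for edges uses that two edges of a simple polygon meet in finitely many
  points.

  The stabilisation is applied to \<open>v - \<Pi>v\<close>, so polynomial fields, too, must possess a weak
  divergence and an edge trace. This is Green's formula for functions that vanish on the boundary
  outside one edge (\<open>polygonal_Green\<close>). It is obtained by integrating along lines
  parallel to the axes: such a line generically meets the boundary in finitely many points, at most one of
  them on the edge, and the outward normal is recovered by inspecting on which side of that
  point the line runs inside the polygon.
\<close>

section \<open>Smooth functions and exhaustion of open sets\<close>

lemma partial_eq:
  assumes "(f has_derivative f') (at x)"
  shows "partial i f x = f' (axis i 1)"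
  using frechet_derivative_at[OF assms] by (simp add: partial_def)

lemma smooth_differentiable: "smooth \<phi> \<Longrightarrow> \<phi> differentiable (at x)"
  by (auto elim: smooth.cases)

lemma smooth_partial: "smooth \<phi> \<Longrightarrow> smooth (partial i \<phi>)"
  by (auto elim: smooth.cases)

lemma smooth_has_derivative: "smooth \<phi> \<Longrightarrow> (\<phi> has_derivative frechet_derivative \<phi> (at x)) (at x)"
  using smooth_differentiable frechet_derivative_works by blast

definition cutoff :: "nat \<Rightarrow> real \<Rightarrow> real" where
  "cutoff n t = (if t > 0 then inverse t ^ n * exp (- inverse t) else 0)"

text \<open>The derivatives of \<open>exp (- 1/t)\<close>, extended by \<open>0\<close> to \<open>t \<le> 0\<close>, are combinations of
  members of this family, which is what makes the family closed under differentiation.\<close>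

lemma cutoff_has_derivative:
  "(cutoff n has_real_derivative cutoff (n + 2) t - n * cutoff (Suc n) t) (at t)"
proof (cases t "0 :: real" rule: linorder_cases)
  case less
  have "((\<lambda>t. 0) has_real_derivative cutoff (n + 2) t - n * cutoff (Suc n) t) (at t)"
    using less by (simp add: cutoff_def)
  moreover have "eventually (\<lambda>s. s \<in> {..<0}) (nhds t)"
    using less by (intro eventually_nhds_in_open) auto
  then have "eventually (\<lambda>s. cutoff n s = 0) (nhds t)"
    by eventually_elim (auto simp: cutoff_def)
  ultimately show ?thesis
    using DERIV_cong_ev[OF refl, of "cutoff n" "\<lambda>_. 0" t] by simp
next
  case greater
  have "((\<lambda>t. inverse t ^ n * exp (- inverse t)) has_real_derivative
      inverse t ^ n * (exp (- inverse t) * (inverse t)\<^sup>2)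
        + real n * inverse t ^ (n - Suc 0) * (- (inverse t)\<^sup>2) * exp (- inverse t)) (at t)"
    using greater by (auto intro!: derivative_eq_intros simp: power2_eq_square)
  also have "inverse t ^ n * (exp (- inverse t) * (inverse t)\<^sup>2)
        + real n * inverse t ^ (n - Suc 0) * (- (inverse t)\<^sup>2) * exp (- inverse t) =
      cutoff (n + 2) t - n * cutoff (Suc n) t"
    using greater by (cases n) (simp_all add: cutoff_def power_add power2_eq_square algebra_simps)
  finally have "((\<lambda>t. inverse t ^ n * exp (- inverse t)) has_real_derivative
      cutoff (n + 2) t - n * cutoff (Suc n) t) (at t)" .
  moreover have "eventually (\<lambda>s. s \<in> {0<..}) (nhds t)"
    using greater by (intro eventually_nhds_in_open) auto
  then have "eventually (\<lambda>s. cutoff n s = inverse s ^ n * exp (- inverse s)) (nhds t)"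
    by eventually_elim (auto simp: cutoff_def)
  ultimately show ?thesis
    using DERIV_cong_ev[OF refl, of "cutoff n" "\<lambda>s. inverse s ^ n * exp (- inverse s)" t] by simp
next
  case equal
  have "((\<lambda>h. cutoff n h / h) \<longlongrightarrow> 0) (at_right 0)"
  proof (rule Lim_transform_eventually)
    show "((\<lambda>h. inverse h ^ Suc n / exp (inverse h)) \<longlongrightarrow> 0) (at_right (0::real))"
      by (rule filterlim_compose[OF tendsto_power_div_exp_0 filterlim_inverse_at_top_right])
    show "eventually (\<lambda>h. inverse h ^ Suc n / exp (inverse h) = cutoff n h / h) (at_right (0::real))"
      by (rule eventually_mono[OF eventually_at_right_less])
         (auto simp: cutoff_def exp_minus field_simps)
  qed
  moreover have "((\<lambda>h. cutoff n h / h) \<longlongrightarrow> 0) (at_left 0)"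
  proof (rule Lim_transform_eventually)
    show "((\<lambda>h. 0) \<longlongrightarrow> 0) (at_left (0::real))" by simp
    show "eventually (\<lambda>h. 0 = cutoff n h / h) (at_left (0::real))"
      by (auto simp: eventually_at_filter cutoff_def)
  qed
  ultimately have "((\<lambda>h. cutoff n h / h) \<longlongrightarrow> 0) (at 0)"
    by (rule filterlim_split_at[rotated])
  then show ?thesis
    unfolding DERIV_def using equal by (simp add: cutoff_def)
qed

lemma cutoff_nonneg: "0 \<le> cutoff 0 t" and cutoff_le_1: "cutoff 0 t \<le> 1"
  and cutoff_0: "t \<le> 0 \<Longrightarrow> cutoff n t = 0"
  by (auto simp: cutoff_def)

text \<open>A class of functions that is visibly closed under partial derivatives, built only to serve as
  the coinduction invariant from which the closure properties of \<open>smooth\<close> follow.\<close>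

inductive smooth_generated :: "(real^2 \<Rightarrow> real) \<Rightarrow> bool" where
  base: "smooth f \<Longrightarrow> smooth_generated f"
| const: "smooth_generated (\<lambda>x. c)"
| coord: "smooth_generated (\<lambda>x. x $ i)"
| cutoff: "smooth_generated f \<Longrightarrow> smooth_generated (\<lambda>x. cutoff n (f x))"
| add: "smooth_generated f \<Longrightarrow> smooth_generated g \<Longrightarrow> smooth_generated (\<lambda>x. f x + g x)"
| mult: "smooth_generated f \<Longrightarrow> smooth_generated g \<Longrightarrow> smooth_generated (\<lambda>x. f x * g x)"

lemma partial_mult:
  assumes "f differentiable (at x)" "g differentiable (at x)"
  shows "partial i (\<lambda>x. f x * g x) x = f x * partial i g x + partial i f x * g x"
  using partial_eq[OF has_derivative_mult[OF
      assms[unfolded frechet_derivative_works]], of i]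
  by (simp add: partial_def)

lemma partial_add:
  assumes "f differentiable (at x)" "g differentiable (at x)"
  shows "partial i (\<lambda>x. f x + g x) x = partial i f x + partial i g x"
  using partial_eq[OF has_derivative_add[OF
      assms[unfolded frechet_derivative_works]], of i]
  by (simp add: partial_def)

lemma smooth_generated_step:
  "smooth_generated f \<Longrightarrow> (\<forall>x. f differentiable (at x)) \<and> (\<forall>i. smooth_generated (partial i f))"
proof (induction rule: smooth_generated.induct)
  case (base f)
  then show ?case
    by (simp add: smooth_generated.base smooth_differentiable smooth_partial)
next
  case (const c)
  have "partial i (\<lambda>x. c) = (\<lambda>x. 0)" for i
    by (rule ext) (simp add: partial_def)
  then show ?case
    by (simp add: smooth_generated.const)
next
  case (coord j)
  have "((\<lambda>x::real^2. x $ j) has_derivative (\<lambda>h. h $ j)) (at x)" for x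
    by (rule bounded_linear_imp_has_derivative) (rule bounded_linear_vec_nth)
  note der = this
  have "partial i (\<lambda>x. x $ j) = (\<lambda>x. axis i 1 $ j)" for i
    by (rule ext) (rule partial_eq[OF der])
  moreover have "(\<lambda>x::real^2. x $ j) differentiable (at x)" for x
    by (rule differentiableI) (rule der)
  ultimately show ?case
    by (simp add: smooth_generated.const)
next
  case (cutoff f n)
  have der: "((\<lambda>x. cutoff n (f x)) has_derivative
      (\<lambda>h. frechet_derivative f (at x) h * (cutoff (n + 2) (f x) - n * cutoff (Suc n) (f x)))) (at x)" for x
  proof -
    have "(f has_derivative frechet_derivative f (at x)) (at x)"
      using cutoff.IH frechet_derivative_works by blast
    from has_derivative_compose[OF this
        cutoff_has_derivative[of n "f x", unfolded has_field_derivative_def]]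
    show ?thesis
      by (simp only: mult.commute)
  qed
  have "partial i (\<lambda>x. cutoff n (f x)) =
     (\<lambda>x. partial i f x * (cutoff (n + 2) (f x) + (- real n) * cutoff (Suc n) (f x)))" for i
    by (rule ext) (simp add: partial_eq[OF der], simp add: partial_def)
  moreover have "smooth_generated
      (\<lambda>x. partial i f x * (cutoff (n + 2) (f x) + (- real n) * cutoff (Suc n) (f x)))" for i
  proof (rule smooth_generated.mult)
    show "smooth_generated (partial i f)"
      using cutoff.IH by blast
    show "smooth_generated (\<lambda>x. cutoff (n + 2) (f x) + (- real n) * cutoff (Suc n) (f x))"
      by (intro smooth_generated.add smooth_generated.mult smooth_generated.const
         smooth_generated.cutoff cutoff.hyps)
  qed
  moreover have "(\<lambda>x. cutoff n (f x)) differentiable (at x)" for x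
    by (rule differentiableI) (rule der)
  ultimately show ?case
    by simp
next
  case (add f g)
  have "partial i (\<lambda>x. f x + g x) = (\<lambda>x. partial i f x + partial i g x)" for i
    by (rule ext, rule partial_add) (use add.IH in blast)+
  moreover have "(\<lambda>x. f x + g x) differentiable (at x)" for x
    using add.IH by (intro differentiable_add) blast+
  moreover have "smooth_generated (\<lambda>x. partial i f x + partial i g x)" for i
    by (rule smooth_generated.add) (use add.IH in blast)+
  ultimately show ?case by simp
next
  case (mult f g)
  have "partial i (\<lambda>x. f x * g x) = (\<lambda>x. f x * partial i g x + partial i f x * g x)" for i
    by (rule ext, rule partial_mult) (use mult.IH in blast)+
  moreover have "(\<lambda>x. f x * g x) differentiable (at x)" for x
    using mult.IH by (intro differentiable_mult) blast+
  moreover have "smooth_generated (\<lambda>x. f x * partial i g x + partial i f x * g x)" for i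
    by (rule smooth_generated.add; rule smooth_generated.mult) (simp_all add: mult)
  ultimately show ?case by simp
qed

lemma smooth_if_generated:
  assumes "smooth_generated f"
  shows "smooth f"
  using assms
proof (rule smooth.coinduct)
  fix g assume "smooth_generated g"
  from smooth_generated_step[OF this]
  show "\<exists>\<phi>. g = \<phi> \<and> (\<forall>x. \<phi> differentiable at x) \<and>
      (\<forall>i. smooth_generated (partial i \<phi>) \<or> smooth (partial i \<phi>))"
    by (intro exI[of _ g]) simp
qed

lemma smooth_const: "smooth (\<lambda>x. c)"
  by (rule smooth_if_generated) (rule smooth_generated.const)

lemma smooth_coord: "smooth (\<lambda>x. x $ i)"
  by (rule smooth_if_generated) (rule smooth_generated.coord)

lemma smooth_cutoff: "smooth f \<Longrightarrow> smooth (\<lambda>x. cutoff n (f x))"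
  by (rule smooth_if_generated, rule smooth_generated.cutoff, rule smooth_generated.base)

lemma smooth_add: "smooth f \<Longrightarrow> smooth g \<Longrightarrow> smooth (\<lambda>x. f x + g x)"
  by (rule smooth_if_generated, rule smooth_generated.add; rule smooth_generated.base)

lemma smooth_mult: "smooth f \<Longrightarrow> smooth g \<Longrightarrow> smooth (\<lambda>x. f x * g x)"
  by (rule smooth_if_generated, rule smooth_generated.mult; rule smooth_generated.base)

lemma smooth_power: "smooth f \<Longrightarrow> smooth (\<lambda>x. f x ^ n)"
  by (induction n) (auto intro: smooth_mult smooth_const)

lemma smooth_sum: "(\<And>i. i \<in> I \<Longrightarrow> smooth (f i)) \<Longrightarrow> smooth (\<lambda>x. \<Sum>i\<in>I. f i x)"
  by (induction I rule: infinite_finite_induct) (auto intro: smooth_add smooth_const)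

lemma smooth_prod: "(\<And>i. i \<in> I \<Longrightarrow> smooth (f i)) \<Longrightarrow> smooth (\<lambda>x. \<Prod>i\<in>I. f i x)"
  by (induction I rule: infinite_finite_induct) (auto intro: smooth_mult smooth_const)

lemma smooth_diff: "smooth f \<Longrightarrow> smooth g \<Longrightarrow> smooth (\<lambda>x. f x - g x)"
  using smooth_add[of f "\<lambda>x. -1 * g x"] smooth_mult[OF smooth_const[of "-1"], of g] by simp

lemma smooth_continuous: "smooth \<phi> \<Longrightarrow> continuous_on A \<phi>"
  by (intro continuous_at_imp_continuous_on ballI differentiable_imp_continuous_within
      smooth_differentiable)

lemma continuous_grad:
  assumes "smooth \<phi>"
  shows "continuous_on A (grad \<phi>)"
  unfolding grad_def by (intro continuous_intros smooth_continuous smooth_partial assms)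

definition bump :: "nat \<Rightarrow> real^2 \<Rightarrow> real^2 \<Rightarrow> real^2 \<Rightarrow> real" where
  "bump n a b x = (\<Prod>i\<in>UNIV. cutoff 0 (real n * (x $ i - a $ i)) * cutoff 0 (real n * (b $ i - x $ i)))"

lemma smooth_bump: "smooth (bump n a b)"
  unfolding bump_def[abs_def]
  by (intro smooth_prod smooth_mult smooth_cutoff smooth_diff smooth_const smooth_coord)

lemma bump_nonneg: "0 \<le> bump n a b x" and bump_le_1: "bump n a b x \<le> 1"
  by (auto simp: bump_def cutoff_nonneg cutoff_le_1 intro!: prod_nonneg prod_le_1 mult_le_one)

lemma bump_eq_0: "x \<notin> cbox a b \<Longrightarrow> bump n a b x = 0"
proof -
  assume "x \<notin> cbox a b"
  then obtain i where "x $ i < a $ i \<or> b $ i < x $ i"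
    by (auto simp: mem_box_cart not_le)
  then have "cutoff 0 (real n * (x $ i - a $ i)) * cutoff 0 (real n * (b $ i - x $ i)) = 0"
    using cutoff_0[OF mult_nonneg_nonpos[of "real n"]] by auto
  then show ?thesis
    unfolding bump_def by (intro prod_zero) auto
qed

lemma cutoff_tendsto: "t > 0 \<Longrightarrow> (\<lambda>n. cutoff 0 (real n * t)) \<longlonglongrightarrow> 1"
proof -
  assume "t > 0"
  have "filterlim (\<lambda>n. real n * t) at_top sequentially"
    by (rule filterlim_at_top_mult_tendsto_pos[OF tendsto_const \<open>t > 0\<close> filterlim_real_sequentially])
  then have "(\<lambda>n. exp (- inverse (real n * t))) \<longlonglongrightarrow> exp (- 0)"
    by (intro tendsto_intros tendsto_inverse_0_at_top)
  moreover have "eventually (\<lambda>n. exp (- inverse (real n * t)) = cutoff 0 (real n * t)) sequentially"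
    using eventually_gt_at_top[of 0] by eventually_elim (use \<open>t > 0\<close> in \<open>auto simp: cutoff_def\<close>)
  ultimately show ?thesis
    by (simp add: Lim_transform_eventually)
qed

lemma bump_tendsto:
  assumes "x \<in> box a b"
  shows "(\<lambda>n. bump n a b x) \<longlonglongrightarrow> 1"
proof -
  have "(\<lambda>n. bump n a b x) \<longlonglongrightarrow> (\<Prod>i\<in>(UNIV::2 set). 1 * 1)"
    unfolding bump_def using assms
    by (intro tendsto_prod tendsto_mult cutoff_tendsto) (auto simp: mem_box_cart)
  then show ?thesis by simp
qed

text \<open>Cover \<open>U\<close> by countably many boxes with closure in \<open>U\<close> and take
  \<open>1 - (\<Prod>j<n. 1 - \<beta>\<^sub>j)\<close>, where \<open>\<beta>\<^sub>j\<close> is a bump on the \<open>j\<close>-th box that steepens with \<open>n\<close>. Multiplying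
  by these cut-offs turns any smooth function into test functions that converge to it boundedly
  on \<open>U\<close>; this replaces density arguments throughout.\<close>

lemma smooth_exhaustion:
  fixes U :: "(real^2) set"
  assumes "open U"
  obtains \<eta> :: "nat \<Rightarrow> real^2 \<Rightarrow> real"
  where "\<And>n. \<eta> n \<in> test_functions U" "\<And>n x. 0 \<le> \<eta> n x" "\<And>n x. \<eta> n x \<le> 1"
    "\<And>x. x \<in> U \<Longrightarrow> (\<lambda>n. \<eta> n x) \<longlonglongrightarrow> 1"
proof -
  define \<F> where "\<F> = {box a b |a b. cbox a b \<subseteq> U}"
  obtain \<F>' where F': "\<F>' \<subseteq> \<F>" "countable \<F>'" "\<Union>\<F>' = \<Union>\<F>"
  proof (rule Lindelof[of \<F>])
    show "\<And>S. S \<in> \<F> \<Longrightarrow> open S" unfolding \<F>_def using open_box by blast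
  qed
  have "\<exists>p. S = box (fst p) (snd p) \<and> cbox (fst p) (snd p) \<subseteq> U" if "S \<in> \<F>'" for S
  proof -
    obtain a b where "S = box a b" "cbox a b \<subseteq> U"
      using \<open>S \<in> \<F>'\<close> F'(1) unfolding \<F>_def by blast
    then show ?thesis by (intro exI[of _ "(a, b)"]) simp
  qed
  note ex = this
  define c where "c S = (SOME p. S = box (fst p) (snd p) \<and> cbox (fst p) (snd p) \<subseteq> U)" for S
  have c: "S = box (fst (c S)) (snd (c S))" "cbox (fst (c S)) (snd (c S)) \<subseteq> U"
    if "S \<in> \<F>'" for S
    using someI_ex[OF ex[OF that], folded c_def] by (rule conjunct1, rule conjunct2)
  have cover: "\<exists>S\<in>\<F>'. x \<in> S" if "x \<in> U" for x
  proof -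
    obtain a b where "cbox a b \<subseteq> U" "x \<in> box a b"
      by (rule open_contains_cbox[OF \<open>open U\<close> \<open>x \<in> U\<close>]) blast
    then have "x \<in> \<Union>\<F>" unfolding \<F>_def by blast
    then show ?thesis using F'(3) by blast
  qed
  \<comment> \<open>Finitely many boxes at each stage, each box being included eventually.\<close>
  define I where "I n = {S \<in> \<F>'. to_nat_on \<F>' S < n}" for n
  have fin: "finite (I n)" for n
    unfolding I_def
    by (rule finite_imageD[of "to_nat_on \<F>'"])
       (auto intro: finite_subset[of _ "{..<n}"] inj_on_subset[OF inj_on_to_nat_on[OF F'(2)]])
  define \<eta> where "\<eta> n x = 1 - (\<Prod>S\<in>I n. 1 - bump n (fst (c S)) (snd (c S)) x)" for n x
  have ge0: "0 \<le> \<eta> n x" and le1: "\<eta> n x \<le> 1" for n x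
    by (auto simp: \<eta>_def bump_nonneg bump_le_1 intro!: prod_le_1 prod_nonneg)
  have "smooth (\<eta> n)" for n
    unfolding \<eta>_def[abs_def] by (intro smooth_diff smooth_prod smooth_const smooth_bump)
  moreover have "\<exists>K. compact K \<and> K \<subseteq> U \<and> (\<forall>x. x \<notin> K \<longrightarrow> \<eta> n x = 0)" for n
  proof (intro exI[of _ "\<Union>S\<in>I n. cbox (fst (c S)) (snd (c S))"] conjI allI impI)
    show "compact (\<Union>S\<in>I n. cbox (fst (c S)) (snd (c S)))"
      using fin by (intro compact_UN) auto
    show "(\<Union>S\<in>I n. cbox (fst (c S)) (snd (c S))) \<subseteq> U"
      using c(2) by (auto simp: I_def)
    fix x assume "x \<notin> (\<Union>S\<in>I n. cbox (fst (c S)) (snd (c S)))"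
    then show "\<eta> n x = 0"
      by (simp add: \<eta>_def bump_eq_0)
  qed
  ultimately have "\<eta> n \<in> test_functions U" for n
    by (simp add: test_functions_def)
  moreover have "(\<lambda>n. \<eta> n x) \<longlonglongrightarrow> 1" if x: "x \<in> U" for x
  proof -
    obtain S where S: "S \<in> \<F>'" "x \<in> S" using cover[OF x] by auto
    let ?\<beta> = "\<lambda>n. bump n (fst (c S)) (snd (c S)) x"
    have "eventually (\<lambda>n. ?\<beta> n \<le> \<eta> n x) sequentially"
      using eventually_gt_at_top[of "to_nat_on \<F>' S"]
    proof eventually_elim
      case (elim n)
      then have "S \<in> I n" using S by (simp add: I_def)
      then have "(\<Prod>S\<in>I n. 1 - bump n (fst (c S)) (snd (c S)) x) =
          (1 - ?\<beta> n) * (\<Prod>S\<in>I n - {S}. 1 - bump n (fst (c S)) (snd (c S)) x)"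
        using fin by (simp add: prod.remove)
      also have "\<dots> \<le> (1 - ?\<beta> n) * 1"
        by (intro mult_left_mono prod_le_1) (auto simp: bump_nonneg bump_le_1)
      finally show ?case by (simp add: \<eta>_def)
    qed
    moreover have "?\<beta> \<longlonglongrightarrow> 1"
      by (rule bump_tendsto) (use S c(1)[OF S(1)] in simp)
    ultimately show ?thesis
      using le1 by (intro tendsto_sandwich[OF _ _ \<open>?\<beta> \<longlonglongrightarrow> 1\<close> tendsto_const]) auto
  qed
  ultimately show thesis
    using ge0 le1 that by blast
qed

section \<open>Square-integrable fields on bounded sets\<close>

lemma L2_measurable: "f \<in> L2 \<omega> \<Longrightarrow> f \<in> borel_measurable (lebesgue_on \<omega>)"
  by (simp add: L2_def)

lemma L2_inner_integrable:
  assumes "f \<in> L2 \<omega>" "g \<in> L2 \<omega>"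
  shows "integrable (lebesgue_on \<omega>) (\<lambda>x. f x \<bullet> g x)"
proof (rule Bochner_Integration.integrable_bound)
  show "integrable (lebesgue_on \<omega>) (\<lambda>x. (norm (f x))\<^sup>2 + (norm (g x))\<^sup>2)"
    using assms by (simp add: L2_def)
  show "(\<lambda>x. f x \<bullet> g x) \<in> borel_measurable (lebesgue_on \<omega>)"
    using assms by (intro borel_measurable_inner L2_measurable)
  have "\<bar>a \<bullet> b\<bar> \<le> (norm a)\<^sup>2 + (norm b)\<^sup>2" for a b :: 'b
  proof -
    have "0 \<le> norm a * norm b" by simp
    then show ?thesis
      using Cauchy_Schwarz_ineq2[of a b] sum_squares_bound[of "norm a" "norm b"] by linarith
  qed
  then show "AE x in lebesgue_on \<omega>. norm (f x \<bullet> g x) \<le> norm ((norm (f x))\<^sup>2 + (norm (g x))\<^sup>2)"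
    by (simp add: abs_of_nonneg)
qed

lemma L2_add:
  assumes "f \<in> L2 \<omega>" "g \<in> L2 \<omega>"
  shows "(\<lambda>x. f x + g x) \<in> L2 \<omega>"
proof -
  have "integrable (lebesgue_on \<omega>) (\<lambda>x. (norm (f x))\<^sup>2 + (norm (g x))\<^sup>2 + 2 * (f x \<bullet> g x))"
    using assms L2_inner_integrable[OF assms] by (simp add: L2_def)
  moreover have "(norm (f x + g x))\<^sup>2 = (norm (f x))\<^sup>2 + (norm (g x))\<^sup>2 + 2 * (f x \<bullet> g x)" for x
    by (simp add: power2_norm_eq_inner inner_add inner_commute)
  moreover have "(\<lambda>x. f x + g x) \<in> borel_measurable (lebesgue_on \<omega>)"
    using assms by (intro borel_measurable_add L2_measurable)
  ultimately show ?thesis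
    by (simp add: L2_def)
qed

lemma L2_scaleR:
  assumes "f \<in> L2 \<omega>"
  shows "(\<lambda>x. a *\<^sub>R f x) \<in> L2 \<omega>"
  using assms borel_measurable_scaleR[OF borel_measurable_const L2_measurable[OF assms], of a]
  by (simp add: L2_def power_mult_distrib)

lemma L2_lincomb:
  "f \<in> L2 \<omega> \<Longrightarrow> g \<in> L2 \<omega> \<Longrightarrow> (\<lambda>x. a *\<^sub>R f x + b *\<^sub>R g x) \<in> L2 \<omega>"
  by (intro L2_add L2_scaleR)

lemma L2_zero: "(\<lambda>x. 0) \<in> L2 \<omega>"
  by (simp add: L2_def)

lemma continuous_measurable_lebesgue_on:
  fixes f :: "'a::euclidean_space \<Rightarrow> 'b::euclidean_space"
  shows "continuous_on UNIV f \<Longrightarrow> f \<in> borel_measurable (lebesgue_on \<omega>)"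
  using borel_measurable_continuous_onI[of f]
  by (intro measurable_restrict_space1 measurable_completion) simp

lemma bounded_measurable_imp_L2:
  fixes f :: "'a::euclidean_space \<Rightarrow> 'b::euclidean_space"
  assumes "f \<in> borel_measurable (lebesgue_on \<omega>)" "\<omega> \<in> lmeasurable"
    and "\<And>x. x \<in> \<omega> \<Longrightarrow> norm (f x) \<le> M"
  shows "f \<in> L2 \<omega>"
proof -
  have "integrable (lebesgue_on \<omega>) (\<lambda>x. (norm (f x))\<^sup>2)"
  proof (rule Bochner_Integration.integrable_bound)
    show "integrable (lebesgue_on \<omega>) (\<lambda>x. M\<^sup>2)"
      using assms(2) by (simp add: integrable_const_ivl finite_measure.integrable_const finite_measure_lebesgue_on)
    show "(\<lambda>x. (norm (f x))\<^sup>2) \<in> borel_measurable (lebesgue_on \<omega>)"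
      using assms(1) by measurable
    show "AE x in lebesgue_on \<omega>. norm ((norm (f x))\<^sup>2) \<le> norm (M\<^sup>2)"
      by (rule AE_I2) (use assms(2,3) in \<open>auto simp: space_restrict_space intro!: power_mono\<close>)
  qed
  with assms(1) show ?thesis by (simp add: L2_def)
qed

lemma continuous_imp_L2:
  fixes f :: "'a::euclidean_space \<Rightarrow> 'b::euclidean_space"
  assumes "continuous_on UNIV f" "bounded \<omega>" "\<omega> \<in> sets lebesgue"
  shows "f \<in> L2 \<omega>"
proof -
  have "bounded (f ` closure \<omega>)"
    using assms by (intro compact_imp_bounded compact_continuous_image)
      (auto intro: continuous_on_subset)
  then obtain M where "\<forall>y\<in>f ` closure \<omega>. norm y \<le> M"
    by (auto simp: bounded_iff)
  then have "\<And>x. x \<in> \<omega> \<Longrightarrow> norm (f x) \<le> M"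
    using closure_subset by blast
  then show ?thesis
    using assms by (intro bounded_measurable_imp_L2 continuous_measurable_lebesgue_on)
      (auto intro: bounded_set_imp_lmeasurable)
qed

lemma l2_inner_commute: "l2_inner \<omega> f g = l2_inner \<omega> g f"
  by (simp add: l2_inner_def inner_commute)

lemma l2_inner_nonneg: "0 \<le> l2_inner \<omega> f f"
  by (simp add: l2_inner_def integral_nonneg_AE)

lemma l2_norm_power2: "(l2_norm \<omega> f)\<^sup>2 = l2_inner \<omega> f f"
  by (simp add: l2_norm_def l2_inner_nonneg)

lemma l2_inner_lincomb_left:
  assumes "f \<in> L2 \<omega>" "g \<in> L2 \<omega>" "h \<in> L2 \<omega>"
  shows "l2_inner \<omega> (\<lambda>x. a *\<^sub>R f x + b *\<^sub>R g x) h = a * l2_inner \<omega> f h + b * l2_inner \<omega> g h"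
  using L2_inner_integrable[OF assms(1,3)] L2_inner_integrable[OF assms(2,3)]
  by (simp add: l2_inner_def inner_add_left)

lemma l2_inner_diff_left:
  assumes "f \<in> L2 \<omega>" "g \<in> L2 \<omega>" "h \<in> L2 \<omega>"
  shows "l2_inner \<omega> (\<lambda>x. f x - g x) h = l2_inner \<omega> f h - l2_inner \<omega> g h"
  using l2_inner_lincomb_left[OF assms, of 1 "-1"] by simp

lemma l2_inner_cong_AE:
  assumes "AE x in lebesgue_on \<omega>. f x = f' x" "f \<in> L2 \<omega>" "f' \<in> L2 \<omega>" "g \<in> L2 \<omega>"
  shows "l2_inner \<omega> f g = l2_inner \<omega> f' g"
  unfolding l2_inner_def using assms(1)
  by (intro integral_cong_AE borel_measurable_inner L2_measurable assms) auto

lemma smooth_imp_L2: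
  assumes "smooth \<phi>" "bounded \<omega>" "open \<omega>"
  shows "\<phi> \<in> L2 \<omega>" "grad \<phi> \<in> L2 \<omega>" "(\<lambda>x. perp (grad \<phi> x)) \<in> L2 \<omega>" "(\<lambda>x. \<phi> x *\<^sub>R perp x) \<in> L2 \<omega>"
proof -
  have perp: "continuous_on UNIV perp"
  proof -
    have eq: "perp = (\<lambda>x. (\<chi> i. if i = 1 then x $ 2 else - x $ 1))"
      by (auto simp: perp_def fun_eq_iff vec_eq_iff forall_2)
    show ?thesis
      unfolding eq
    proof (rule continuous_on_vec_lambda)
      fix i :: 2
      show "continuous_on UNIV (\<lambda>x::real^2. if i = 1 then x $ 2 else - x $ 1)"
        by (cases "i = 1") (auto intro!: continuous_intros)
    qed
  qed
  have "\<omega> \<in> sets lebesgue"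
    using \<open>open \<omega>\<close> by (simp add: borel_open)
  note L2 = continuous_imp_L2[OF _ \<open>bounded \<omega>\<close> this]
  show "\<phi> \<in> L2 \<omega>" "grad \<phi> \<in> L2 \<omega>"
    by (intro L2 smooth_continuous continuous_grad \<open>smooth \<phi>\<close>)+
  show "(\<lambda>x. perp (grad \<phi> x)) \<in> L2 \<omega>"
    by (intro L2 continuous_on_compose2[OF perp continuous_grad] \<open>smooth \<phi>\<close>) auto
  show "(\<lambda>x. \<phi> x *\<^sub>R perp x) \<in> L2 \<omega>"
    by (intro L2 continuous_on_scaleR perp smooth_continuous \<open>smooth \<phi>\<close>)
qed

section \<open>Uniqueness of weak divergences\<close>

lemma l2_inner_tendsto:
  fixes d \<psi> :: "'a::euclidean_space \<Rightarrow> real"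
  assumes "d \<in> L2 \<omega>" "\<psi> \<in> L2 \<omega>" "\<And>n. (\<lambda>x. \<psi> x * \<eta> n x) \<in> L2 \<omega>"
    and "\<And>n x. 0 \<le> \<eta> n x" "\<And>n x. \<eta> n x \<le> 1"
    and "AE x in lebesgue_on \<omega>. (\<lambda>n. \<eta> n x) \<longlonglongrightarrow> 1"
  shows "(\<lambda>n. l2_inner \<omega> d (\<lambda>x. \<psi> x * \<eta> n x)) \<longlonglongrightarrow> l2_inner \<omega> d \<psi>"
  unfolding l2_inner_def
proof (rule integral_dominated_convergence)
  show "integrable (lebesgue_on \<omega>) (\<lambda>x. norm (d x \<bullet> \<psi> x))"
    by (rule integrable_norm[OF L2_inner_integrable[OF assms(1,2)]])
  show "(\<lambda>x. d x \<bullet> \<psi> x) \<in> borel_measurable (lebesgue_on \<omega>)"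
    by (rule borel_measurable_integrable[OF L2_inner_integrable[OF assms(1,2)]])
  show "(\<lambda>x. d x \<bullet> (\<psi> x * \<eta> n x)) \<in> borel_measurable (lebesgue_on \<omega>)" for n
    by (rule borel_measurable_integrable[OF L2_inner_integrable[OF assms(1,3)]])
  show "AE x in lebesgue_on \<omega>. (\<lambda>n. d x \<bullet> (\<psi> x * \<eta> n x)) \<longlonglongrightarrow> d x \<bullet> \<psi> x"
    using assms(6)
  proof eventually_elim
    case (elim x)
    then have "(\<lambda>n. d x \<bullet> (\<psi> x * \<eta> n x)) \<longlonglongrightarrow> d x \<bullet> (\<psi> x * 1)"
      by (intro tendsto_intros)
    then show ?case by simp
  qed
  show "AE x in lebesgue_on \<omega>. norm (d x \<bullet> (\<psi> x * \<eta> n x)) \<le> norm (d x \<bullet> \<psi> x)" for n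
    using assms(4,5) by (auto simp: abs_mult mult_left_le mult.assoc[symmetric])
qed

text \<open>Fundamental lemma of the calculus of variations in the form needed here: smooth functions that
  do not vanish near the boundary are limits of test functions by \<open>smooth_exhaustion\<close>, and
  dominated convergence applies because \<open>\<omega>\<close> is bounded.\<close>

lemma l2_inner_eq_0_smooth:
  assumes "open \<omega>" "bounded \<omega>" "d \<in> L2 \<omega>" "smooth \<psi>"
    and "\<And>\<phi>. \<phi> \<in> test_functions \<omega> \<Longrightarrow> l2_inner \<omega> d \<phi> = 0"
  shows "l2_inner \<omega> d \<psi> = 0"
proof -
  obtain \<eta> where \<eta>: "\<And>n. \<eta> n \<in> test_functions \<omega>" "\<And>n x. 0 \<le> \<eta> n x" "\<And>n x. \<eta> n x \<le> 1"
    "\<And>x. x \<in> \<omega> \<Longrightarrow> (\<lambda>n. \<eta> n x) \<longlonglongrightarrow> 1"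
    using smooth_exhaustion[OF \<open>open \<omega>\<close>] by blast
  have test: "(\<lambda>x. \<psi> x * \<eta> n x) \<in> test_functions \<omega>" for n
  proof -
    from \<eta>(1)[of n] obtain K where K: "smooth (\<eta> n)" "compact K" "K \<subseteq> \<omega>" "\<And>x. x \<notin> K \<Longrightarrow> \<eta> n x = 0"
      unfolding test_functions_def by blast
    then have "\<forall>x. x \<notin> K \<longrightarrow> \<psi> x * \<eta> n x = 0" by simp
    with K(2,3) smooth_mult[OF \<open>smooth \<psi>\<close> K(1)] show ?thesis
      unfolding test_functions_def by blast
  qed
  have L2: "\<phi> \<in> L2 \<omega>" if "smooth \<phi>" for \<phi>
    by (rule smooth_imp_L2(1)[OF that assms(2,1)])
  have "(\<lambda>n. l2_inner \<omega> d (\<lambda>x. \<psi> x * \<eta> n x)) \<longlonglongrightarrow> l2_inner \<omega> d \<psi>"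
  proof (rule l2_inner_tendsto[OF assms(3) L2[OF assms(4)]])
    show "(\<lambda>x. \<psi> x * \<eta> n x) \<in> L2 \<omega>" for n
      using test[of n] by (intro L2) (simp add: test_functions_def)
    show "AE x in lebesgue_on \<omega>. (\<lambda>n. \<eta> n x) \<longlonglongrightarrow> 1"
      by (rule AE_I2) (simp add: \<eta>)
  qed (rule \<eta>)+
  moreover have "l2_inner \<omega> d (\<lambda>x. \<psi> x * \<eta> n x) = 0" for n
    by (rule assms(5)[OF test])
  ultimately have "(\<lambda>n. 0) \<longlonglongrightarrow> l2_inner \<omega> d \<psi>" by simp
  then show ?thesis
    by (rule LIMSEQ_unique[OF _ tendsto_const])
qed

lemma test_functionsD: "\<phi> \<in> test_functions \<omega> \<Longrightarrow> smooth \<phi>"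
  by (simp add: test_functions_def)

lemma has_weak_div_L2: "has_weak_div \<omega> v d \<Longrightarrow> v \<in> L2 \<omega>" "has_weak_div \<omega> v d \<Longrightarrow> d \<in> L2 \<omega>"
  by (auto simp: has_weak_div_def)

lemma has_weak_div_wdiv: "has_weak_div \<omega> v d \<Longrightarrow> has_weak_div \<omega> v (wdiv \<omega> v)"
  unfolding wdiv_def by (rule someI[of "has_weak_div \<omega> v"])

text \<open>Although \<open>wdiv\<close> is an arbitrary choice among weak divergences, its moments are not; this is
  the source of every linearity statement about \<open>wdiv\<close>.\<close>

lemma l2_inner_wdiv:
  assumes "open \<omega>" "bounded \<omega>" "has_weak_div \<omega> v d" "smooth \<psi>"
  shows "l2_inner \<omega> (wdiv \<omega> v) \<psi> = l2_inner \<omega> d \<psi>"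
proof -
  note d = assms(3) has_weak_div_wdiv[OF assms(3)]
  have "l2_inner \<omega> (\<lambda>x. wdiv \<omega> v x - d x) \<psi> = 0"
  proof (rule l2_inner_eq_0_smooth[OF assms(1,2) _ assms(4)])
    show "(\<lambda>x. wdiv \<omega> v x - d x) \<in> L2 \<omega>"
      using L2_lincomb[OF d[THEN has_weak_div_L2(2)], of "-1" 1] by simp
    fix \<phi> assume "\<phi> \<in> test_functions \<omega>"
    moreover from this have "\<phi> \<in> L2 \<omega>"
      using assms test_functionsD by (intro smooth_imp_L2) auto
    ultimately show "l2_inner \<omega> (\<lambda>x. wdiv \<omega> v x - d x) \<phi> = 0"
      using d by (subst l2_inner_diff_left) (auto simp: has_weak_div_def)
  qed
  then show ?thesis
    using assms d[THEN has_weak_div_L2(2)] by (simp add: l2_inner_diff_left smooth_imp_L2)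
qed

lemma has_weak_div_lincomb:
  assumes "open \<omega>" "bounded \<omega>" "has_weak_div \<omega> v d" "has_weak_div \<omega> w e"
  shows "has_weak_div \<omega> (\<lambda>x. a *\<^sub>R v x + b *\<^sub>R w x) (\<lambda>x. a *\<^sub>R d x + b *\<^sub>R e x)"
  using assms smooth_imp_L2[OF test_functionsD \<open>bounded \<omega>\<close> \<open>open \<omega>\<close>]
  unfolding has_weak_div_def by (auto simp only: l2_inner_lincomb_left L2_lincomb)

lemma has_weak_curl_lincomb:
  assumes "open \<omega>" "bounded \<omega>" "has_weak_curl \<omega> v d" "has_weak_curl \<omega> w e"
  shows "has_weak_curl \<omega> (\<lambda>x. a *\<^sub>R v x + b *\<^sub>R w x) (\<lambda>x. a *\<^sub>R d x + b *\<^sub>R e x)"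
  using assms smooth_imp_L2[OF test_functionsD \<open>bounded \<omega>\<close> \<open>open \<omega>\<close>]
  unfolding has_weak_curl_def by (auto simp only: l2_inner_lincomb_left L2_lincomb)

lemma l2_inner_wdiv_lincomb:
  assumes "open \<omega>" "bounded \<omega>" "v \<in> Hdiv \<omega>" "w \<in> Hdiv \<omega>" "smooth \<psi>"
  shows "l2_inner \<omega> (wdiv \<omega> (\<lambda>x. a *\<^sub>R v x + b *\<^sub>R w x)) \<psi> =
     a * l2_inner \<omega> (wdiv \<omega> v) \<psi> + b * l2_inner \<omega> (wdiv \<omega> w) \<psi>"
proof -
  obtain d e where de: "has_weak_div \<omega> v d" "has_weak_div \<omega> w e"
    using assms by (auto simp: Hdiv_def)
  show ?thesis
    using de[THEN has_weak_div_L2(2)] assms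
    by (simp add: l2_inner_wdiv[OF assms(1,2) de(1) assms(5)] l2_inner_wdiv[OF assms(1,2) de(2) assms(5)]
        l2_inner_wdiv[OF assms(1,2) has_weak_div_lincomb[OF assms(1,2) de] assms(5)]
        l2_inner_lincomb_left smooth_imp_L2 del: real_scaleR_def)
qed

lemma Hdiv_lincomb:
  "open \<omega> \<Longrightarrow> bounded \<omega> \<Longrightarrow> v \<in> Hdiv \<omega> \<Longrightarrow> w \<in> Hdiv \<omega> \<Longrightarrow> (\<lambda>x. a *\<^sub>R v x + b *\<^sub>R w x) \<in> Hdiv \<omega>"
  using has_weak_div_lincomb unfolding Hdiv_def by blast

lemma Hcurl_lincomb:
  "open \<omega> \<Longrightarrow> bounded \<omega> \<Longrightarrow> v \<in> Hcurl \<omega> \<Longrightarrow> w \<in> Hcurl \<omega> \<Longrightarrow> (\<lambda>x. a *\<^sub>R v x + b *\<^sub>R w x) \<in> Hcurl \<omega>"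
  using has_weak_curl_lincomb unfolding Hcurl_def by blast

lemma Hdiv_L2: "v \<in> Hdiv \<omega> \<Longrightarrow> v \<in> L2 \<omega>"
  by (auto simp: Hdiv_def dest: has_weak_div_L2)

lemma normal_trace_lincomb:
  assumes "open \<omega>" "bounded \<omega>" "v \<in> Hdiv \<omega>" "w \<in> Hdiv \<omega>" "smooth \<psi>"
  shows "normal_trace \<omega> (\<lambda>x. a *\<^sub>R v x + b *\<^sub>R w x) \<psi> =
     a * normal_trace \<omega> v \<psi> + b * normal_trace \<omega> w \<psi>"
  using assms
  by (simp add: normal_trace_def l2_inner_wdiv_lincomb l2_inner_lincomb_left Hdiv_L2 smooth_imp_L2
      algebra_simps)

lemma zero_normal_trace_lincomb:
  assumes "open \<omega>" "bounded \<omega>" "v \<in> Hdiv \<omega>" "w \<in> Hdiv \<omega>"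
    "zero_normal_trace_on \<omega> \<Sigma> v" "zero_normal_trace_on \<omega> \<Sigma> w"
  shows "zero_normal_trace_on \<omega> \<Sigma> (\<lambda>x. a *\<^sub>R v x + b *\<^sub>R w x)"
  using assms by (simp add: zero_normal_trace_on_def normal_trace_lincomb trace_tests_def)

lemma V_space_lincomb:
  assumes "open \<Omega>" "bounded \<Omega>" "v \<in> V_space \<Omega> \<Gamma>" "w \<in> V_space \<Omega> \<Gamma>"
  shows "(\<lambda>x. a *\<^sub>R v x + b *\<^sub>R w x) \<in> V_space \<Omega> \<Gamma>"
  using assms by (simp add: V_space_def Hdiv_lincomb zero_normal_trace_lincomb)

section \<open>Polynomials and the elementwise projection\<close>

definition monomial_span :: "(nat \<times> nat) set \<Rightarrow> (real^2 \<Rightarrow> real) set" where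
  "monomial_span I = {p. \<exists>a. p = (\<lambda>x. \<Sum>(i, j)\<in>I. a i j * (x $ 1) ^ i * (x $ 2) ^ j)}"

lemma polys_eq_span: "polys n = monomial_span {(i, j). int (i + j) \<le> n}"
  by (simp add: polys_def monomial_span_def)

lemma finite_degrees: "finite {(i, j). int (i + j) \<le> n}"
  by (rule finite_subset[of _ "{..nat n} \<times> {..nat n}"]) auto

lemma monomial_span_lincomb:
  assumes "p \<in> monomial_span I" "q \<in> monomial_span I"
  shows "(\<lambda>x. a * p x + b * q x) \<in> monomial_span I"
proof -
  obtain c d where "p = (\<lambda>x. \<Sum>(i, j)\<in>I. c i j * (x $ 1) ^ i * (x $ 2) ^ j)"
      "q = (\<lambda>x. \<Sum>(i, j)\<in>I. d i j * (x $ 1) ^ i * (x $ 2) ^ j)"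
    using assms unfolding monomial_span_def by blast
  then have "(\<lambda>x. a * p x + b * q x) =
     (\<lambda>x. \<Sum>(i, j)\<in>I. (a * c i j + b * d i j) * (x $ 1) ^ i * (x $ 2) ^ j)"
    by (simp add: sum_distrib_left sum.distrib[symmetric] algebra_simps case_prod_beta)
  then show ?thesis
    unfolding monomial_span_def mem_Collect_eq by (rule exI[of _ "\<lambda>i j. a * c i j + b * d i j"])
qed

lemma monomial_span_mono:
  assumes "finite J" "I \<subseteq> J" "p \<in> monomial_span I"
  shows "p \<in> monomial_span J"
proof -
  obtain c where p: "p = (\<lambda>x. \<Sum>(i, j)\<in>I. c i j * (x $ 1) ^ i * (x $ 2) ^ j)"
    using assms unfolding monomial_span_def by blast
  have "p = (\<lambda>x. \<Sum>(i, j)\<in>J. (if (i, j) \<in> I then c i j else 0) * (x $ 1) ^ i * (x $ 2) ^ j)"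
    unfolding p by (rule ext, rule sum.mono_neutral_cong_left) (use assms in auto)
  then show ?thesis
    unfolding monomial_span_def mem_Collect_eq
    by (rule exI[of _ "\<lambda>i j. if (i, j) \<in> I then c i j else 0"])
qed

lemma monomial_span_insert:
  assumes "finite I" "(i, j) \<notin> I" "p \<in> monomial_span (insert (i, j) I)"
  obtains a r where "r \<in> monomial_span I" "p = (\<lambda>x. a * ((x $ 1) ^ i * (x $ 2) ^ j) + r x)"
proof -
  obtain c where p: "p = (\<lambda>x. \<Sum>(i, j)\<in>insert (i, j) I. c i j * (x $ 1) ^ i * (x $ 2) ^ j)"
    using assms(3) unfolding monomial_span_def by blast
  show thesis
  proof (rule that)
    show "(\<lambda>x. \<Sum>(i, j)\<in>I. c i j * (x $ 1) ^ i * (x $ 2) ^ j) \<in> monomial_span I"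
      unfolding monomial_span_def by blast
    show "p = (\<lambda>x. c i j * ((x $ 1) ^ i * (x $ 2) ^ j) +
        (\<Sum>(i, j)\<in>I. c i j * (x $ 1) ^ i * (x $ 2) ^ j))"
      unfolding p using assms(1,2) by (simp add: mult.assoc)
  qed
qed

lemma smooth_monomial: "smooth (\<lambda>x. (x $ 1) ^ i * (x $ 2) ^ j)"
  by (intro smooth_mult smooth_power smooth_coord)

lemma monomial_span_smooth:
  assumes "p \<in> monomial_span I"
  shows "smooth p"
proof -
  obtain c where p: "p = (\<lambda>x. \<Sum>(i, j)\<in>I. c i j * (x $ 1) ^ i * (x $ 2) ^ j)"
    using assms unfolding monomial_span_def by blast
  show ?thesis
    unfolding p case_prod_beta
    by (intro smooth_sum smooth_mult smooth_power smooth_coord smooth_const)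
qed

lemma polys_smooth: "p \<in> polys n \<Longrightarrow> smooth p"
  by (simp add: polys_eq_span monomial_span_smooth)

lemma polys_lincomb:
  "p \<in> polys n \<Longrightarrow> q \<in> polys n \<Longrightarrow> (\<lambda>x. a * p x + b * q x) \<in> polys n"
  by (simp add: polys_eq_span monomial_span_lincomb)

text \<open>Restricted to the line through a point of \<open>\<omega>\<close> and an arbitrary point, a polynomial has
  infinitely many zeros near the former, hence vanishes at the latter. This is why the projection
  is unique as a function on the whole plane.\<close>

lemma polys_eq_0_if_open:
  assumes "p \<in> polys n" "open \<omega>" "\<omega> \<noteq> {}" "\<And>x. x \<in> \<omega> \<Longrightarrow> p x = 0"
  shows "p = (\<lambda>x. 0)"
proof
  fix y
  obtain x where x: "x \<in> \<omega>" using assms by auto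
  obtain a where p: "p = (\<lambda>x. \<Sum>(i, j)\<in>{(i, j). int (i + j) \<le> n}. a i j * (x $ 1) ^ i * (x $ 2) ^ j)"
    using assms unfolding polys_def by blast
  define f where "f t = p (x + t *\<^sub>R (y - x))" for t
  have lin: "real_polynomial_function (\<lambda>t. x $ i + t * (y $ i - x $ i))" for i
    by (rule real_polynomial_function.intros(3), rule real_polynomial_function.intros(2),
        rule real_polynomial_function.intros(4), rule real_polynomial_function.intros(1),
        rule bounded_linear_ident, rule real_polynomial_function.intros(2))
  have "real_polynomial_function f"
    unfolding f_def p case_prod_beta
  proof (rule real_polynomial_function_sum)
    show "finite {p. int (fst p + snd p) \<le> n}"
      by (rule finite_subset[OF _ finite_degrees[of n]]) auto
    fix ij
    show "real_polynomial_function (\<lambda>t. a (fst ij) (snd ij) *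
        ((x + t *\<^sub>R (y - x)) $ 1) ^ fst ij * ((x + t *\<^sub>R (y - x)) $ 2) ^ snd ij)"
      using lin by (simp add: real_polynomial_function.intros real_polynomial_function_power)
  qed
  then obtain c m where f: "f = (\<lambda>t. \<Sum>i\<le>m. c i * t ^ i)"
    using real_polynomial_function_imp_sum by blast
  have "((\<lambda>t. x + t *\<^sub>R (y - x)) \<longlongrightarrow> x + 0 *\<^sub>R (y - x)) (at 0)"
    by (intro tendsto_intros)
  then have "eventually (\<lambda>t. x + t *\<^sub>R (y - x) \<in> \<omega>) (at 0)"
    using x \<open>open \<omega>\<close> by (intro topological_tendstoD) auto
  then have "eventually (\<lambda>t. f t = 0) (at (0::real))"
    by eventually_elim (simp add: f_def assms(4))
  then obtain e where e: "e > 0" "\<And>t. t \<noteq> 0 \<Longrightarrow> dist t 0 < e \<Longrightarrow> f t = 0"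
    unfolding eventually_at by auto
  have "{0<..<e} \<subseteq> {t. (\<Sum>i\<le>m. c i * t ^ i) = 0}"
    using e(2) unfolding f by (auto simp: dist_real_def)
  then have "infinite {t. (\<Sum>i\<le>m. c i * t ^ i) = 0}"
    using infinite_super[OF _ infinite_Ioo[OF \<open>e > 0\<close>]] by blast
  then have "\<forall>k\<le>m. c k = 0"
    using polyfun_rootbound_finite by blast
  then have "f 1 = 0" by (simp add: f)
  then show "p y = 0" by (simp add: f_def)
qed

lemma l2_inner_cong:
  assumes "\<And>x. x \<in> \<omega> \<Longrightarrow> f x = f' x" "\<And>x. x \<in> \<omega> \<Longrightarrow> g x = g' x"
  shows "l2_inner \<omega> f g = l2_inner \<omega> f' g'"
  unfolding l2_inner_def
  by (rule Bochner_Integration.integral_cong) (auto simp: space_restrict_space assms)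

lemma l2_inner_definite:
  fixes h :: "real^2 \<Rightarrow> real"
  assumes "open \<omega>" "bounded \<omega>" "continuous_on UNIV h" "l2_inner \<omega> h h = 0" "x \<in> \<omega>"
  shows "h x = 0"
proof -
  have \<omega>: "\<omega> \<in> sets lebesgue"
    using \<open>open \<omega>\<close> by (simp add: borel_open)
  have h: "h \<in> L2 \<omega>"
    by (rule continuous_imp_L2[OF assms(3,2) \<omega>])
  have "AE x in lebesgue_on \<omega>. h x \<bullet> h x = 0"
    using assms(4) integral_nonneg_eq_0_iff_AE[OF L2_inner_integrable[OF h h]]
    by (simp add: l2_inner_def)
  then have "AE x in lebesgue. x \<in> \<omega> \<longrightarrow> h x = 0"
    using \<omega> by (simp add: AE_restrict_space_iff)
  moreover have "closed {x. h x = 0}"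
    using continuous_closed_vimage[of "{0}" h] assms(3)
    by (simp add: continuous_on_eq_continuous_at vimage_def)
  ultimately show ?thesis
    using mem_closed_if_AE_lebesgue_open[OF \<open>open \<omega>\<close>, of "{x. h x = 0}" x] \<open>x \<in> \<omega>\<close> by simp
qed

lemma l2_inner_lincomb_right:
  assumes "f \<in> L2 \<omega>" "g \<in> L2 \<omega>" "h \<in> L2 \<omega>"
  shows "l2_inner \<omega> h (\<lambda>x. a *\<^sub>R f x + b *\<^sub>R g x) = a * l2_inner \<omega> h f + b * l2_inner \<omega> h g"
  using l2_inner_lincomb_left[OF assms] by (simp add: l2_inner_commute[of \<omega> h])

lemma L2_diff: "f \<in> L2 \<omega> \<Longrightarrow> g \<in> L2 \<omega> \<Longrightarrow> (\<lambda>x. f x - g x) \<in> L2 \<omega>"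
  using L2_lincomb[of f \<omega> g 1 "-1"] by simp

text \<open>One Gram-Schmidt step per monomial. If the new direction \<open>h\<close> has norm zero then it vanishes on
  \<open>\<omega>\<close>, and nothing has to be added.\<close>

lemma projection_exists:
  assumes \<omega>: "open \<omega>" "bounded \<omega>" and "finite I"
  shows "f \<in> L2 \<omega> \<Longrightarrow>
    \<exists>q\<in>monomial_span I. \<forall>p\<in>monomial_span I. l2_inner \<omega> (\<lambda>x. f x - q x) p = 0"
  using \<open>finite I\<close>
proof (induction I arbitrary: f rule: finite_induct)
  case empty
  have "monomial_span {} = {\<lambda>x. 0}"
    by (auto simp: monomial_span_def)
  then show ?case by (simp add: l2_inner_def)
next
  case (insert ij I)
  obtain i j where ij: "ij = (i, j)" by (cases ij)
  define \<mu> :: "real^2 \<Rightarrow> real" where "\<mu> x = (x $ 1) ^ i * (x $ 2) ^ j" for x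
  note L2 = smooth_imp_L2(1)[OF _ \<omega>(2,1)] smooth_imp_L2(1)[OF monomial_span_smooth \<omega>(2,1)]
  have \<mu>: "smooth \<mu>" "\<mu> \<in> L2 \<omega>"
    unfolding \<mu>_def[abs_def] by (intro L2 smooth_monomial)+
  obtain r where r: "r \<in> monomial_span I" "\<And>p. p \<in> monomial_span I \<Longrightarrow> l2_inner \<omega> (\<lambda>x. \<mu> x - r x) p = 0"
    using insert.IH[OF \<mu>(2)] by blast
  obtain q where q: "q \<in> monomial_span I" "\<And>p. p \<in> monomial_span I \<Longrightarrow> l2_inner \<omega> (\<lambda>x. f x - q x) p = 0"
    using insert.IH[OF insert.prems] by blast
  define h where "h x = \<mu> x - r x" for x
  have h: "smooth h" "h \<in> L2 \<omega>" "\<And>p. p \<in> monomial_span I \<Longrightarrow> l2_inner \<omega> h p = 0"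
    using \<mu> r L2 unfolding h_def[abs_def] by (auto intro: smooth_diff L2_diff monomial_span_smooth)
  define \<alpha> where "\<alpha> = l2_inner \<omega> (\<lambda>x. f x - q x) h / l2_inner \<omega> h h"
  have fq: "(\<lambda>x. f x - q x) \<in> L2 \<omega>"
    using insert.prems q L2 by (intro L2_diff)
  have orth: "l2_inner \<omega> (\<lambda>x. f x - q x) h - \<alpha> * l2_inner \<omega> h h = 0"
  proof (cases "l2_inner \<omega> h h = 0")
    case True
    then have "h x = 0" if "x \<in> \<omega>" for x
      using l2_inner_definite[OF \<omega> smooth_continuous[OF h(1)]] that by blast
    then have "l2_inner \<omega> (\<lambda>x. f x - q x) h = l2_inner \<omega> (\<lambda>x. f x - q x) (\<lambda>x. 0)"
      by (intro l2_inner_cong) auto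
    then show ?thesis
      using True by (simp add: l2_inner_def)
  qed (simp add: \<alpha>_def)
  have \<mu>span: "\<mu> \<in> monomial_span (insert ij I)"
  proof (rule monomial_span_mono)
    have "\<mu> = (\<lambda>x. \<Sum>(i, j)\<in>{ij}. 1 * (x $ 1) ^ i * (x $ 2) ^ j)"
      by (simp add: ij \<mu>_def[abs_def])
    then show "\<mu> \<in> monomial_span {ij}"
      unfolding monomial_span_def mem_Collect_eq by (rule exI[of _ "\<lambda>i j. 1"])
  qed (use insert.hyps(1) in auto)
  have sub: "p \<in> monomial_span (insert ij I)" if "p \<in> monomial_span I" for p
    using that insert.hyps(1) by (intro monomial_span_mono[of "insert ij I" I]) auto
  define q' where "q' x = 1 * q x + \<alpha> * (1 * \<mu> x + (- 1) * r x)" for x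
  have q': "q' \<in> monomial_span (insert ij I)"
    unfolding q'_def[abs_def] by (intro monomial_span_lincomb \<mu>span sub q(1) r(1))
  have q'_eq: "(\<lambda>x. f x - q' x) = (\<lambda>x. 1 *\<^sub>R (f x - q x) + (- \<alpha>) *\<^sub>R h x)"
    by (simp add: q'_def h_def algebra_simps)
  have "l2_inner \<omega> (\<lambda>x. f x - q' x) p = 0" if p: "p \<in> monomial_span (insert ij I)" for p
  proof -
    obtain b s where s: "s \<in> monomial_span I" "p = (\<lambda>x. b * ((x $ 1) ^ i * (x $ 2) ^ j) + s x)"
      using monomial_span_insert[OF insert.hyps(1) _ p[unfolded ij]] insert.hyps(2) ij by blast
    define s' where "s' x = b * r x + 1 * s x" for x
    have s': "s' \<in> monomial_span I"
      unfolding s'_def[abs_def] by (intro monomial_span_lincomb r(1) s(1))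
    have p_eq: "p = (\<lambda>x. b *\<^sub>R h x + 1 *\<^sub>R s' x)"
      by (simp add: s(2) h_def s'_def \<mu>_def algebra_simps)
    note s'L2 = L2(2)[OF s']
    have "l2_inner \<omega> (\<lambda>x. f x - q' x) p =
        b * (l2_inner \<omega> (\<lambda>x. f x - q x) h - \<alpha> * l2_inner \<omega> h h)
        + (l2_inner \<omega> (\<lambda>x. f x - q x) s' - \<alpha> * l2_inner \<omega> h s')"
      unfolding q'_eq p_eq
      by (simp only: l2_inner_lincomb_right[OF h(2) s'L2 L2_lincomb[OF fq h(2)]]
          l2_inner_lincomb_left[OF fq h(2) h(2)] l2_inner_lincomb_left[OF fq h(2) s'L2])
         (simp add: algebra_simps)
    then show ?thesis
      using orth q(2)[OF s'] h(3)[OF s'] by simp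
  qed
  with q' show ?case by blast
qed

lemma path_vertex_path:
  "vs \<noteq> [] \<Longrightarrow> path (vertex_path vs) \<and> pathstart (vertex_path vs) = hd vs \<and> pathfinish (vertex_path vs) = last vs"
  by (induction vs rule: vertex_path.induct) (auto simp: path_join_eq)

lemma region_open: "open (region E)" and region_bounded: "bounded (region E)"
  and region_frontier: "frontier (region E) \<subseteq> path_image (boundary_path E)"
proof -
  have "compact (path_image (boundary_path E))"
    using path_vertex_path[of "E @ [hd E]"] by (auto simp: boundary_path_def intro: compact_path_image)
  then show "open (region E)" "bounded (region E)" "frontier (region E) \<subseteq> path_image (boundary_path E)"
    unfolding region_def
    by (auto simp: compact_eq_bounded_closed intro: open_inside bounded_inside dest: frontier_inside_subset)
qed

lemma polys_L2: "p \<in> polys n \<Longrightarrow> p \<in> L2 (region E)"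
  by (rule smooth_imp_L2(1)[OF polys_smooth region_bounded region_open])

lemma proj_unique:
  assumes "region E \<noteq> {}" "f \<in> L2 (region E)" "q \<in> polys n"
    and "\<And>p. p \<in> polys n \<Longrightarrow> l2_inner (region E) (\<lambda>x. f x - q x) p = 0"
  shows "proj n E f = q"
  unfolding proj_def
proof (rule the_equality)
  show "q \<in> polys n \<and> (\<forall>p\<in>polys n. l2_inner (region E) (\<lambda>x. f x - q x) p = 0)"
    using assms by blast
  fix q' assume q': "q' \<in> polys n \<and> (\<forall>p\<in>polys n. l2_inner (region E) (\<lambda>x. f x - q' x) p = 0)"
  define h where "h x = 1 * q x + (- 1) * q' x" for x
  have h: "h \<in> polys n"
    unfolding h_def[abs_def] using assms q' by (intro polys_lincomb) auto
  have "l2_inner (region E) (\<lambda>x. (f x - q' x) - (f x - q x)) h = 0"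
    using assms q' h L2_diff[OF assms(2) polys_L2[OF assms(3)]] L2_diff[OF assms(2) polys_L2[of q' n]]
      polys_L2[OF h]
    by (subst l2_inner_diff_left) auto
  also have "(\<lambda>x. (f x - q' x) - (f x - q x)) = h"
    by (simp add: h_def fun_eq_iff)
  finally have "h = (\<lambda>x. 0)"
    using l2_inner_definite[OF region_open region_bounded smooth_continuous[OF polys_smooth[OF h]]]
      polys_eq_0_if_open[OF h region_open assms(1)] by blast
  then show "q' = q"
    by (simp add: h_def fun_eq_iff)
qed

lemma proj_orthogonal:
  assumes "region E \<noteq> {}" "f \<in> L2 (region E)"
  shows "proj n E f \<in> polys n"
    and "\<And>p. p \<in> polys n \<Longrightarrow> l2_inner (region E) (\<lambda>x. f x - proj n E f x) p = 0"
proof -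
  obtain q where q: "q \<in> polys n" "\<And>p. p \<in> polys n \<Longrightarrow> l2_inner (region E) (\<lambda>x. f x - q x) p = 0"
    using projection_exists[OF region_open region_bounded finite_degrees[of n] assms(2)]
    unfolding polys_eq_span by blast
  have "proj n E f = q"
    by (rule proj_unique[OF assms q])
  with q show "proj n E f \<in> polys n"
    "\<And>p. p \<in> polys n \<Longrightarrow> l2_inner (region E) (\<lambda>x. f x - proj n E f x) p = 0"
    by auto
qed

lemma proj_lincomb:
  assumes E: "region E \<noteq> {}" and fg: "f \<in> L2 (region E)" "g \<in> L2 (region E)"
  shows "proj n E (\<lambda>x. a * f x + b * g x) = (\<lambda>x. a * proj n E f x + b * proj n E g x)"
proof (rule proj_unique[OF E])
  note P = proj_orthogonal[OF E]
  show "(\<lambda>x. a * f x + b * g x) \<in> L2 (region E)"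
    using L2_lincomb[OF fg, of a b] by simp
  show "(\<lambda>x. a * proj n E f x + b * proj n E g x) \<in> polys n"
    by (intro polys_lincomb P fg)
  fix p :: "real^2 \<Rightarrow> real" assume p: "p \<in> polys n"
  have eq: "(\<lambda>x. a * f x + b * g x - (a * proj n E f x + b * proj n E g x)) =
     (\<lambda>x. a *\<^sub>R (f x - proj n E f x) + b *\<^sub>R (g x - proj n E g x))"
    by (simp add: algebra_simps)
  show "l2_inner (region E) (\<lambda>x. a * f x + b * g x - (a * proj n E f x + b * proj n E g x)) p = 0"
    unfolding eq using P(2)[OF fg(1) p] P(2)[OF fg(2) p]
      L2_diff[OF fg(1) polys_L2[OF P(1)[OF fg(1), of n]]]
      L2_diff[OF fg(2) polys_L2[OF P(1)[OF fg(2), of n]]] polys_L2[OF p]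
    by (subst l2_inner_lincomb_left) auto
qed

lemma proj_eq_AE:
  assumes E: "region E \<noteq> {}" and f: "f \<in> L2 (region E)" and q: "q \<in> polys n"
    and "AE x in lebesgue_on (region E). f x = q x"
  shows "proj n E f = q"
proof (rule proj_unique[OF E f q])
  fix p :: "real^2 \<Rightarrow> real" assume p: "p \<in> polys n"
  have "l2_inner (region E) (\<lambda>x. f x - q x) p = l2_inner (region E) (\<lambda>x. 0) p"
    by (rule l2_inner_cong_AE[OF _ L2_diff[OF f polys_L2[OF q]] L2_zero polys_L2[OF p]])
       (use assms(4) in auto)
  then show "l2_inner (region E) (\<lambda>x. f x - q x) p = 0"
    by (simp add: l2_inner_def)
qed

lemma L2_component:
  fixes v :: "real^2 \<Rightarrow> real^2"
  assumes "v \<in> L2 \<omega>"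
  shows "(\<lambda>x. v x $ i) \<in> L2 \<omega>"
proof -
  have m: "v \<in> borel_measurable (lebesgue_on \<omega>)" "integrable (lebesgue_on \<omega>) (\<lambda>x. (norm (v x))\<^sup>2)"
    using assms by (auto simp: L2_def)
  have m': "(\<lambda>x. v x $ i) \<in> borel_measurable (lebesgue_on \<omega>)"
    using borel_measurable_inner[OF m(1) borel_measurable_const[of "axis i 1"]]
    by (simp add: inner_axis)
  moreover have "integrable (lebesgue_on \<omega>) (\<lambda>x. (norm (v x $ i))\<^sup>2)"
  proof (rule Bochner_Integration.integrable_bound[OF m(2)])
    show "(\<lambda>x. (norm (v x $ i))\<^sup>2) \<in> borel_measurable (lebesgue_on \<omega>)"
      using m' by measurable
    show "AE x in lebesgue_on \<omega>. norm ((norm (v x $ i))\<^sup>2) \<le> norm ((norm (v x))\<^sup>2)"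
      using component_le_norm_cart[of "v _" i] by (intro AE_I2) (simp add: power_mono abs_le_square_iff[symmetric])
  qed
  ultimately show ?thesis by (simp add: L2_def)
qed

lemma vproj_lincomb:
  assumes "region E \<noteq> {}" "v \<in> L2 (region E)" "w \<in> L2 (region E)"
  shows "vproj n E (\<lambda>x. a *\<^sub>R v x + b *\<^sub>R w x) x = a *\<^sub>R vproj n E v x + b *\<^sub>R vproj n E w x"
  by (simp add: vproj_def vec_eq_iff proj_lincomb[OF assms(1) L2_component[OF assms(2)] L2_component[OF assms(3)]])

section \<open>Edges of a polygon and uniqueness of edge traces\<close>

lemma vertex_path_image:
  "2 \<le> length vs \<Longrightarrow>
    path_image (vertex_path vs) = (\<Union>i<length vs - 1. closed_segment (vs ! i) (vs ! Suc i))"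
proof (induction vs rule: vertex_path.induct)
  case (4 a b c xs)
  have "path_image (vertex_path (a # b # c # xs)) =
      closed_segment a b \<union> path_image (vertex_path (b # c # xs))"
    using path_vertex_path[of "b # c # xs"] by (simp add: path_image_join)
  also have "\<dots> = closed_segment a b \<union>
      (\<Union>i<length (c # xs). closed_segment ((b # c # xs) ! i) ((b # c # xs) ! Suc i))"
    using "4.IH" by simp
  also have "\<dots> = (\<Union>i<Suc (length (c # xs)).
      closed_segment ((a # b # c # xs) ! i) ((a # b # c # xs) ! Suc i))"
    unfolding lessThan_Suc_eq_insert_0 by auto
  finally show ?case by simp
qed auto

text \<open>Edge traces are determined only up to null sets of the edge, so it is enough that distinct
  edges share finitely many points; injectivity of the boundary path provides this.\<close>

lemma arc_vertex_path_finite_Int: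
  assumes "arc (vertex_path vs)" "i < j" "Suc j < length vs"
  shows "finite (closed_segment (vs ! i) (vs ! Suc i) \<inter> closed_segment (vs ! j) (vs ! Suc j))"
  using assms
proof (induction vs arbitrary: i j rule: vertex_path.induct)
  case (4 a b c xs)
  let ?r = "vertex_path (b # c # xs)"
  have r: "pathfinish (linepath a b) = pathstart ?r"
    using path_vertex_path[of "b # c # xs"] by simp
  with "4.prems"(1) have arc: "arc ?r" "path_image (linepath a b) \<inter> path_image ?r \<subseteq> {pathstart ?r}"
    by (simp_all only: vertex_path.simps arc_join_eq)
  obtain j' where j: "j = Suc j'" using "4.prems" by (cases j) auto
  show ?case
  proof (cases i)
    case 0
    have "closed_segment ((b # c # xs) ! j') ((b # c # xs) ! Suc j') \<subseteq> path_image ?r"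
      using "4.prems" j by (subst vertex_path_image) auto
    then have "closed_segment a b \<inter> closed_segment ((b # c # xs) ! j') ((b # c # xs) ! Suc j') \<subseteq> {pathstart ?r}"
      using arc(2) by auto
    then show ?thesis
      unfolding 0 j using finite_subset by simp blast
  next
    case (Suc i')
    then show ?thesis
      using "4.IH"[OF arc(1), of i' j'] "4.prems" j by simp
  qed
qed auto

lemma edge_nth:
  assumes "i < length E" "E \<noteq> []"
  shows "edge_set (edge E i) = closed_segment ((E @ [hd E]) ! i) ((E @ [hd E]) ! Suc i)"
proof (cases "Suc i = length E")
  case True
  then show ?thesis
    using assms by (simp add: edge_set_def edge_def nth_append hd_conv_nth)
next
  case False
  then show ?thesis
    using assms by (simp add: edge_set_def edge_def nth_append)
qed

lemma boundary_path_image: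
  assumes "simple_polygon E"
  shows "path_image (boundary_path E) = (\<Union>i<length E. edge_set (edge E i))"
proof -
  have E: "3 \<le> length E" "E \<noteq> []"
    using assms by (auto simp: simple_polygon_def)
  then show ?thesis
    unfolding boundary_path_def
    by (subst vertex_path_image) (auto simp: edge_nth)
qed

lemma simple_polygon_finite_Int:
  assumes E: "simple_polygon E" and ij: "i < length E" "j < length E" "i \<noteq> j"
  shows "finite (edge_set (edge E i) \<inter> edge_set (edge E j))"
proof -
  have *: "finite (edge_set (edge E i) \<inter> edge_set (edge E j))"
    if ij: "i < j" "j < length E" for i j
  proof -
    have len: "3 \<le> length E" "simple_path (boundary_path E)"
      using E by (auto simp: simple_polygon_def)
    then obtain a b c xs where abc: "E = a # b # c # xs"
      by (cases E; cases "tl E"; cases "tl (tl E)") auto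
    let ?vs = "b # c # xs @ [a]"
    let ?r = "vertex_path ?vs"
    have bp: "boundary_path E = linepath a b +++ ?r"
      by (simp add: boundary_path_def abc)
    have r: "pathstart ?r = b" "pathfinish ?r = a"
      using path_vertex_path[of ?vs] by auto
    have arc: "arc ?r" "path_image (linepath a b) \<inter> path_image ?r \<subseteq> {a, b}"
      using len(2) r simple_path_join_loop_eq[of ?r "linepath a b"] unfolding bp by simp_all
    have nth: "edge_set (edge E (Suc m)) = closed_segment (?vs ! m) (?vs ! Suc m)"
      if "Suc m < length E" for m
      using edge_nth[OF that] by (simp add: abc)
    obtain j' where j: "j = Suc j'" using ij by (cases j) auto
    show ?thesis
    proof (cases i)
      case 0
      have "edge_set (edge E j) \<subseteq> path_image ?r"
        using ij nth[of j'] by (subst vertex_path_image) (auto simp: j abc)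
      moreover have "edge_set (edge E 0) = path_image (linepath a b)"
        by (simp add: edge_set_def edge_def abc)
      ultimately have "edge_set (edge E 0) \<inter> edge_set (edge E j) \<subseteq> {a, b}"
        using arc(2) by auto
      then show ?thesis
        unfolding 0 by (rule finite_subset) simp
    next
      case (Suc i')
      then show ?thesis
        using arc_vertex_path_finite_Int[OF arc(1), of i' j'] nth[of i'] nth[of j'] ij
        by (simp add: j abc)
    qed
  qed
  then show ?thesis
    using ij *[of i j] *[of j i] by (cases "i < j") (auto simp: Int_commute)
qed

lemma edge_integral_eq_inner:
  "edge_integral e (\<lambda>x. g x * \<phi> x) = dist (fst e) (snd e) *
     l2_inner {0..1} (g \<circ> linepath (fst e) (snd e)) (\<phi> \<circ> linepath (fst e) (snd e))"
  by (simp add: edge_integral_def l2_inner_def)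

lemma smooth_edge_L2: "smooth \<phi> \<Longrightarrow> \<phi> \<circ> linepath a b \<in> L2 {0..1}"
  by (rule continuous_imp_L2, intro continuous_on_compose smooth_continuous continuous_on_linepath) auto

lemma edge_integral_lincomb:
  assumes "g \<circ> linepath (fst e) (snd e) \<in> L2 {0..1}" "h \<circ> linepath (fst e) (snd e) \<in> L2 {0..1}" "smooth \<phi>"
  shows "edge_integral e (\<lambda>x. (a * g x + b * h x) * \<phi> x) =
     a * edge_integral e (\<lambda>x. g x * \<phi> x) + b * edge_integral e (\<lambda>x. h x * \<phi> x)"
  using l2_inner_lincomb_left[OF assms(1,2) smooth_edge_L2[OF assms(3)], of a b]
  unfolding edge_integral_eq_inner by (simp add: comp_def algebra_simps)

lemma has_edge_trace_lincomb:
  assumes "open \<omega>" "bounded \<omega>" "v \<in> Hdiv \<omega>" "w \<in> Hdiv \<omega>"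
    and "has_edge_trace \<omega> v e g" "has_edge_trace \<omega> w e h"
  shows "has_edge_trace \<omega> (\<lambda>x. a *\<^sub>R v x + b *\<^sub>R w x) e (\<lambda>x. a * g x + b * h x)"
proof -
  have gh: "g \<circ> linepath (fst e) (snd e) \<in> L2 {0..1}" "h \<circ> linepath (fst e) (snd e) \<in> L2 {0..1}"
    using assms by (auto simp: has_edge_trace_def)
  have "(\<lambda>x. a * g x + b * h x) \<circ> linepath (fst e) (snd e) \<in> L2 {0..1}"
    using L2_lincomb[OF gh, of a b] by (simp add: comp_def)
  moreover have "normal_trace \<omega> (\<lambda>x. a *\<^sub>R v x + b *\<^sub>R w x) \<phi> =
      edge_integral e (\<lambda>x. (a * g x + b * h x) * \<phi> x)"
    if "\<phi> \<in> trace_tests \<omega> (edge_set e)" for \<phi>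
    using that assms gh
    by (simp add: trace_tests_def normal_trace_lincomb edge_integral_lincomb has_edge_trace_def)
  ultimately show ?thesis
    by (simp add: has_edge_trace_def)
qed

lemma AE_edge_avoids_finite:
  assumes "a \<noteq> b" "finite (closed_segment a b \<inter> C)"
  shows "AE t in lebesgue_on {0..1}. linepath a b t \<notin> C"
proof -
  let ?N = "{t \<in> {0..1}. linepath a b t \<in> C}"
  have "inj_on (linepath a b) {0..1}"
    using arc_linepath[OF \<open>a \<noteq> b\<close>] by (simp add: arc_def)
  then have inj: "inj_on (linepath a b) ?N"
    by (rule inj_on_subset) auto
  have "linepath a b ` ?N \<subseteq> closed_segment a b \<inter> C"
    using linepath_in_path by auto
  then have "finite ?N"
    using assms(2) finite_subset finite_imageD[OF _ inj] by blast
  then have "negligible ?N"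
    by (rule negligible_finite)
  then have "AE t in lebesgue. t \<notin> ?N"
    by (intro AE_not_in) (simp only: negligible_iff_null_sets)
  then have "AE t in lebesgue. t \<in> {0..1} \<longrightarrow> linepath a b t \<notin> C"
    by eventually_elim auto
  then show ?thesis
    by (subst AE_restrict_space_iff) auto
qed

text \<open>Trace tests for the edge must vanish on all other edges. Cutting an arbitrary \<open>p\<close> off with an
  exhaustion of the complement of those edges produces such tests, and they converge to \<open>p\<close> on the
  edge outside finitely many points.\<close>

lemma edge_moment_unique:
  assumes E: "simple_polygon E" and i: "i < length E"
    and g: "has_edge_trace (region E) v (edge E i) g" and h: "has_edge_trace (region E) v (edge E i) h"
    and p: "smooth p"
  shows "edge_integral (edge E i) (\<lambda>x. g x * p x) = edge_integral (edge E i) (\<lambda>x. h x * p x)"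
proof (cases "fst (edge E i) = snd (edge E i)")
  case True
  then show ?thesis by (simp add: edge_integral_def)
next
  case False
  define e where "e = edge E i"
  let ?l = "linepath (fst e) (snd e)"
  define C where "C = (\<Union>j\<in>{..<length E} - {i}. edge_set (edge E j))"
  have "closed C"
    unfolding C_def by (intro closed_UN) (auto simp: edge_set_def)
  then have "open (- C)" by (simp add: open_Compl)
  then obtain \<eta> where \<eta>: "\<And>n. \<eta> n \<in> test_functions (- C)" "\<And>n x. 0 \<le> \<eta> n x" "\<And>n x. \<eta> n x \<le> 1"
    "\<And>x. x \<in> - C \<Longrightarrow> (\<lambda>n. \<eta> n x) \<longlonglongrightarrow> 1"
    using smooth_exhaustion by blast
  have \<eta>s: "smooth (\<lambda>x. p x * \<eta> n x)" for n
    using \<eta>(1)[of n] p by (intro smooth_mult) (auto simp: test_functions_def)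
  have test: "(\<lambda>x. p x * \<eta> n x) \<in> trace_tests (region E) (edge_set e)" for n
  proof -
    have "p x * \<eta> n x = 0" if "x \<in> frontier (region E) - edge_set e" for x
    proof -
      have "x \<in> C"
        using that region_frontier[of E] boundary_path_image[OF E] unfolding C_def e_def by blast
      then have "\<eta> n x = 0"
        using \<eta>(1)[of n] unfolding test_functions_def by blast
      then show ?thesis by simp
    qed
    then show ?thesis
      using \<eta>s by (simp add: trace_tests_def)
  qed
  have "finite (\<Union>j\<in>{..<length E} - {i}. edge_set (edge E i) \<inter> edge_set (edge E j))"
    using simple_polygon_finite_Int[OF E i] by (intro finite_UN_I) auto
  then have "finite (closed_segment (fst e) (snd e) \<inter> C)"
    unfolding C_def e_def edge_set_def by simp
  then have AE: "AE t in lebesgue_on {0..1}. ?l t \<notin> C"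
    using False by (intro AE_edge_avoids_finite) (simp add: e_def)
  have lim: "(\<lambda>n. edge_integral e (\<lambda>x. f x * (p x * \<eta> n x))) \<longlonglongrightarrow> edge_integral e (\<lambda>x. f x * p x)"
    if "f \<circ> ?l \<in> L2 {0..1}" for f
    unfolding edge_integral_eq_inner
  proof (rule tendsto_mult[OF tendsto_const])
    have "(\<lambda>n. l2_inner {0..1} (f \<circ> ?l) (\<lambda>x. (p \<circ> ?l) x * (\<eta> n \<circ> ?l) x)) \<longlonglongrightarrow>
        l2_inner {0..1} (f \<circ> ?l) (p \<circ> ?l)"
    proof (rule l2_inner_tendsto[OF that smooth_edge_L2[OF p]])
      show "(\<lambda>x. (p \<circ> ?l) x * (\<eta> n \<circ> ?l) x) \<in> L2 {0..1}" for n
        using smooth_edge_L2[OF \<eta>s[of n], of "fst e" "snd e"] by (simp add: comp_def)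
      show "AE t in lebesgue_on {0..1}. (\<lambda>n. (\<eta> n \<circ> ?l) t) \<longlonglongrightarrow> 1"
        using AE by eventually_elim (simp add: \<eta>(4))
    qed (auto simp: \<eta>)
    then show "(\<lambda>n. l2_inner {0..1} (f \<circ> ?l) ((\<lambda>x. p x * \<eta> n x) \<circ> ?l)) \<longlonglongrightarrow>
        l2_inner {0..1} (f \<circ> ?l) (p \<circ> ?l)"
      by (simp add: comp_def)
  qed
  have gh: "g \<circ> ?l \<in> L2 {0..1}" "h \<circ> ?l \<in> L2 {0..1}"
    using g h by (auto simp: has_edge_trace_def e_def)
  have "edge_integral e (\<lambda>x. g x * (p x * \<eta> n x)) = edge_integral e (\<lambda>x. h x * (p x * \<eta> n x))" for n
    using g h test[of n] unfolding has_edge_trace_def e_def[symmetric] by metis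
  then have "edge_integral e (\<lambda>x. g x * p x) = edge_integral e (\<lambda>x. h x * p x)"
    using LIMSEQ_unique[OF lim[OF gh(1)]] lim[OF gh(2)] by simp
  then show ?thesis
    by (simp add: e_def)
qed

section \<open>Green's formula on polygonal regions\<close>

text \<open>A short interval on one side of \<open>s\<close> avoids the finite frontier, so by connectedness it lies inside or
  outside \<open>S\<close>.\<close>

lemma eventually_side_constant:
  fixes S :: "real set"
  assumes "finite (frontier S)"
  shows "\<exists>P. eventually (\<lambda>x. x \<in> S \<longleftrightarrow> P) (at_left s)"
    and "\<exists>P. eventually (\<lambda>x. x \<in> S \<longleftrightarrow> P) (at_right s)"
proof -
  have "open (- (frontier S - {s}))"
    using assms by (intro open_Compl finite_imp_closed) auto
  then obtain d where d: "d > 0" "ball s d \<subseteq> - (frontier S - {s})"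
    using open_contains_ball[of "- (frontier S - {s})"] by auto
  have const: "(\<forall>x\<in>I. x \<in> S) \<or> (\<forall>x\<in>I. x \<notin> S)"
    if "connected I" "I \<subseteq> ball s d" "s \<notin> I" for I
    using connected_Int_frontier[of I S] that d(2) by blast
  have sub: "{s - d<..<s} \<subseteq> ball s d" "{s<..<s + d} \<subseteq> ball s d"
    by (auto simp: dist_real_def)
  have "(\<forall>x\<in>{s - d<..<s}. x \<in> S) \<or> (\<forall>x\<in>{s - d<..<s}. x \<notin> S)"
    by (rule const[OF connected_Ioo sub(1)]) simp
  moreover have "(\<forall>x\<in>{s<..<s + d}. x \<in> S) \<or> (\<forall>x\<in>{s<..<s + d}. x \<notin> S)"
    by (rule const[OF connected_Ioo sub(2)]) simp
  moreover have "eventually (\<lambda>x. x \<in> {s - d<..<s}) (at_left s)" "eventually (\<lambda>x. x \<in> {s<..<s + d}) (at_right s)"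
    by (rule eventually_at_leftI[of "s - d"], assumption, use d(1) in simp,
        rule eventually_at_rightI[of s "s + d"], assumption, use d(1) in simp)
  moreover have "\<exists>P. eventually (\<lambda>x. x \<in> S \<longleftrightarrow> P) F"
    if "(\<forall>x\<in>I. x \<in> S) \<or> (\<forall>x\<in>I. x \<notin> S)" "eventually (\<lambda>x. x \<in> I) F" for I F
    using that(1)
  proof
    assume "\<forall>x\<in>I. x \<in> S"
    then show ?thesis
      by (intro exI[of _ True] eventually_mono[OF that(2)]) simp
  next
    assume "\<forall>x\<in>I. x \<notin> S"
    then show ?thesis
      by (intro exI[of _ False] eventually_mono[OF that(2)]) simp
  qed
  ultimately show "\<exists>P. eventually (\<lambda>x. x \<in> S \<longleftrightarrow> P) (at_left s)"
    "\<exists>P. eventually (\<lambda>x. x \<in> S \<longleftrightarrow> P) (at_right s)"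
    by simp_all
qed

text \<open>The product of \<open>f\<close> with the indicator of \<open>S\<close> is continuous at the frontier points because \<open>f\<close>
  vanishes there, so only the one-sided limits at the endpoints enter the fundamental theorem of calculus.\<close>

lemma integral_between:
  fixes S :: "real set" and f f' :: "real \<Rightarrow> real"
  assumes "a < b" "finite (frontier S)"
    and f': "\<And>x. (f has_real_derivative f' x) (at x)"
    and f0: "\<And>x. x \<in> frontier S \<Longrightarrow> a < x \<Longrightarrow> x < b \<Longrightarrow> f x = 0"
    and A: "eventually (\<lambda>x. x \<in> S \<longleftrightarrow> A) (at_right a)" and B: "eventually (\<lambda>x. x \<in> S \<longleftrightarrow> B) (at_left b)"
  shows "((\<lambda>x. indicator S x * f' x) has_integral (of_bool B * f b - of_bool A * f a)) {a..b}"
proof -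
  \<comment> \<open>The indicator times \<open>f\<close> with the endpoint values replaced by the one-sided limits, so that it is continuous on \<open>[a,b]\<close>.\<close>
  define G where "G x = (if x = a then of_bool A * f a else if x = b then of_bool B * f b
    else indicator S x * f x)" for x
  have cont: "isCont f x" for x
    using f' DERIV_isCont by blast
  have loc: "\<exists>U. open U \<and> x \<in> U \<and> ((\<forall>y\<in>U. G y = f y \<and> y \<in> S) \<or> (\<forall>y\<in>U. G y = 0 \<and> y \<notin> S))"
    if "x \<in> {a<..<b}" "x \<notin> frontier S" for x
  proof -
    have "x \<in> interior S \<or> x \<in> interior (- S)"
      using that(2) by (auto simp: frontier_def interior_closure)
    then show ?thesis
    proof
      assume "x \<in> interior S"
      then show ?thesis
        using that(1) interior_subset[of S]
        by (intro exI[of _ "{a<..<b} \<inter> interior S"]) (auto simp: G_def open_Int)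
    next
      assume "x \<in> interior (- S)"
      then show ?thesis
        using that(1) interior_subset[of "- S"]
        by (intro exI[of _ "{a<..<b} \<inter> interior (- S)"]) (auto simp: G_def open_Int)
    qed
  qed
  have der: "(G has_vector_derivative indicator S x * f' x) (at x)"
    if x: "x \<in> {a<..<b} - frontier S" for x
  proof -
    obtain U where U: "open U" "x \<in> U" "(\<forall>y\<in>U. G y = f y \<and> y \<in> S) \<or> (\<forall>y\<in>U. G y = 0 \<and> y \<notin> S)"
      using loc[of x] x by auto
    from U(3) show ?thesis
    proof
      assume G: "\<forall>y\<in>U. G y = f y \<and> y \<in> S"
      have "(f has_vector_derivative f' x) (at x)"
        using f' by (simp add: has_real_derivative_iff_has_vector_derivative)
      then have "(G has_vector_derivative f' x) (at x)"
        by (rule has_vector_derivative_transform_within_open[OF _ U(1,2)]) (use G in auto)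
      then show ?thesis
        using G U(2) by simp
    next
      assume G: "\<forall>y\<in>U. G y = 0 \<and> y \<notin> S"
      have "((\<lambda>_. 0) has_vector_derivative 0) (at x)"
        by (rule has_vector_derivative_const)
      then have "(G has_vector_derivative 0) (at x)"
        by (rule has_vector_derivative_transform_within_open[OF _ U(1,2)]) (use G in auto)
      then show ?thesis
        using G U(2) by simp
    qed
  qed
  have "continuous_on {a..b} G"
    unfolding continuous_on_def
  proof
    fix x assume x: "x \<in> {a..b}"
    consider "x = a" | "x = b" | "x \<in> {a<..<b} - frontier S" | "x \<in> {a<..<b}" "x \<in> frontier S"
      using x by force
    then show "(G \<longlongrightarrow> G x) (at x within {a..b})"
    proof cases
      case 1
      have "((\<lambda>y. of_bool A * f y) \<longlongrightarrow> of_bool A * f a) (at_right a)"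
        using cont[of a] by (intro tendsto_intros) (simp add: continuous_at filterlim_at_split)
      moreover have "eventually (\<lambda>y. y \<in> {a<..<b}) (at_right a)"
        using \<open>a < b\<close> by (auto intro!: eventually_at_rightI[of a b])
      then have "eventually (\<lambda>y. of_bool A * f y = G y) (at_right a)"
        using A by eventually_elim (auto simp: G_def)
      ultimately have "(G \<longlongrightarrow> of_bool A * f a) (at_right a)"
        by (rule Lim_transform_eventually)
      then show ?thesis
        unfolding 1 at_within_Icc_at_right[OF \<open>a < b\<close>] by (simp add: G_def)
    next
      case 2
      have "((\<lambda>y. of_bool B * f y) \<longlongrightarrow> of_bool B * f b) (at_left b)"
        using cont[of b] by (intro tendsto_intros) (simp add: continuous_at filterlim_at_split)
      moreover have "eventually (\<lambda>y. y \<in> {a<..<b}) (at_left b)"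
        using \<open>a < b\<close> by (auto intro!: eventually_at_leftI[of a b])
      then have "eventually (\<lambda>y. of_bool B * f y = G y) (at_left b)"
        using B by eventually_elim (auto simp: G_def)
      ultimately have "(G \<longlongrightarrow> of_bool B * f b) (at_left b)"
        by (rule Lim_transform_eventually)
      then show ?thesis
        unfolding 2 at_within_Icc_at_left[OF \<open>a < b\<close>] using \<open>a < b\<close> by (simp add: G_def)
    next
      case 3
      then have "isCont G x"
        using der[of x] has_vector_derivative_continuous by blast
      then show ?thesis
        by (simp add: continuous_at_imp_continuous_within continuous_within[symmetric])
    next
      case 4
      then have "f x = 0" "G x = 0"
        using f0[of x] by (auto simp: G_def)
      have "eventually (\<lambda>y. y \<in> {a<..<b}) (at x)"
        using 4 by (intro eventually_at_in_open') auto
      then have "eventually (\<lambda>y. norm (G y) \<le> norm (f y)) (at x)"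
        by eventually_elim (auto simp: G_def indicator_def)
      moreover have "(f \<longlongrightarrow> 0) (at x)"
        using cont[of x] \<open>f x = 0\<close> by (simp add: continuous_at)
      ultimately have "(G \<longlongrightarrow> 0) (at x)"
        using Lim_null_comparison[of G "\<lambda>y. norm (f y)"] tendsto_norm_zero by blast
      then show ?thesis
        unfolding \<open>G x = 0\<close> by (rule tendsto_within_subset) simp
    qed
  qed
  then have "((\<lambda>x. indicator S x * f' x) has_integral (G b - G a)) {a..b}"
    using assms(1) by (intro fundamental_theorem_of_calculus_interior_strong[OF assms(2)] der) auto
  then show ?thesis
    using assms(1) by (simp add: G_def)
qed

text \<open>For a polygon \<open>E\<close> and a point \<open>x\<close> on an edge not parallel to \<open>d\<close>, this is the sign of
  the component of the outward normal along \<open>d\<close>, obtained by looking just before and just after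
  \<open>x\<close>. Countably many step sizes keep it Borel measurable.\<close>

definition jump :: "'a::real_vector \<Rightarrow> 'a set \<Rightarrow> 'a \<Rightarrow> real" where
  "jump d E x = of_bool (\<forall>\<^sub>F n in sequentially. x - inverse (real (Suc n)) *\<^sub>R d \<in> E)
     - of_bool (\<forall>\<^sub>F n in sequentially. x + inverse (real (Suc n)) *\<^sub>R d \<in> E)"

lemma jump_bound: "\<bar>jump d E x\<bar> \<le> 1"
  by (simp add: jump_def)

lemma jump_measurable:
  fixes d :: "'a::euclidean_space"
  assumes "E \<in> sets borel"
  shows "jump d E \<in> borel_measurable borel"
  unfolding jump_def[abs_def] eventually_sequentially using assms by measurable

lemma jump_eq_sides:
  fixes S :: "real set"
  assumes "eventually (\<lambda>x. x \<in> S \<longleftrightarrow> A) (at_left s)" "eventually (\<lambda>x. x \<in> S \<longleftrightarrow> B) (at_right s)"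
  shows "jump 1 S s = of_bool A - of_bool B"
proof -
  have lim: "(\<lambda>n. inverse (real (Suc n))) \<longlonglongrightarrow> 0"
    by (rule LIMSEQ_inverse_real_of_nat)
  have "filterlim (\<lambda>n. s - inverse (real (Suc n))) (at_left s) sequentially"
    using tendsto_diff[OF tendsto_const[of s] lim] by (auto simp: filterlim_at)
  then have 1: "\<forall>\<^sub>F n in sequentially. s - inverse (real (Suc n)) \<in> S \<longleftrightarrow> A"
    using eventually_compose_filterlim[OF assms(1)] by blast
  have "filterlim (\<lambda>n. s + inverse (real (Suc n))) (at_right s) sequentially"
    using tendsto_add[OF tendsto_const[of s] lim] by (auto simp: filterlim_at)
  then have 2: "\<forall>\<^sub>F n in sequentially. s + inverse (real (Suc n)) \<in> S \<longleftrightarrow> B"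
    using eventually_compose_filterlim[OF assms(2)] by blast
  have "(\<forall>\<^sub>F n in sequentially. s - inverse (real (Suc n)) \<in> S) \<longleftrightarrow> A"
    using eventually_subst[OF 1] by (cases A) auto
  moreover have "(\<forall>\<^sub>F n in sequentially. s + inverse (real (Suc n)) \<in> S) \<longleftrightarrow> B"
    using eventually_subst[OF 2] by (cases B) auto
  ultimately show ?thesis
    by (simp add: jump_def)
qed

lemma integrable_indicator_continuous:
  fixes f :: "'a::euclidean_space \<Rightarrow> real"
  assumes "open S" "bounded S" "continuous_on UNIV f"
  shows "integrable lborel (\<lambda>x. indicator S x * f x)"
proof -
  have "integrable lborel (\<lambda>x. indicator (closure S) x *\<^sub>R f x)"
    using assms by (intro borel_integrable_compact) (auto intro: continuous_on_subset)
  then have "integrable lborel (\<lambda>x. indicator S x *\<^sub>R (indicator (closure S) x *\<^sub>R f x))"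
    using assms(1) by (intro integrable_mult_indicator[OF _ \<open>integrable lborel _\<close>]) simp
  moreover have "(\<lambda>x. indicator S x *\<^sub>R (indicator (closure S) x *\<^sub>R f x)) = (\<lambda>x. indicator S x * f x)"
    using closure_subset[of S] by (auto simp: indicator_def fun_eq_iff)
  ultimately show ?thesis by (simp only:)
qed

text \<open>The fundamental theorem on both sides of the single frontier point \<open>s\<close> at which \<open>f\<close> need not
  vanish; the two boundary terms combine to the jump of \<open>S\<close> at \<open>s\<close>.\<close>

lemma slice_integral:
  fixes S :: "real set" and f f' :: "real \<Rightarrow> real"
  assumes S: "open S" "bounded S" "finite (frontier S)"
    and f': "\<And>x. (f has_real_derivative f' x) (at x)" "continuous_on UNIV f'"
    and f0: "\<And>x. x \<in> frontier S \<Longrightarrow> x \<noteq> s \<Longrightarrow> f x = 0"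
  shows "(LINT x|lborel. indicator S x * f' x) = jump 1 S s * f s"
proof -
  obtain A where A: "eventually (\<lambda>x. x \<in> S \<longleftrightarrow> A) (at_left s)"
    using eventually_side_constant[OF S(3)] by blast
  obtain B where B: "eventually (\<lambda>x. x \<in> S \<longleftrightarrow> B) (at_right s)"
    using eventually_side_constant[OF S(3)] by blast
  obtain K where K: "\<And>x. x \<in> S \<Longrightarrow> \<bar>x\<bar> \<le> K"
    using S(2) by (auto simp: bounded_iff)
  define M where "M = \<bar>K\<bar> + \<bar>s\<bar> + 1"
  have M: "- M < s" "s < M"
    by (auto simp: M_def)
  have out: "x \<notin> S" if "x < - M + 1 \<or> M - 1 < x" for x
    using K[of x] that by (auto simp: M_def)
  have ends: "eventually (\<lambda>x. x \<in> S \<longleftrightarrow> False) (at_right (- M))" "eventually (\<lambda>x. x \<in> S \<longleftrightarrow> False) (at_left M)"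
    using out by (auto intro!: eventually_at_leftI[of "M - 1"] eventually_at_rightI[of _ "- M + 1"])
  have "((\<lambda>x. indicator S x * f' x) has_integral
      ((of_bool A * f s - of_bool False * f (- M)) + (of_bool False * f M - of_bool B * f s))) {- M..M}"
    using M f0
    by (intro has_integral_combine[of _ s] integral_between[OF _ S(3) f'(1)] A B ends) auto
  then have "((\<lambda>x. indicator S x * f' x) has_integral jump 1 S s * f s) {- M..M}"
    by (simp add: jump_eq_sides[OF A B] algebra_simps)
  then have "((\<lambda>x. indicator S x * f' x) has_integral jump 1 S s * f s) UNIV"
  proof (rule has_integral_on_superset)
    fix x assume "x \<notin> {- M..M}"
    then show "indicator S x * f' x = 0"
      using K[of x] by (auto simp: M_def indicator_def)
  qed simp
  then show ?thesis
    using has_integral_integral_lborel[OF integrable_indicator_continuous[OF S(1,2) f'(2)]]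
    by (rule has_integral_unique[symmetric])
qed

lemma slice_integral_0:
  fixes S :: "real set" and f f' :: "real \<Rightarrow> real"
  assumes S: "open S" "bounded S" "finite (frontier S)"
    and f': "\<And>x. (f has_real_derivative f' x) (at x)" "continuous_on UNIV f'"
    and f0: "\<And>x. x \<in> frontier S \<Longrightarrow> f x = 0"
  shows "(LINT x|lborel. indicator S x * f' x) = 0"
proof -
  obtain K where K: "\<And>x. x \<in> S \<Longrightarrow> \<bar>x\<bar> \<le> K"
    using S(2) by (auto simp: bounded_iff)
  \<comment> \<open>A point so far from \<open>S\<close> that steps of length at most 1 do not reach \<open>S\<close>.\<close>
  define s where "s = - \<bar>K\<bar> - 2"
  have "s - inverse (real (Suc n)) \<notin> S" "s + inverse (real (Suc n)) \<notin> S" for n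
  proof -
    have "0 < inverse (real (Suc n))" "inverse (real (Suc n)) \<le> 1"
      by (simp_all add: inverse_le_1_iff)
    then show "s - inverse (real (Suc n)) \<notin> S" "s + inverse (real (Suc n)) \<notin> S"
      using K[of "s - inverse (real (Suc n))"] K[of "s + inverse (real (Suc n))"]
      unfolding s_def by linarith+
  qed
  then have "jump 1 S s = 0"
    by (simp add: jump_def)
  then show ?thesis
    using slice_integral[OF S f', of s] f0 by simp
qed

definition plane_point :: "2 \<Rightarrow> 2 \<Rightarrow> real \<Rightarrow> real \<Rightarrow> real^2" where
  "plane_point i j s t = s *\<^sub>R axis i 1 + t *\<^sub>R axis j 1"

lemma UNIV_2_distinct: "i \<noteq> j \<Longrightarrow> UNIV = {i, j :: 2}"
  using exhaust_2[of i] exhaust_2[of j] by (auto simp: UNIV_2)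

lemma forall_2_distinct: "i \<noteq> j \<Longrightarrow> (\<forall>k. P k) \<longleftrightarrow> P i \<and> P (j :: 2)"
  using UNIV_2_distinct[of i j] by (metis UNIV_I insertE singletonD)

lemma plane_point_nth:
  assumes "i \<noteq> j"
  shows "plane_point i j s t $ i = s" "plane_point i j s t $ j = t"
  using assms by (auto simp: plane_point_def axis_def)

lemma plane_point_components: "i \<noteq> j \<Longrightarrow> plane_point i j (x $ i) (x $ j) = x"
  by (simp add: vec_eq_iff forall_2_distinct plane_point_nth)

lemma plane_point_eq_iff:
  assumes "i \<noteq> j"
  shows "plane_point i j s t = x \<longleftrightarrow> s = x $ i \<and> t = x $ j"
  using plane_point_components[OF assms, of x] plane_point_nth[OF assms] by auto

lemma continuous_plane_point: "continuous_on A (\<lambda>p. plane_point i j (fst p) (snd p))"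
  unfolding plane_point_def by (intro continuous_intros)

text \<open>Keeping \<open>i\<close> and \<open>j\<close> symbolic lets Fubini's theorem be applied in either coordinate direction by
  one argument.\<close>

lemma lborel_plane:
  assumes ij: "i \<noteq> j"
  shows "lborel = distr (lborel \<Otimes>\<^sub>M lborel) borel (\<lambda>p. plane_point i j (fst p) (snd p))"
proof (rule lborel_eqI)
  have meas: "(\<lambda>p. plane_point i j (fst p) (snd p)) \<in> borel_measurable (lborel \<Otimes>\<^sub>M lborel)"
    unfolding lborel_prod using borel_measurable_continuous_onI[OF continuous_plane_point] by simp
  fix l u :: "real^2" assume lu: "\<And>b. b \<in> Basis \<Longrightarrow> l \<bullet> b \<le> u \<bullet> b"
  have le: "l $ k \<le> u $ k" for k
    using lu[of "axis k 1"] by (simp add: inner_axis)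
  have "(\<lambda>p. plane_point i j (fst p) (snd p)) -` box l u \<inter> space (lborel \<Otimes>\<^sub>M lborel) =
      {l $ i<..<u $ i} \<times> {l $ j<..<u $ j}"
    by (auto simp: mem_box_cart space_pair_measure forall_2_distinct[OF ij] plane_point_nth[OF ij])
  then have "emeasure (distr (lborel \<Otimes>\<^sub>M lborel) borel (\<lambda>p. plane_point i j (fst p) (snd p))) (box l u) =
      emeasure (lborel \<Otimes>\<^sub>M lborel) ({l $ i<..<u $ i} \<times> {l $ j<..<u $ j})"
    by (simp add: emeasure_distr meas)
  also have "\<dots> = ennreal (u $ i - l $ i) * ennreal (u $ j - l $ j)"
    using le by (simp add: lborel.emeasure_pair_measure_Times)
  also have "\<dots> = ennreal (\<Prod>k\<in>{i, j}. u $ k - l $ k)"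
    using le ij by (simp add: ennreal_mult)
  also have "(\<Prod>k\<in>{i, j}. u $ k - l $ k) = (\<Prod>b\<in>(\<lambda>k. axis k 1) ` UNIV. (u - l) \<bullet> b)"
    unfolding UNIV_2_distinct[OF ij, symmetric]
    by (subst prod.reindex) (auto simp: inj_on_def axis_eq_axis inner_axis)
  also have "(\<lambda>k. axis k (1::real)) ` (UNIV :: 2 set) = Basis"
    by (auto simp: Basis_vec_def)
  finally show "emeasure (distr (lborel \<Otimes>\<^sub>M lborel) borel (\<lambda>p. plane_point i j (fst p) (snd p))) (box l u) =
      (\<Prod>b\<in>Basis. (u - l) \<bullet> b)" .
qed simp

lemma integral_plane:
  fixes F :: "real^2 \<Rightarrow> real"
  assumes ij: "i \<noteq> j" and F: "integrable lborel F"
  shows "(LINT x|lborel. F x) = (LINT t|lborel. LINT s|lborel. F (plane_point i j s t))"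
    and "(\<lambda>t. LINT s|lborel. F (plane_point i j s t)) \<in> borel_measurable lborel"
proof -
  have meas: "(\<lambda>p. plane_point i j (fst p) (snd p)) \<in> borel_measurable (lborel \<Otimes>\<^sub>M lborel)"
    unfolding lborel_prod using borel_measurable_continuous_onI[OF continuous_plane_point] by simp
  have F': "F \<in> borel_measurable borel"
    using borel_measurable_integrable[OF F] by simp
  have int: "integrable (lborel \<Otimes>\<^sub>M lborel) (\<lambda>p. F (plane_point i j (fst p) (snd p)))"
    using F unfolding lborel_plane[OF ij] integrable_distr_eq[OF meas F'] by (simp add: comp_def)
  have "(LINT x|lborel. F x) = (LINT p|(lborel \<Otimes>\<^sub>M lborel). F (plane_point i j (fst p) (snd p)))"
    by (subst lborel_plane[OF ij]) (rule integral_distr[OF meas F'])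
  also have "\<dots> = (LINT t|lborel. LINT s|lborel. F (plane_point i j s t))"
    using lborel_pair.integral_snd[of "\<lambda>s t. F (plane_point i j s t)",
        unfolded case_prod_unfold, OF int] by (rule sym)
  finally show "(LINT x|lborel. F x) = (LINT t|lborel. LINT s|lborel. F (plane_point i j s t))" .
  have "(\<lambda>p. F (plane_point i j (snd p) (fst p))) \<in> borel_measurable (lborel \<Otimes>\<^sub>M lborel)"
    using measurable_compose[OF measurable_pair_swap' borel_measurable_integrable[OF int]]
    by (simp add: case_prod_beta)
  then show "(\<lambda>t. LINT s|lborel. F (plane_point i j s t)) \<in> borel_measurable lborel"
    by (intro lborel.borel_measurable_lebesgue_integral) (simp add: case_prod_beta)
qed

lemma segment_line_finite:
  assumes ij: "i \<noteq> j" and t: "a $ j = b $ j \<Longrightarrow> t \<noteq> a $ j"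
  shows "finite {s. plane_point i j s t \<in> closed_segment a b}"
proof -
  have affine: "(1 - r) * x + r * y = x + r * (y - x)" for r x y :: real
    by (simp add: algebra_simps)
  have "s = a $ i + ((t - a $ j) / (b $ j - a $ j)) * (b $ i - a $ i)"
    if "plane_point i j s t \<in> closed_segment a b" for s
  proof -
    obtain r where r: "plane_point i j s t = (1 - r) *\<^sub>R a + r *\<^sub>R b"
      using \<open>plane_point i j s t \<in> closed_segment a b\<close> unfolding in_segment(1) by blast
    then have st: "s = (1 - r) * a $ i + r * b $ i" "t = (1 - r) * a $ j + r * b $ j"
      using plane_point_nth[OF ij, of s t] by auto
    then have "a $ j \<noteq> b $ j"
      using t by (auto simp: algebra_simps)
    then have "(t - a $ j) / (b $ j - a $ j) = r"
      using st(2) by (simp add: field_simps)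
    show ?thesis
      unfolding \<open>(t - a $ j) / (b $ j - a $ j) = r\<close> st(1) affine by (rule refl)
  qed
  then have "{s. plane_point i j s t \<in> closed_segment a b} \<subseteq>
      {a $ i + ((t - a $ j) / (b $ j - a $ j)) * (b $ i - a $ i)}"
    by blast
  then show ?thesis
    by (rule finite_subset) simp
qed

lemma smooth_slice_derivative:
  assumes "smooth \<psi>"
  shows "((\<lambda>s. \<psi> (plane_point i j s t)) has_real_derivative partial i \<psi> (plane_point i j s t)) (at s)"
proof -
  have "((\<lambda>s. plane_point i j s t) has_derivative (\<lambda>h. h *\<^sub>R axis i 1)) (at s)"
    unfolding plane_point_def by (auto intro!: derivative_eq_intros)
  from has_derivative_compose[OF this smooth_has_derivative[OF assms]]
  have *: "((\<lambda>s. \<psi> (plane_point i j s t)) has_derivative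
      (\<lambda>h. frechet_derivative \<psi> (at (plane_point i j s t)) (h *\<^sub>R axis i 1))) (at s)" .
  have "linear (frechet_derivative \<psi> (at (plane_point i j s t)))"
    using smooth_has_derivative[OF assms] has_derivative_linear by blast
  with * show ?thesis
    by (simp add: has_field_derivative_def partial_def linear_scale mult.commute[of _ "frechet_derivative _ _ _"])
qed

lemma jump_slice:
  "jump 1 {s. plane_point i j s t \<in> E} s = jump (axis i 1) E (plane_point i j s t)"
proof -
  have "plane_point i j (s - h) t = plane_point i j s t - h *\<^sub>R axis i 1"
    "plane_point i j (s + h) t = plane_point i j s t + h *\<^sub>R axis i 1" for h
    by (simp_all add: plane_point_def algebra_simps)
  then show ?thesis
    by (simp add: jump_def)
qed

text \<open>Green's formula for functions that vanish on the boundary outside one edge. Slice along the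
  \<open>i\<close>-th axis: for all but finitely many \<open>t\<close> the line \<open>x\<^sub>j = t\<close> meets the frontier in finitely many
  points, of which at most one lies on \<open>[a,b]\<close>, so \<open>slice_integral\<close> evaluates the slice. Affine
  reparametrisation of \<open>t\<close> by the edge gives the right-hand side. If the edge is parallel to the axis,
  almost every slice misses it and both sides are zero.\<close>

lemma polygonal_Green:
  fixes E :: "(real^2) set"
  assumes ij: "i \<noteq> j" and E: "open E" "bounded E"
    and \<Sigma>: "finite \<Sigma>" "frontier E \<subseteq> (\<Union>e\<in>\<Sigma>. edge_set e)"
    and \<psi>: "smooth \<psi>" "\<And>x. x \<in> frontier E - closed_segment a b \<Longrightarrow> \<psi> x = 0"
  shows "(LINT x|lborel. indicator E x * partial i \<psi> x) =
    \<bar>b $ j - a $ j\<bar> * (LINT r|lebesgue_on {0..1}. jump (axis i 1) E (linepath a b r) * \<psi> (linepath a b r))"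
proof -
  define I where "I t = (LINT s|lborel. indicator E (plane_point i j s t) * partial i \<psi> (plane_point i j s t))" for t
  define H where "H r = indicator {0..1} r * (jump (axis i 1) E (linepath a b r) * \<psi> (linepath a b r))" for r :: real
  have lp_meas: "linepath a b \<in> borel_measurable borel"
    by (intro borel_measurable_continuous_onI continuous_on_linepath)
  have J_meas: "(\<lambda>r. jump (axis i 1) E (linepath a b r)) \<in> borel_measurable borel"
    using measurable_compose[OF lp_meas jump_measurable[OF borel_open[OF E(1)]]] .
  have \<psi>_meas: "(\<lambda>r. \<psi> (linepath a b r)) \<in> borel_measurable borel"
    using measurable_compose[OF lp_meas borel_measurable_continuous_onI[OF smooth_continuous[OF \<psi>(1)]]] .
  have K_meas: "(\<lambda>r. jump (axis i 1) E (linepath a b r) * \<psi> (linepath a b r)) \<in> borel_measurable borel"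
    by (intro borel_measurable_times J_meas \<psi>_meas)
  have H_meas: "H \<in> borel_measurable borel"
    unfolding H_def[abs_def] by (intro borel_measurable_times borel_measurable_indicator K_meas) auto
  have H_int: "(LINT r|lborel. H r) =
      (LINT r|lebesgue_on {0..1}. jump (axis i 1) E (linepath a b r) * \<psi> (linepath a b r))"
    using H_meas by (simp add: integral_restrict_space H_def[abs_def] integral_completion)
  have int: "integrable lborel (\<lambda>x. indicator E x * partial i \<psi> x)"
    by (intro integrable_indicator_continuous E smooth_continuous smooth_partial \<psi>)
  note plane = integral_plane[OF ij int, folded I_def]
  \<comment> \<open>The exceptional lines: those that may contain an edge parallel to the axis.\<close>
  define N where "N = (\<lambda>e. fst e $ j) ` \<Sigma> \<union> (if a $ j = b $ j then {a $ j} else {})"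
  have N: "finite N"
    using \<Sigma>(1) by (simp add: N_def)
  have AE_N: "AE t in lborel. t \<notin> N"
    using N by (intro AE_not_in) (simp add: finite_imp_null_set_lborel)
  have I_eq: "I t = (if a $ j = b $ j then 0 else H ((t - a $ j) / (b $ j - a $ j)))" if t: "t \<notin> N" for t
  proof -
    define S where "S = {s. plane_point i j s t \<in> E}"
    have cont: "continuous_on UNIV (\<lambda>s. plane_point i j s t)"
      unfolding plane_point_def by (intro continuous_intros)
    have S_open: "open S"
      unfolding S_def using open_vimage[OF E(1) cont] by (simp add: vimage_def)
    have "closed {s. plane_point i j s t \<in> closure E}"
      using closed_vimage[OF closed_closure cont, of E] by (simp add: vimage_def)
    then have "closure S \<subseteq> {s. plane_point i j s t \<in> closure E}"
      unfolding S_def using closure_subset[of E] by (intro closure_minimal) auto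
    then have frontier_S: "plane_point i j s t \<in> frontier E" if "s \<in> frontier S" for s
      using that S_open E(1) by (auto simp: frontier_def interior_open S_def)
    have "bounded ((\<lambda>x. x $ i) ` E)"
      by (rule bounded_linear_image[OF E(2) bounded_linear_vec_nth])
    moreover have "S \<subseteq> (\<lambda>x. x $ i) ` E"
    proof
      fix s assume "s \<in> S"
      then show "s \<in> (\<lambda>x. x $ i) ` E"
        using plane_point_nth(1)[OF ij, of s t] by (intro image_eqI[of _ _ "plane_point i j s t"]) (auto simp: S_def)
    qed
    ultimately have S_bounded: "bounded S"
      by (rule bounded_subset)
    have tN: "fst e $ j \<noteq> t" if "e \<in> \<Sigma>" for e
      using t imageI[OF that, of "\<lambda>e. fst e $ j"] by (auto simp: N_def)
    have "finite (\<Union>e\<in>\<Sigma>. {s. plane_point i j s t \<in> closed_segment (fst e) (snd e)})"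
    proof (rule finite_UN_I[OF \<Sigma>(1)])
      fix e assume "e \<in> \<Sigma>"
      from tN[OF this] show "finite {s. plane_point i j s t \<in> closed_segment (fst e) (snd e)}"
        by (intro segment_line_finite[OF ij]) (rule not_sym)
    qed
    then have S_finite: "finite (frontier S)"
      by (rule finite_subset[rotated]) (use frontier_S \<Sigma>(2) in \<open>auto simp: edge_set_def\<close>)
    have cont': "continuous_on UNIV (\<lambda>s. partial i \<psi> (plane_point i j s t))"
      by (rule continuous_on_compose2[OF smooth_continuous[OF smooth_partial[OF \<psi>(1)]] cont]) auto
    have I_S: "I t = (LINT s|lborel. indicator S s * partial i \<psi> (plane_point i j s t))"
      unfolding I_def by (rule Bochner_Integration.integral_cong) (auto simp: S_def indicator_def)
    define r where "r = (t - a $ j) / (b $ j - a $ j)"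
    have r: "q = r" if "plane_point i j s t = linepath a b q" "a $ j \<noteq> b $ j" for s q
    proof -
      have "t = (1 - q) * a $ j + q * b $ j"
        using arg_cong[OF that(1), of "\<lambda>x. x $ j"] plane_point_nth[OF ij] by (simp add: linepath_def)
      then show ?thesis
        using that(2) by (simp add: r_def field_simps)
    qed
    show ?thesis
    proof (cases "a $ j \<noteq> b $ j \<and> r \<in> {0..1}")
      case True
      define s where "s = linepath a b r $ i"
      have "r * (b $ j - a $ j) = t - a $ j"
        using True by (simp add: r_def)
      then have "linepath a b r $ j = t"
        by (simp add: linepath_def algebra_simps)
      then have pt: "plane_point i j s t = linepath a b r"
        by (simp add: plane_point_eq_iff[OF ij] s_def)
      have "I t = jump 1 S s * \<psi> (plane_point i j s t)"
        unfolding I_S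
      proof (rule slice_integral[OF S_open S_bounded S_finite smooth_slice_derivative[OF \<psi>(1)] cont'])
        fix s' assume s': "s' \<in> frontier S" "s' \<noteq> s"
        have "plane_point i j s' t \<notin> closed_segment a b"
        proof
          assume "plane_point i j s' t \<in> closed_segment a b"
          then obtain q where "plane_point i j s' t = linepath a b q"
            by (auto simp: closed_segment_def linepath_def)
          with r[OF this] True pt have "plane_point i j s' t = plane_point i j s t"
            by simp
          then show False
            using s'(2) plane_point_nth[OF ij] by metis
        qed
        then show "\<psi> (plane_point i j s' t) = 0"
          using frontier_S[OF s'(1)] \<psi>(2) by blast
      qed
      then show ?thesis
        using True jump_slice[of i j t E s] by (simp add: S_def pt H_def r_def)
    next
      case False
      have "I t = 0"
        unfolding I_S
      proof (rule slice_integral_0[OF S_open S_bounded S_finite smooth_slice_derivative[OF \<psi>(1)] cont'])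
        fix s' assume s': "s' \<in> frontier S"
        have "plane_point i j s' t \<notin> closed_segment a b"
        proof
          assume "plane_point i j s' t \<in> closed_segment a b"
          then obtain q where q: "plane_point i j s' t = linepath a b q" "0 \<le> q" "q \<le> 1"
            by (auto simp: closed_segment_def linepath_def)
          show False
          proof (cases "a $ j = b $ j")
            case True
            then have "linepath a b q $ j = a $ j"
              by (simp add: linepath_def algebra_simps)
            then have "t = a $ j"
              using q(1) plane_point_nth[OF ij] by metis
            then show False
              using t True by (simp add: N_def)
          next
            case neq: False
            with r[OF q(1)] q(2,3) False show False
              by simp
          qed
        qed
        then show "\<psi> (plane_point i j s' t) = 0"
          using frontier_S[OF s'] \<psi>(2) by blast
      qed
      then show ?thesis
        using False by (auto simp: H_def r_def)
    qed
  qed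
  show ?thesis
  proof (cases "a $ j = b $ j")
    case True
    have "(LINT t|lborel. I t) = (LINT t::real|lborel. 0)"
      by (intro integral_cong_AE plane(2) eventually_mono[OF AE_N]) (auto simp: I_eq True)
    then show ?thesis
      using plane(1) True by simp
  next
    case False
    let ?c = "b $ j - a $ j"
    have "(LINT t|lborel. I t) = (LINT t|lborel. H ((t - a $ j) / ?c))"
    proof (intro integral_cong_AE plane(2) eventually_mono[OF AE_N])
      show "(\<lambda>t. H ((t - a $ j) / ?c)) \<in> borel_measurable lborel"
        using measurable_compose[OF _ H_meas, of "\<lambda>t. (t - a $ j) / ?c" lborel] by simp
    qed (auto simp: I_eq False)
    also have "\<dots> = \<bar>?c\<bar> * (LINT r|lborel. H r)"
      using False lborel_integral_real_affine[of ?c "\<lambda>t. H ((t - a $ j) / ?c)" "a $ j"] by simp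
    finally show ?thesis
      using plane(1) H_int by simp
  qed
qed

section \<open>Polynomial fields have divergences and edge traces\<close>

definition smooth_field :: "(real^2 \<Rightarrow> real^2) \<Rightarrow> bool" where
  "smooth_field w \<longleftrightarrow> (\<forall>i. smooth (\<lambda>x. w x $ i))"

definition divergence :: "(real^2 \<Rightarrow> real^2) \<Rightarrow> real^2 \<Rightarrow> real" where
  "divergence w x = (\<Sum>i\<in>UNIV. partial i (\<lambda>y. w y $ i) x)"

lemma smooth_field_L2:
  assumes "smooth_field w" "bounded \<omega>" "open \<omega>"
  shows "w \<in> L2 \<omega>"
proof (rule continuous_imp_L2[OF _ assms(2)])
  have "continuous_on UNIV (\<lambda>x. (\<chi> i. w x $ i))"
    using assms(1) by (intro continuous_on_vec_lambda smooth_continuous) (simp add: smooth_field_def)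
  then show "continuous_on UNIV w" by simp
  show "\<omega> \<in> sets lebesgue"
    using assms(3) by (simp add: borel_open)
qed

lemma smooth_divergence: "smooth_field w \<Longrightarrow> smooth (divergence w)"
  unfolding divergence_def[abs_def] smooth_field_def by (intro smooth_sum smooth_partial) blast

lemma LINT_lebesgue_on_eq_lborel:
  fixes f :: "'a::euclidean_space \<Rightarrow> real"
  assumes "open S" "continuous_on UNIV f"
  shows "(LINT x|lebesgue_on S. f x) = (LINT x|lborel. indicator S x * f x)"
proof -
  have S: "S \<in> sets borel" "S \<in> sets lebesgue"
    using assms(1) by (simp_all add: borel_open)
  have "(\<lambda>x. indicator S x * f x) \<in> borel_measurable lborel"
    using borel_measurable_continuous_onI[OF assms(2)] S(1)
    by (intro borel_measurable_times borel_measurable_indicator) simp_all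
  from integral_completion[OF this] show ?thesis
    using S(2) by (simp add: integral_restrict_space)
qed

lemma divergence_product:
  assumes "smooth_field w" "smooth \<phi>"
  shows "divergence w x * \<phi> x + w x \<bullet> grad \<phi> x = (\<Sum>i\<in>UNIV. partial i (\<lambda>y. w y $ i * \<phi> y) x)"
  using assms
  by (simp add: divergence_def grad_def inner_vec_def sum_distrib_right sum.distrib[symmetric]
      partial_mult smooth_field_def smooth_differentiable add.commute)

lemma Green_components:
  assumes E: "open E" "bounded E" and w: "smooth_field w" and \<phi>: "smooth \<phi>"
  shows "l2_inner E (divergence w) \<phi> + l2_inner E w (grad \<phi>) =
    (\<Sum>i\<in>UNIV. LINT x|lborel. indicator E x * partial i (\<lambda>y. w y $ i * \<phi> y) x)"
proof -
  have sm: "smooth (\<lambda>y. w y $ i * \<phi> y)" for i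
    using w \<phi> by (intro smooth_mult) (auto simp: smooth_field_def)
  have int: "integrable lborel (\<lambda>x. indicator E x * partial i (\<lambda>y. w y $ i * \<phi> y) x)" for i
    by (intro integrable_indicator_continuous E smooth_continuous smooth_partial sm)
  have "l2_inner E (divergence w) \<phi> + l2_inner E w (grad \<phi>) =
      (LINT x|lebesgue_on E. divergence w x \<bullet> \<phi> x + w x \<bullet> grad \<phi> x)"
    unfolding l2_inner_def
    by (intro Bochner_Integration.integral_add[symmetric] L2_inner_integrable
        smooth_imp_L2[OF _ E(2,1)] smooth_field_L2[OF _ E(2,1)] smooth_divergence w \<phi>)
  also have "\<dots> = (LINT x|lebesgue_on E. (\<Sum>i\<in>UNIV. partial i (\<lambda>y. w y $ i * \<phi> y) x))"
    by (simp add: divergence_product[OF w \<phi>])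
  also have "\<dots> = (LINT x|lborel. indicator E x * (\<Sum>i\<in>UNIV. partial i (\<lambda>y. w y $ i * \<phi> y) x))"
    by (intro LINT_lebesgue_on_eq_lborel E continuous_on_sum smooth_continuous smooth_partial sm)
  also have "\<dots> = (\<Sum>i\<in>UNIV. LINT x|lborel. indicator E x * partial i (\<lambda>y. w y $ i * \<phi> y) x)"
    using int by (simp only: sum_distrib_left) (rule Bochner_Integration.integral_sum)
  finally show ?thesis .
qed

lemma region_frontier_edges:
  assumes "simple_polygon E"
  shows "frontier (region E) \<subseteq> (\<Union>e\<in>edges E. edge_set e)"
  using region_frontier[of E] boundary_path_image[OF assms] by (auto simp: edges_def)

lemma finite_edges: "finite (edges E)"
  by (simp add: edges_def)

lemma other_index: "i \<noteq> i + 1" for i :: 2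
  by simp

text \<open>The products \<open>w\<^sub>i \<phi>\<close> vanish on the frontier, so \<open>polygonal_Green\<close> applies with the degenerate
  segment from \<open>0\<close> to \<open>0\<close> and yields no boundary term.\<close>

lemma smooth_field_weak_div:
  assumes E: "simple_polygon E" and w: "smooth_field w"
  shows "has_weak_div (region E) w (divergence w)"
  unfolding has_weak_div_def
proof (intro conjI ballI)
  show "w \<in> L2 (region E)" "divergence w \<in> L2 (region E)"
    using w by (simp_all add: smooth_field_L2 smooth_imp_L2 smooth_divergence region_open region_bounded)
  fix \<phi> assume "\<phi> \<in> test_functions (region E)"
  then obtain K where \<phi>: "smooth \<phi>" and K: "K \<subseteq> region E" "\<And>x. x \<notin> K \<Longrightarrow> \<phi> x = 0"
    unfolding test_functions_def by blast
  have "(LINT x|lborel. indicator (region E) x * partial i (\<lambda>y. w y $ i * \<phi> y) x) = 0" for i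
  proof -
    have "w x $ i * \<phi> x = 0" if "x \<in> frontier (region E)" for x
    proof -
      have "x \<notin> region E"
        using that region_open[of E] by (simp add: frontier_def interior_open)
      then have "\<phi> x = 0"
        using K by blast
      then show ?thesis by simp
    qed
    then show ?thesis
      using polygonal_Green[OF other_index[of i] region_open region_bounded finite_edges
          region_frontier_edges[OF E], of "\<lambda>y. w y $ i * \<phi> y" 0 0] w \<phi>
      by (simp add: smooth_mult smooth_field_def)
  qed
  then show "l2_inner (region E) (divergence w) \<phi> = - l2_inner (region E) w (grad \<phi>)"
    using Green_components[OF region_open region_bounded w \<phi>, of E] by simp
qed

text \<open>Without this, the residual \<open>v - \<Pi>v\<close> could fail to have an edge trace, the chosen \<open>edge_trace\<close> would
  be meaningless and the stabilisation would not be bilinear. The trace is the normal component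
  of \<open>w\<close>, with each component of the normal written as its absolute value
  \<open>\<kappa> i\<close> times the jump of the region.\<close>

lemma smooth_field_edge_trace:
  assumes E: "simple_polygon E" and w: "smooth_field w"
  shows "\<exists>g. has_edge_trace (region E) w e g"
proof -
  define a b where "a = fst e" and "b = snd e"
  \<comment> \<open>In the plane, the extent of the edge along the other axis, divided by its length, is the absolute value of the normal component.\<close>
  define \<kappa> where "\<kappa> i = (if a = b then 0 else \<bar>b $ (i + 1) - a $ (i + 1)\<bar> / dist a b)" for i :: 2
  define g where "g x = (\<Sum>i\<in>UNIV. \<kappa> i * jump (axis i 1) (region E) x * w x $ i)" for x
  let ?l = "linepath a b"
  have jump_L2: "(\<lambda>r. jump (axis i 1) (region E) (?l r) * f (?l r)) \<in> L2 {0..1}" if "smooth f" for i f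
  proof -
    have lm: "?l \<in> borel_measurable borel"
      by (intro borel_measurable_continuous_onI continuous_on_linepath)
    have "(\<lambda>r. jump (axis i 1) (region E) (?l r)) \<in> borel_measurable borel"
      using measurable_compose[OF lm jump_measurable[OF borel_open[OF region_open]]] .
    then have jm: "(\<lambda>r. jump (axis i 1) (region E) (?l r)) \<in> borel_measurable (lebesgue_on {0..1})"
      by (intro measurable_restrict_space1 measurable_completion) simp
    have fm: "f \<circ> ?l \<in> L2 {0..1}"
      by (rule smooth_edge_L2[OF that])
    have "compact ((f \<circ> ?l) ` {0..1})"
      by (intro compact_continuous_image continuous_on_compose smooth_continuous[OF that]
          continuous_on_linepath) simp
    from compact_imp_bounded[OF this] obtain M where "\<forall>y\<in>(f \<circ> ?l) ` {0..1}. norm y \<le> M"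
      unfolding bounded_iff by blast
    then have M: "\<bar>f (?l r)\<bar> \<le> M" if "r \<in> {0..1}" for r
      using that by simp
    show ?thesis
    proof (rule bounded_measurable_imp_L2)
      show "(\<lambda>r. jump (axis i 1) (region E) (?l r) * f (?l r)) \<in> borel_measurable (lebesgue_on {0..1})"
        using borel_measurable_times[OF jm L2_measurable[OF fm]] by (simp add: comp_def)
      fix r :: real assume r: "r \<in> {0..1}"
      show "norm (jump (axis i 1) (region E) (?l r) * f (?l r)) \<le> M"
        using mult_mono[OF jump_bound[of "axis i 1" "region E" "?l r"] M[OF r]] by (simp add: abs_mult)
    qed auto
  qed
  have wi: "smooth (\<lambda>x. w x $ i)" for i
    using w by (simp add: smooth_field_def)
  have "(\<lambda>r. \<kappa> 1 *\<^sub>R (jump (axis 1 1) (region E) (?l r) * w (?l r) $ 1) +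
      \<kappa> 2 *\<^sub>R (jump (axis 2 1) (region E) (?l r) * w (?l r) $ 2)) \<in> L2 {0..1}"
    by (intro L2_lincomb jump_L2[OF wi])
  then have "g \<circ> ?l \<in> L2 {0..1}"
    by (simp add: g_def comp_def sum_2 mult.assoc)
  moreover have "normal_trace (region E) w \<phi> = edge_integral e (\<lambda>x. g x * \<phi> x)"
    if "\<phi> \<in> trace_tests (region E) (edge_set e)" for \<phi>
  proof -
    have \<phi>: "smooth \<phi>" "\<And>x. x \<in> frontier (region E) - closed_segment a b \<Longrightarrow> \<phi> x = 0"
      using that by (auto simp: trace_tests_def edge_set_def a_def b_def)
    define m where "m i = (LINT r|lebesgue_on {0..1}. jump (axis i 1) (region E) (?l r) * (w (?l r) $ i * \<phi> (?l r)))" for i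
    have "normal_trace (region E) w \<phi> = l2_inner (region E) (divergence w) \<phi> + l2_inner (region E) w (grad \<phi>)"
      unfolding normal_trace_def
      by (simp add: l2_inner_wdiv[OF region_open region_bounded smooth_field_weak_div[OF E w] \<phi>(1)])
    also have "\<dots> = (\<Sum>i\<in>UNIV. LINT x|lborel. indicator (region E) x * partial i (\<lambda>y. w y $ i * \<phi> y) x)"
      by (rule Green_components[OF region_open region_bounded w \<phi>(1)])
    also have "\<dots> = (\<Sum>i\<in>UNIV. \<bar>b $ (i + 1) - a $ (i + 1)\<bar> * m i)"
      unfolding m_def
      by (intro sum.cong refl polygonal_Green[OF other_index region_open region_bounded finite_edges
          region_frontier_edges[OF E]] smooth_mult wi \<phi>(1)) (simp add: \<phi>(2))
    also have "\<dots> = (\<Sum>i\<in>UNIV. dist a b * (\<kappa> i * m i))"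
      by (intro sum.cong) (auto simp: \<kappa>_def)
    also have "\<dots> = dist a b * (\<kappa> 1 * m 1 + \<kappa> 2 * m 2)"
      by (simp add: sum_2 distrib_left)
    also have "\<kappa> 1 * m 1 + \<kappa> 2 * m 2 = (LINT r|lebesgue_on {0..1}. g (?l r) * \<phi> (?l r))"
    proof -
      have int: "integrable (lebesgue_on {0..1}) (\<lambda>r. jump (axis i 1) (region E) (?l r) * (w (?l r) $ i * \<phi> (?l r)))" for i
        using L2_inner_integrable[OF jump_L2[OF wi[of i]] smooth_edge_L2[OF \<phi>(1)], of i]
        by (simp add: comp_def mult.assoc)
      show ?thesis
        using int[of 1] int[of 2] unfolding m_def
        by (simp add: g_def sum_2 distrib_right mult.assoc)
    qed
    finally show ?thesis
      by (simp add: edge_integral_def a_def b_def)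
  qed
  ultimately show ?thesis
    unfolding has_edge_trace_def a_def b_def by blast
qed

section \<open>The discrete inner product\<close>

text \<open>Membership asks for exactly the objects that the degrees of freedom choose. The space contains the
  virtual element fields and the smooth fields, hence also the residuals of the projection.\<close>

definition dof_space :: "polygon \<Rightarrow> (real^2 \<Rightarrow> real^2) set" where
  "dof_space E = {v \<in> Hdiv (region E). \<forall>e\<in>edges E. \<exists>g. has_edge_trace (region E) v e g}"

lemma dof_spaceD:
  assumes "v \<in> dof_space E"
  shows "v \<in> Hdiv (region E)" "v \<in> L2 (region E)"
  using assms by (auto simp: dof_space_def dest: Hdiv_L2)

lemma vem_local_dof_space: "v \<in> vem_local k E \<Longrightarrow> v \<in> dof_space E"
  by (auto simp: vem_local_def dof_space_def)

lemma dof_space_lincomb: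
  assumes "v \<in> dof_space E" "w \<in> dof_space E"
  shows "(\<lambda>x. a *\<^sub>R v x + b *\<^sub>R w x) \<in> dof_space E"
  unfolding dof_space_def
proof (intro CollectI conjI ballI)
  show "(\<lambda>x. a *\<^sub>R v x + b *\<^sub>R w x) \<in> Hdiv (region E)"
    by (intro Hdiv_lincomb region_open region_bounded dof_spaceD(1) assms)
  fix e assume "e \<in> edges E"
  then obtain g h where "has_edge_trace (region E) v e g" "has_edge_trace (region E) w e h"
    using assms unfolding dof_space_def by blast
  from has_edge_trace_lincomb[OF region_open region_bounded dof_spaceD(1)[OF assms(1)]
      dof_spaceD(1)[OF assms(2)] this]
  show "\<exists>g. has_edge_trace (region E) (\<lambda>x. a *\<^sub>R v x + b *\<^sub>R w x) e g" by blast
qed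

lemma smooth_field_dof_space:
  assumes "simple_polygon E" "smooth_field w"
  shows "w \<in> dof_space E"
  using smooth_field_weak_div[OF assms] smooth_field_edge_trace[OF assms]
  unfolding dof_space_def Hdiv_def by blast

text \<open>The degrees of freedom as a list of functionals, so that the stabilisation becomes a sum of squares of
  linear forms.\<close>

definition dof_functionals :: "dof_bases \<Rightarrow> polygon \<Rightarrow> ((real^2 \<Rightarrow> real^2) \<Rightarrow> real) list" where
  "dof_functionals B E =
     map (\<lambda>p w. l2_inner (region E) (wdiv (region E) w) p) (div_basis B E) @
     map (\<lambda>p w. l2_inner (region E) w (\<lambda>x. p x *\<^sub>R perp x)) (curl_basis B E) @
     concat (map (\<lambda>i. map (\<lambda>p w. edge_integral (edge E i)
                                 (\<lambda>x. edge_trace (region E) w (edge E i) x * p x))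
                            (edge_basis B E (edge E i))) [0..<length E])"

lemma dofs_eq_functionals: "dofs B E w = map (\<lambda>F. F w) (dof_functionals B E)"
  by (simp add: dofs_def dof_functionals_def map_concat comp_def)

lemma stab_eq_sum: "stab B E v w = (\<Sum>F\<leftarrow>dof_functionals B E. F v * F w)"
proof -
  have "map2 (*) (map (\<lambda>F. F v) Fs) (map (\<lambda>F. F w) Fs) = map (\<lambda>F. F v * F w) Fs"
    for Fs :: "((real^2 \<Rightarrow> real^2) \<Rightarrow> real) list"
    by (induction Fs) auto
  then show ?thesis
    by (simp add: stab_def dofs_eq_functionals)
qed

lemma stab_commute: "stab B E v w = stab B E w v"
  by (simp add: stab_eq_sum mult.commute)

lemma stab_nonneg: "0 \<le> stab B E v v"
  unfolding stab_eq_sum by (intro sum_list_nonneg) auto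

lemma has_edge_trace_edge_trace:
  "has_edge_trace \<omega> v e g \<Longrightarrow> has_edge_trace \<omega> v e (edge_trace \<omega> v e)"
  unfolding edge_trace_def by (rule someI[of "has_edge_trace \<omega> v e"])

lemma vproj_smooth_field:
  assumes "region E \<noteq> {}" "v \<in> L2 (region E)"
  shows "smooth_field (vproj n E v)"
  using polys_smooth[OF proj_orthogonal(1)[OF assms(1) L2_component[OF assms(2)]]]
  by (simp add: smooth_field_def vproj_def)

text \<open>On an empty region the projection is not characterised by orthogonality, but the form vanishes because
  the diameter does.\<close>

lemma m_local_empty: "region E = {} \<Longrightarrow> m_local n B E v w = 0"
  by (simp add: m_local_def l2_inner_def)

context
  fixes k :: nat and B :: dof_bases and E :: polygon
  assumes E: "simple_polygon E" and B: "is_dof_bases k {E} B"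
begin

lemma dof_functionals_cases:
  assumes "F \<in> set (dof_functionals B E)"
  obtains p where "smooth p" "F = (\<lambda>w. l2_inner (region E) (wdiv (region E) w) p)"
  | p where "smooth p" "F = (\<lambda>w. l2_inner (region E) w (\<lambda>x. p x *\<^sub>R perp x))"
  | p i where "smooth p" "i < length E"
      "F = (\<lambda>w. edge_integral (edge E i) (\<lambda>x. edge_trace (region E) w (edge E i) x * p x))"
proof -
  have b: "set (div_basis B E) \<subseteq> polys (int k)" "set (curl_basis B E) \<subseteq> polys (int k - 1)"
    "\<And>i. i < length E \<Longrightarrow> set (edge_basis B E (edge E i)) \<subseteq> polys (int k)"
    using B by (auto simp: is_dof_bases_def is_poly_basis_def edges_def)
  consider p where "p \<in> set (div_basis B E)" "F = (\<lambda>w. l2_inner (region E) (wdiv (region E) w) p)"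
  | p where "p \<in> set (curl_basis B E)" "F = (\<lambda>w. l2_inner (region E) w (\<lambda>x. p x *\<^sub>R perp x))"
  | p i where "i < length E" "p \<in> set (edge_basis B E (edge E i))"
      "F = (\<lambda>w. edge_integral (edge E i) (\<lambda>x. edge_trace (region E) w (edge E i) x * p x))"
    using assms unfolding dof_functionals_def by auto
  then show thesis
    using that b polys_smooth by cases blast+
qed

lemma dof_functional_lincomb:
  assumes F: "F \<in> set (dof_functionals B E)" and v: "v \<in> dof_space E" and w: "w \<in> dof_space E"
  shows "F (\<lambda>x. a *\<^sub>R v x + b *\<^sub>R w x) = a * F v + b * F w"
  using F
proof (cases rule: dof_functionals_cases)
  case (1 p)
  then show ?thesis
    using l2_inner_wdiv_lincomb[OF region_open region_bounded dof_spaceD(1)[OF v] dof_spaceD(1)[OF w]]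
    by simp
next
  case (2 p)
  then show ?thesis
    using l2_inner_lincomb_left[OF dof_spaceD(2)[OF v] dof_spaceD(2)[OF w]
        smooth_imp_L2(4)[OF _ region_bounded region_open]]
    by simp
next
  case (3 p i)
  let ?e = "edge E i" and ?u = "\<lambda>x. a *\<^sub>R v x + b *\<^sub>R w x"
  have i: "?e \<in> edges E"
    using 3 by (simp add: edges_def)
  have tr: "has_edge_trace (region E) z ?e (edge_trace (region E) z ?e)" if "z \<in> dof_space E" for z
    using that i has_edge_trace_edge_trace unfolding dof_space_def by blast
  have lin: "has_edge_trace (region E) ?u ?e
      (\<lambda>x. a * edge_trace (region E) v ?e x + b * edge_trace (region E) w ?e x)"
    by (rule has_edge_trace_lincomb[OF region_open region_bounded dof_spaceD(1)[OF v]
          dof_spaceD(1)[OF w] tr[OF v] tr[OF w]])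
  have "edge_integral ?e (\<lambda>x. edge_trace (region E) ?u ?e x * p x) =
      edge_integral ?e (\<lambda>x. (a * edge_trace (region E) v ?e x + b * edge_trace (region E) w ?e x) * p x)"
    by (rule edge_moment_unique[OF E 3(2) has_edge_trace_edge_trace[OF lin] lin 3(1)])
  also have "\<dots> = a * edge_integral ?e (\<lambda>x. edge_trace (region E) v ?e x * p x) +
      b * edge_integral ?e (\<lambda>x. edge_trace (region E) w ?e x * p x)"
    using tr[OF v] tr[OF w] 3(1) by (intro edge_integral_lincomb) (auto simp: has_edge_trace_def)
  finally show ?thesis
    using 3 by simp
qed

lemma stab_lincomb_left:
  assumes "v \<in> dof_space E" "w \<in> dof_space E"
  shows "stab B E (\<lambda>x. a *\<^sub>R v x + b *\<^sub>R w x) z = a * stab B E v z + b * stab B E w z"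
proof -
  have "(\<Sum>F\<leftarrow>Fs. F (\<lambda>x. a *\<^sub>R v x + b *\<^sub>R w x) * F z) = a * (\<Sum>F\<leftarrow>Fs. F v * F z) + b * (\<Sum>F\<leftarrow>Fs. F w * F z)"
    if "set Fs \<subseteq> set (dof_functionals B E)" for Fs
    using that
  proof (induction Fs)
    case (Cons F Fs)
    then show ?case
      using dof_functional_lincomb[of F v w a b] assms by (simp add: algebra_simps)
  qed simp
  then show ?thesis
    by (simp add: stab_eq_sum)
qed

text \<open>A field that vanishes almost everywhere has the zero function as a divergence and as an edge trace;
  the uniqueness results transfer this to the chosen representatives.\<close>

lemma dof_functional_zero:
  assumes F: "F \<in> set (dof_functionals B E)" and w: "w \<in> L2 (region E)"
    and 0: "AE x in lebesgue_on (region E). w x = 0"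
  shows "F w = 0"
proof -
  have l2: "l2_inner (region E) w h = 0" if "h \<in> L2 (region E)" for h
    using l2_inner_cong_AE[OF 0 w L2_zero that] by (simp add: l2_inner_def)
  have div: "has_weak_div (region E) w (\<lambda>x. 0)"
    unfolding has_weak_div_def
    using w L2_zero l2[OF smooth_imp_L2(2)[OF test_functionsD region_bounded region_open]]
    by (auto simp: l2_inner_def)
  have wdiv: "l2_inner (region E) (wdiv (region E) w) p = 0" if "smooth p" for p
    using l2_inner_wdiv[OF region_open region_bounded div that] by (simp add: l2_inner_def)
  have tr: "has_edge_trace (region E) w e (\<lambda>x. 0)" for e
    using wdiv l2[OF smooth_imp_L2(2)[OF _ region_bounded region_open]] L2_zero[of "{0..1::real}"]
    by (auto simp: has_edge_trace_def normal_trace_def trace_tests_def edge_integral_def comp_def)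
  show ?thesis
    using F
  proof (cases rule: dof_functionals_cases)
    case (1 p)
    then show ?thesis by (simp add: wdiv)
  next
    case (2 p)
    then show ?thesis by (simp add: l2 smooth_imp_L2 region_bounded region_open)
  next
    case (3 p i)
    then show ?thesis
      using edge_moment_unique[OF E 3(2) has_edge_trace_edge_trace[OF tr] tr 3(1)]
      by (simp add: edge_integral_def)
  qed
qed

lemma stab_zero:
  assumes "w \<in> L2 (region E)" "AE x in lebesgue_on (region E). w x = 0"
  shows "stab B E w w = 0"
proof -
  have "(\<Sum>F\<leftarrow>Fs. F w * F w) = 0" if "set Fs \<subseteq> set (dof_functionals B E)" for Fs
    using that dof_functional_zero[OF _ assms] by (induction Fs) auto
  then show ?thesis
    by (simp add: stab_eq_sum)
qed

lemma m_local_lincomb_left: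
  assumes v: "v \<in> dof_space E" and w: "w \<in> dof_space E" and z: "z \<in> dof_space E"
  shows "m_local n B E (\<lambda>x. a *\<^sub>R v x + b *\<^sub>R w x) z = a * m_local n B E v z + b * m_local n B E w z"
proof (cases "region E = {}")
  case True
  then show ?thesis by (simp add: m_local_empty)
next
  case False
  define r where "r u = (\<lambda>x. u x - vproj (int n) E u x)" for u :: "real^2 \<Rightarrow> real^2"
  have vp: "vproj (int n) E (\<lambda>x. a *\<^sub>R v x + b *\<^sub>R w x) =
      (\<lambda>x. a *\<^sub>R vproj (int n) E v x + b *\<^sub>R vproj (int n) E w x)"
    by (rule ext) (rule vproj_lincomb[OF False dof_spaceD(2)[OF v] dof_spaceD(2)[OF w]])
  then have r_lin: "r (\<lambda>x. a *\<^sub>R v x + b *\<^sub>R w x) = (\<lambda>x. a *\<^sub>R r v x + b *\<^sub>R r w x)"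
    by (simp add: r_def algebra_simps)
  have P: "smooth_field (vproj (int n) E u)" if "u \<in> dof_space E" for u
    by (rule vproj_smooth_field[OF False dof_spaceD(2)[OF that]])
  have PL2: "vproj (int n) E u \<in> L2 (region E)" if "u \<in> dof_space E" for u
    by (rule smooth_field_L2[OF P[OF that] region_bounded region_open])
  have r: "r u \<in> dof_space E" if "u \<in> dof_space E" for u
    using dof_space_lincomb[OF that smooth_field_dof_space[OF E P[OF that]], of 1 "-1"]
    by (simp add: r_def)
  have m: "m_local n B E u u' = l2_inner (region E) (vproj (int n) E u) (vproj (int n) E u') +
      (diameter (region E))\<^sup>2 * stab B E (r u) (r u')" for u u'
    by (simp add: m_local_def r_def)
  show ?thesis
    unfolding m r_lin stab_lincomb_left[OF r[OF v] r[OF w]] vp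
      l2_inner_lincomb_left[OF PL2[OF v] PL2[OF w] PL2[OF z]]
    by (simp add: algebra_simps)
qed

end

lemma m_local_commute: "m_local n B E v w = m_local n B E w v"
  by (simp add: m_local_def l2_inner_commute stab_commute)

lemma m_local_nonneg: "0 \<le> m_local n B E v v"
  unfolding m_local_def by (intro add_nonneg_nonneg mult_nonneg_nonneg l2_inner_nonneg stab_nonneg) simp

section \<open>Fields on the decomposed domain\<close>

text \<open>Completeness of Lebesgue measure makes measurability of \<open>g\<close> automatic. This matters for the
  coefficient \<open>c\<close>, whose values on the null set between the elements are arbitrary positive numbers.\<close>

lemma L2_cong_AE:
  fixes f g :: "'a::euclidean_space \<Rightarrow> 'b::euclidean_space"
  assumes \<Omega>: "\<Omega> \<in> sets lebesgue" and f: "f \<in> L2 \<Omega>" and eq: "AE x in lebesgue_on \<Omega>. g x = f x"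
  shows "g \<in> L2 \<Omega>"
proof -
  have fm: "f \<in> borel_measurable (lebesgue_on \<Omega>)" and fi: "integrable (lebesgue_on \<Omega>) (\<lambda>x. (norm (f x))\<^sup>2)"
    using f by (auto simp: L2_def)
  have eq': "AE x in lebesgue. x \<in> \<Omega> \<longrightarrow> g x = f x"
    using eq \<Omega> by (simp add: AE_restrict_space_iff)
  have "g \<in> borel_measurable (lebesgue_on \<Omega>)"
  proof (rule measurableI)
    fix A :: "'b set" assume "A \<in> sets borel"
    then have "f -` A \<inter> \<Omega> \<in> sets lebesgue"
      using measurable_sets[OF fm, of A] \<Omega> by (simp add: sets_restrict_space_iff space_restrict_space)
    moreover have "AE x in lebesgue. x \<in> f -` A \<inter> \<Omega> \<longleftrightarrow> x \<in> g -` A \<inter> \<Omega>"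
      using eq' by eventually_elim auto
    ultimately have "g -` A \<inter> \<Omega> \<in> sets lebesgue"
      by (intro completion.in_sets_AE[of "f -` A \<inter> \<Omega>" "g -` A \<inter> \<Omega>" lborel]) auto
    then show "g -` A \<inter> space (lebesgue_on \<Omega>) \<in> sets (lebesgue_on \<Omega>)"
      using \<Omega> by (simp add: sets_restrict_space_iff space_restrict_space)
  qed simp
  moreover from this have "(\<lambda>x. (norm (g x))\<^sup>2) \<in> borel_measurable (lebesgue_on \<Omega>)"
    by measurable
  then have "integrable (lebesgue_on \<Omega>) (\<lambda>x. (norm (g x))\<^sup>2)"
    by (rule integrable_cong_AE_imp[OF fi]) (use eq in \<open>eventually_elim, simp\<close>)
  ultimately show ?thesis
    by (simp add: L2_def)
qed

lemma L2_subset: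
  assumes "f \<in> L2 \<Omega>" "\<omega> \<subseteq> \<Omega>" "\<omega> \<in> sets lebesgue" "\<Omega> \<in> sets lebesgue"
  shows "f \<in> L2 \<omega>"
proof -
  have "restrict_space (lebesgue_on \<Omega>) \<omega> = lebesgue_on \<omega>"
    using assms(2) by (subst restrict_restrict_space) (use assms in \<open>auto simp: Int_absorb1\<close>)
  moreover have "f \<in> borel_measurable (restrict_space (lebesgue_on \<Omega>) \<omega>)"
    by (rule measurable_restrict_space1[OF L2_measurable[OF assms(1)]])
  moreover have "integrable (restrict_space (lebesgue_on \<Omega>) \<omega>) (\<lambda>x. (norm (f x))\<^sup>2)"
  proof -
    have \<omega>: "\<omega> \<in> sets (lebesgue_on \<Omega>)"
      using assms by (simp add: sets_restrict_space_iff)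
    then have "integrable (lebesgue_on \<Omega>) (\<lambda>x. indicator \<omega> x *\<^sub>R (norm (f x))\<^sup>2)"
      using assms(1) by (intro integrable_mult_indicator) (simp_all add: L2_def)
    moreover have "\<omega> \<inter> space (lebesgue_on \<Omega>) \<in> sets (lebesgue_on \<Omega>)"
      using \<omega> sets.Int_space_eq2 by metis
    ultimately show ?thesis
      by (simp only: integrable_restrict_space)
  qed
  ultimately show ?thesis
    by (simp add: L2_def)
qed

lemma edge_set_negligible: "negligible (edge_set e)"
  by (simp add: edge_set_def negligible_convex_interior interior_closed_segment_ge2)

text \<open>A point of \<open>\<Omega>\<close> in no element lies on the frontier of some element, hence on one of
  finitely many segments.\<close>

lemma decomposition_AE:
  assumes "is_decomposition \<Omega> \<Omega>h" "\<Omega> \<in> sets lebesgue"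
  shows "AE x in lebesgue_on \<Omega>. \<exists>E\<in>\<Omega>h. x \<in> region E"
proof -
  let ?N = "\<Union>E\<in>\<Omega>h. \<Union>e\<in>edges E. edge_set e"
  have D: "finite \<Omega>h" "\<And>E. E \<in> \<Omega>h \<Longrightarrow> simple_polygon E" "closure \<Omega> = (\<Union>E\<in>\<Omega>h. closure (region E))"
    using assms(1) by (auto simp: is_decomposition_def)
  have "negligible ?N"
    using D(1) finite_edges edge_set_negligible by (intro negligible_Union) auto
  then have "AE x in lebesgue. x \<notin> ?N"
    by (intro AE_not_in) (simp only: negligible_iff_null_sets)
  then have "AE x in lebesgue. x \<in> \<Omega> \<longrightarrow> (\<exists>E\<in>\<Omega>h. x \<in> region E)"
  proof eventually_elim
    case (elim x)
    show ?case
    proof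
      assume "x \<in> \<Omega>"
      then have "x \<in> closure \<Omega>"
        using closure_subset by blast
      then obtain E where E: "E \<in> \<Omega>h" "x \<in> closure (region E)"
        using D(3) by blast
      have "x \<notin> frontier (region E)"
        using elim region_frontier_edges[OF D(2)[OF E(1)]] E(1) by blast
      then show "\<exists>E\<in>\<Omega>h. x \<in> region E"
        using E region_open[of E] by (auto simp: frontier_def interior_open)
    qed
  qed
  then show ?thesis
    using assms(2) by (simp add: AE_restrict_space_iff)
qed

lemma sum_region_indicator:
  fixes f :: "polygon \<Rightarrow> 'a::real_vector"
  assumes "is_decomposition \<Omega> \<Omega>h" "E \<in> \<Omega>h" "x \<in> region E"
  shows "(\<Sum>F\<in>\<Omega>h. indicator (region F) x *\<^sub>R f F) = f E"
proof -
  have "indicator (region F) x *\<^sub>R f F = (if F = E then f E else 0)" if "F \<in> \<Omega>h" for F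
  proof (cases "F = E")
    case False
    then have "region E \<inter> region F = {}"
      using assms(1,2) that unfolding is_decomposition_def by blast
    then show ?thesis
      using False assms(3) by (auto simp: indicator_def)
  qed (use assms(3) in simp)
  then show ?thesis
    using assms by (simp add: is_decomposition_def)
qed

lemma L2_divide_coefficient:
  fixes p c :: "real^2 \<Rightarrow> real"
  assumes D: "is_decomposition \<Omega> \<Omega>h" and c: "positive_piecewise_constant \<Omega> \<Omega>h c"
    and \<Omega>: "\<Omega> \<in> sets lebesgue" and p: "p \<in> L2 \<Omega>"
  shows "(\<lambda>x. p x / c x) \<in> L2 \<Omega>"
proof -
  have "\<forall>E\<in>\<Omega>h. \<exists>\<gamma>. \<forall>x\<in>region E. c x = \<gamma>"
    using c by (auto simp: positive_piecewise_constant_def constant_on_def)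
  then obtain \<gamma> where \<gamma>: "\<And>E x. E \<in> \<Omega>h \<Longrightarrow> x \<in> region E \<Longrightarrow> c x = \<gamma> E"
    by metis
  \<comment> \<open>A bounded Borel function that agrees with \<open>1 / c\<close> off the element boundaries.\<close>
  define m where "m x = (\<Sum>E\<in>\<Omega>h. indicator (region E) x *\<^sub>R inverse (\<gamma> E))" for x :: "real^2"
  have m: "m \<in> borel_measurable (lebesgue_on \<Omega>)"
    unfolding m_def[abs_def]
    by (intro borel_measurable_sum borel_measurable_scaleR borel_measurable_indicator
        measurable_restrict_space1 measurable_completion borel_measurable_const) (simp_all add: borel_open region_open)
  have bound: "\<bar>m x\<bar> \<le> (\<Sum>E\<in>\<Omega>h. \<bar>inverse (\<gamma> E)\<bar>)" for x
    unfolding m_def by (rule order_trans[OF sum_abs]) (auto intro!: sum_mono simp: indicator_def)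
  let ?K = "\<Sum>E\<in>\<Omega>h. \<bar>inverse (\<gamma> E)\<bar>"
  have pm: "p \<in> borel_measurable (lebesgue_on \<Omega>)" "integrable (lebesgue_on \<Omega>) (\<lambda>x. (norm (p x))\<^sup>2)"
    using p by (auto simp: L2_def)
  have meas: "(\<lambda>x. p x * m x) \<in> borel_measurable (lebesgue_on \<Omega>)"
    by (intro borel_measurable_times pm m)
  have "integrable (lebesgue_on \<Omega>) (\<lambda>x. (norm (p x * m x))\<^sup>2)"
  proof (rule Bochner_Integration.integrable_bound)
    show "integrable (lebesgue_on \<Omega>) (\<lambda>x. ?K\<^sup>2 * (norm (p x))\<^sup>2)"
      using pm(2) by simp
    show "(\<lambda>x. (norm (p x * m x))\<^sup>2) \<in> borel_measurable (lebesgue_on \<Omega>)"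
      using meas by measurable
    have "(norm (p x * m x))\<^sup>2 \<le> ?K\<^sup>2 * (norm (p x))\<^sup>2" for x
    proof -
      have "(m x)\<^sup>2 \<le> ?K\<^sup>2"
        using power_mono[OF bound[of x], of 2] by simp
      from mult_left_mono[OF this zero_le_power2[of "p x"]] show ?thesis
        by (simp add: power_mult_distrib mult.commute)
    qed
    then show "AE x in lebesgue_on \<Omega>. norm ((norm (p x * m x))\<^sup>2) \<le> norm (?K\<^sup>2 * (norm (p x))\<^sup>2)"
      by (intro AE_I2) simp
  qed
  then have "(\<lambda>x. p x * m x) \<in> L2 \<Omega>"
    using meas by (simp add: L2_def)
  then show ?thesis
  proof (rule L2_cong_AE[OF \<Omega>])
    show "AE x in lebesgue_on \<Omega>. p x / c x = p x * m x"
      using decomposition_AE[OF D \<Omega>]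
    proof eventually_elim
      case (elim x)
      then show ?case
        using \<gamma> sum_region_indicator[OF D, of _ x "\<lambda>E. inverse (\<gamma> E)"]
        by (auto simp: m_def divide_inverse)
    qed
  qed
qed

lemma n_form_eq: "n_form \<Omega> c p q = l2_inner \<Omega> (\<lambda>x. p x / c x) (\<lambda>x. q x / c x)"
  by (simp add: n_form_def l2_inner_def power2_eq_square)

lemma V_disc_lincomb:
  assumes \<Omega>: "open \<Omega>" "bounded \<Omega>" and vw: "v \<in> V_disc k \<Omega> \<Gamma>N \<Omega>h" "w \<in> V_disc k \<Omega> \<Gamma>N \<Omega>h"
  shows "(\<lambda>x. a *\<^sub>R v x + b *\<^sub>R w x) \<in> V_disc k \<Omega> \<Gamma>N \<Omega>h"
proof -
  have "(\<lambda>x. a *\<^sub>R v x + b *\<^sub>R w x) \<in> vem_local k E" if "E \<in> \<Omega>h" for E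
  proof -
    have v: "v \<in> vem_local k E" and w: "w \<in> vem_local k E"
      using vw that by (auto simp: V_disc_def)
    note op = region_open[of E] region_bounded[of E]
    have H: "v \<in> Hdiv (region E)" "w \<in> Hdiv (region E)" "v \<in> Hcurl (region E)" "w \<in> Hcurl (region E)"
      using v w by (auto simp: vem_local_def)
    obtain p q where pq: "p \<in> polys (int k)" "has_weak_div (region E) v p"
      "q \<in> polys (int k)" "has_weak_div (region E) w q"
      using v w unfolding vem_local_def by blast
    obtain r s where rs: "r \<in> polys (int k - 1)" "has_weak_curl (region E) v r"
      "s \<in> polys (int k - 1)" "has_weak_curl (region E) w s"
      using v w unfolding vem_local_def by blast
    have "\<exists>p\<in>polys (int k). has_edge_trace (region E) (\<lambda>x. a *\<^sub>R v x + b *\<^sub>R w x) e p" if "e \<in> edges E" for e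
    proof -
      obtain g h where gh: "g \<in> polys (int k)" "has_edge_trace (region E) v e g"
        "h \<in> polys (int k)" "has_edge_trace (region E) w e h"
        using v w \<open>e \<in> edges E\<close> unfolding vem_local_def by blast
      show ?thesis
        using has_edge_trace_lincomb[OF op H(1,2) gh(2,4), of a b]
        by (intro bexI[of _ "\<lambda>x. a * g x + b * h x"] polys_lincomb gh(1,3))
    qed
    moreover have "\<exists>p\<in>polys (int k). has_weak_div (region E) (\<lambda>x. a *\<^sub>R v x + b *\<^sub>R w x) p"
      using has_weak_div_lincomb[OF op pq(2,4), of a b] polys_lincomb[OF pq(1,3), of a b]
      unfolding real_scaleR_def by blast
    moreover have "\<exists>p\<in>polys (int k - 1). has_weak_curl (region E) (\<lambda>x. a *\<^sub>R v x + b *\<^sub>R w x) p"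
      using has_weak_curl_lincomb[OF op rs(2,4), of a b] polys_lincomb[OF rs(1,3), of a b]
      unfolding real_scaleR_def by blast
    ultimately show ?thesis
      using Hdiv_lincomb[OF op H(1,2)] Hcurl_lincomb[OF op H(3,4)]
      unfolding vem_local_def by blast
  qed
  then show ?thesis
    using V_space_lincomb[OF \<Omega>, of v \<Gamma>N w a b] vw by (simp add: V_disc_def)
qed

lemma Q_disc_lincomb:
  assumes "p \<in> Q_disc k \<Omega> \<Omega>h" "q \<in> Q_disc k \<Omega> \<Omega>h"
  shows "(\<lambda>x. a * p x + b * q x) \<in> Q_disc k \<Omega> \<Omega>h"
proof -
  have "\<exists>s\<in>polys (int k). AE x in lebesgue_on (region E). a * p x + b * q x = s x" if "E \<in> \<Omega>h" for E
  proof -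
    obtain s t where st: "s \<in> polys (int k)" "AE x in lebesgue_on (region E). p x = s x"
      "t \<in> polys (int k)" "AE x in lebesgue_on (region E). q x = t x"
      using assms \<open>E \<in> \<Omega>h\<close> unfolding Q_disc_def by blast
    have "AE x in lebesgue_on (region E). a * p x + b * q x = a * s x + b * t x"
      using st(2,4) by eventually_elim simp
    then show ?thesis
      by (intro bexI[of _ "\<lambda>x. a * s x + b * t x"] polys_lincomb st(1,3))
  qed
  then show ?thesis
    using assms L2_lincomb[of p \<Omega> q a b] by (simp add: Q_disc_def)
qed

lemma m_form_lincomb_left:
  assumes D: "is_decomposition \<Omega> \<Omega>h" and B: "is_dof_bases k \<Omega>h B"
    and v: "\<And>E. E \<in> \<Omega>h \<Longrightarrow> v \<in> dof_space E" and w: "\<And>E. E \<in> \<Omega>h \<Longrightarrow> w \<in> dof_space E"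
    and z: "\<And>E. E \<in> \<Omega>h \<Longrightarrow> z \<in> dof_space E"
  shows "m_form k B \<Omega>h (\<lambda>x. a *\<^sub>R v x + b *\<^sub>R w x) z = a * m_form k B \<Omega>h v z + b * m_form k B \<Omega>h w z"
proof -
  have "m_local k B E (\<lambda>x. a *\<^sub>R v x + b *\<^sub>R w x) z = a * m_local k B E v z + b * m_local k B E w z"
    if "E \<in> \<Omega>h" for E
    using D B that
    by (intro m_local_lincomb_left[where k = k] v w z) (auto simp: is_decomposition_def is_dof_bases_def)
  then show ?thesis
    by (simp add: m_form_def sum.distrib sum_distrib_left)
qed

lemma m_form_commute: "m_form k B \<Omega>h v w = m_form k B \<Omega>h w v"
  unfolding m_form_def by (subst m_local_commute) (rule refl)

lemma m_form_nonneg: "0 \<le> m_form k B \<Omega>h v v"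
  unfolding m_form_def by (intro sum_nonneg m_local_nonneg)

section \<open>The energy identity\<close>

text \<open>Test the first equation with \<open>u\<^sub>\<theta> = \<theta> u' + (1 - \<theta>) u\<close> and the second with
  \<open>p\<^sub>\<theta> = \<theta> p' + (1 - \<theta>) p\<close>: the two coupling terms are the same number and cancel. Since
  \<open>u\<^sub>\<theta> = (u' + u)/2 + (\<theta> - 1/2)(u' - u)\<close>, bilinearity and symmetry turn the remaining
  terms into half of the difference of the squared energies plus \<open>\<theta> - 1/2\<close> times the squared
  energy \<open>\<delta>\<close> of the increment.\<close>

lemma theta_step_energy:
  fixes u u' :: "real^2 \<Rightarrow> real^2" and p p' :: "real^2 \<Rightarrow> real"
  assumes \<tau>: "\<tau> > 0" and \<Omega>: "open \<Omega>" "bounded \<Omega>" and D: "is_decomposition \<Omega> \<Omega>h"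
    and c: "positive_piecewise_constant \<Omega> \<Omega>h c" and B: "is_dof_bases k \<Omega>h B"
    and u: "u \<in> V_disc k \<Omega> \<Gamma>N \<Omega>h" "u' \<in> V_disc k \<Omega> \<Gamma>N \<Omega>h"
    and p: "p \<in> Q_disc k \<Omega> \<Omega>h" "p' \<in> Q_disc k \<Omega> \<Omega>h"
    and step: "theta_step k B \<Omega> \<Gamma>N \<Omega>h c \<tau> \<theta> u p u' p'"
  obtains \<delta> where "0 \<le> \<delta>"
    "(disc_energy_norm k B \<Omega> \<Omega>h c u' p')\<^sup>2 = (disc_energy_norm k B \<Omega> \<Omega>h c u p)\<^sup>2 - (2 * \<theta> - 1) * \<delta>"
proof -
  define ut where "ut x = \<theta> *\<^sub>R u' x + (1 - \<theta>) *\<^sub>R u x" for x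
  define pt where "pt x = \<theta> * p' x + (1 - \<theta>) * p x" for x
  let ?m = "m_form k B \<Omega>h" and ?n = "n_form \<Omega> c"
  define du where "du x = 1 *\<^sub>R u' x + (- 1) *\<^sub>R u x" for x
  define dp where "dp x = 1 * p' x + (- 1) * p x" for x
  have dofV: "v \<in> dof_space E" if "v \<in> V_disc k \<Omega> \<Gamma>N \<Omega>h" "E \<in> \<Omega>h" for v E
    using that by (auto simp: V_disc_def intro: vem_local_dof_space)
  have ut: "ut \<in> V_disc k \<Omega> \<Gamma>N \<Omega>h" "du \<in> V_disc k \<Omega> \<Gamma>N \<Omega>h"
    unfolding ut_def[abs_def] du_def[abs_def] by (intro V_disc_lincomb \<Omega> u)+
  have pt: "pt \<in> Q_disc k \<Omega> \<Omega>h"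
    unfolding pt_def[abs_def] by (intro Q_disc_lincomb p)
  have \<Omega>m: "\<Omega> \<in> sets lebesgue"
    using \<Omega>(1) by (simp add: borel_open)
  have L2: "(\<lambda>x. q x / c x) \<in> L2 \<Omega>" if "q \<in> Q_disc k \<Omega> \<Omega>h" for q
    using that by (intro L2_divide_coefficient[OF D c \<Omega>m]) (simp add: Q_disc_def)
  have n_lin: "?n (\<lambda>x. a * q x + b * r x) s = a * ?n q s + b * ?n r s"
    if "q \<in> Q_disc k \<Omega> \<Omega>h" "r \<in> Q_disc k \<Omega> \<Omega>h" "s \<in> Q_disc k \<Omega> \<Omega>h" for a b q r s
    using l2_inner_lincomb_left[OF L2[OF that(1)] L2[OF that(2)] L2[OF that(3)], of a b]
    by (simp add: n_form_eq add_divide_distrib)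
  have n_comm: "?n q r = ?n r q" for q r
    by (simp add: n_form_eq l2_inner_commute)
  have m_lin: "?m (\<lambda>x. a *\<^sub>R v x + b *\<^sub>R w x) z = a * ?m v z + b * ?m w z"
    if "v \<in> V_disc k \<Omega> \<Gamma>N \<Omega>h" "w \<in> V_disc k \<Omega> \<Gamma>N \<Omega>h" "z \<in> V_disc k \<Omega> \<Gamma>N \<Omega>h" for a b v w z
    by (rule m_form_lincomb_left[OF D B dofV[OF that(1)] dofV[OF that(2)] dofV[OF that(3)]])
  have m1: "?m (\<lambda>x. (1 / \<tau>) *\<^sub>R (u' x - u x)) ut = (?m u' ut - ?m u ut) / \<tau>"
    using m_lin[OF u(2,1) ut(1), of "1 / \<tau>" "- 1 / \<tau>"]
    by (simp add: scaleR_diff_right diff_divide_distrib)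
  have m2: "?m v ut = \<theta> * ?m v u' + (1 - \<theta>) * ?m v u" if "v \<in> V_disc k \<Omega> \<Gamma>N \<Omega>h" for v
    using m_lin[OF u(2,1) that, of \<theta> "1 - \<theta>"]
    by (simp add: m_form_commute[of _ _ _ v] ut_def[abs_def])
  have m3: "?m du du = ?m u' u' - 2 * ?m u' u + ?m u u"
    using m_lin[OF u(2,1) ut(2), of 1 "- 1", folded du_def] m_lin[OF u(2,1) u(2), of 1 "- 1", folded du_def]
      m_lin[OF u(2,1) u(1), of 1 "- 1", folded du_def]
      m_form_commute[of k B \<Omega>h u' du] m_form_commute[of k B \<Omega>h u du] m_form_commute[of k B \<Omega>h u u']
    by linarith
  have n1: "?n (\<lambda>x. (p' x - p x) / \<tau>) pt = (?n p' pt - ?n p pt) / \<tau>"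
    using n_lin[OF p(2,1) pt, of "1 / \<tau>" "- 1 / \<tau>"] by (simp add: diff_divide_distrib)
  have n2: "?n q pt = \<theta> * ?n q p' + (1 - \<theta>) * ?n q p" if "q \<in> Q_disc k \<Omega> \<Omega>h" for q
    using n_lin[OF p(2,1) that, of \<theta> "1 - \<theta>"] by (simp add: n_comm[of q] pt_def[abs_def])
  have dp: "dp \<in> Q_disc k \<Omega> \<Omega>h"
    unfolding dp_def[abs_def] by (intro Q_disc_lincomb p)
  have n3: "?n dp dp = ?n p' p' - 2 * ?n p' p + ?n p p"
    using n_lin[OF p(2,1) dp, of 1 "- 1", folded dp_def] n_lin[OF p(2,1) p(2), of 1 "- 1", folded dp_def]
      n_lin[OF p(2,1) p(1), of 1 "- 1", folded dp_def]
      n_comm[of p' dp] n_comm[of p dp] n_comm[of p p']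
    by linarith
  have "?m (\<lambda>x. (1 / \<tau>) *\<^sub>R (u' x - u x)) ut + b_form \<Omega> ut pt = 0"
    using step ut(1) unfolding theta_step_def pt_def[abs_def] by blast
  moreover have "?n (\<lambda>x. (p' x - p x) / \<tau>) pt - b_form \<Omega> ut pt = 0"
    using step pt unfolding theta_step_def ut_def[abs_def] by blast
  ultimately have "(?m u' ut - ?m u ut) / \<tau> + (?n p' pt - ?n p pt) / \<tau> = 0"
    using m1 n1 by simp
  then have "(?m u' ut - ?m u ut + (?n p' pt - ?n p pt)) / \<tau> = 0"
    by (simp add: add_divide_distrib)
  then have "?m u' ut - ?m u ut + (?n p' pt - ?n p pt) = 0"
    using \<tau> by simp
  then have key: "?m u' u' + ?n p' p' = ?m u u + ?n p p - (2 * \<theta> - 1) * (?m du du + ?n dp dp)"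
    unfolding m2[OF u(1)] m2[OF u(2)] n2[OF p(1)] n2[OF p(2)] m3 n3
      m_form_commute[of k B \<Omega>h u u'] n_comm[of p p']
    by (simp add: algebra_simps)
  have n_nonneg: "0 \<le> ?n q q" for q
    by (simp add: n_form_eq l2_inner_nonneg)
  have energy: "(disc_energy_norm k B \<Omega> \<Omega>h c v q)\<^sup>2 = ?m v v + ?n q q" for v q
    using m_form_nonneg[of k B \<Omega>h v] n_nonneg[of q]
    by (simp add: disc_energy_norm_def l2_norm_power2 n_form_eq)
  show thesis
    using that[of "?m du du + ?n dp dp"] key m_form_nonneg[of k B \<Omega>h du] n_nonneg[of dp]
    by (simp add: energy)
qed

text \<open>The initial velocity agrees with a polynomial on each element, so the projection fixes it, the
  residual vanishes almost everywhere and the stabilisation drops out.\<close>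

lemma initial_m_form:
  assumes \<Omega>: "open \<Omega>" and D: "is_decomposition \<Omega> \<Omega>h" and B: "is_dof_bases k \<Omega>h B"
    and u0: "u0 \<in> L2 \<Omega>" and u: "\<And>E. E \<in> \<Omega>h \<Longrightarrow> u \<in> L2 (region E)"
    and eq: "AE x in lebesgue_on \<Omega>. u x = global_vproj (int k) \<Omega>h u0 x"
  shows "m_form k B \<Omega>h u u = (l2_norm \<Omega> (global_vproj (int k) \<Omega>h u0))\<^sup>2"
proof -
  let ?P = "\<lambda>E. vproj (int k) E u0"
  let ?G = "global_vproj (int k) \<Omega>h u0"
  have \<Omega>m: "\<Omega> \<in> sets lebesgue"
    using \<Omega> by (simp add: borel_open)
  have Em: "region E \<in> sets lebesgue" for E
    using region_open[of E] by (simp add: borel_open)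
  have sub: "region E \<subseteq> \<Omega>" "simple_polygon E" if "E \<in> \<Omega>h" for E
    using D that by (auto simp: is_decomposition_def)
  have G: "?G x = ?P E x" if "E \<in> \<Omega>h" "x \<in> region E" for E x
    unfolding global_vproj_def using sum_region_indicator[OF D that] .
  have uE: "AE x in lebesgue_on (region E). u x = ?P E x" if "E \<in> \<Omega>h" for E
  proof -
    have "AE x in lebesgue. x \<in> \<Omega> \<longrightarrow> u x = ?G x"
      using eq \<Omega>m by (simp add: AE_restrict_space_iff)
    then have "AE x in lebesgue. x \<in> region E \<longrightarrow> u x = ?P E x"
      by eventually_elim (use G[OF that] sub(1)[OF that] in auto)
    then show ?thesis
      using Em by (simp add: AE_restrict_space_iff)
  qed
  have u0E: "u0 \<in> L2 (region E)" if "E \<in> \<Omega>h" for E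
    by (rule L2_subset[OF u0 sub(1)[OF that] Em \<Omega>m])
  have PL2: "?P E \<in> L2 (region E)" if "E \<in> \<Omega>h" for E
  proof (cases "region E = {}")
    case True
    then show ?thesis
      using Em[of E] by (intro L2_cong_AE[OF _ L2_zero] AE_I2) (simp_all add: space_restrict_space)
  next
    case False
    show ?thesis
      by (rule smooth_field_L2[OF vproj_smooth_field[OF False u0E[OF that]] region_bounded region_open])
  qed
  have loc: "m_local k B E u u = l2_inner (region E) (?P E) (?P E)" if E: "E \<in> \<Omega>h" for E
  proof (cases "region E = {}")
    case True
    then show ?thesis
      by (simp add: m_local_empty l2_inner_def)
  next
    case False
    have "proj (int k) E (\<lambda>x. u x $ i) = proj (int k) E (\<lambda>x. u0 x $ i)" for i
    proof (rule proj_eq_AE[OF False L2_component[OF u[OF E]]])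
      show "proj (int k) E (\<lambda>x. u0 x $ i) \<in> polys (int k)"
        by (rule proj_orthogonal(1)[OF False L2_component[OF u0E[OF E]]])
      show "AE x in lebesgue_on (region E). u x $ i = proj (int k) E (\<lambda>x. u0 x $ i) x"
        using uE[OF E] by eventually_elim (simp add: vproj_def)
    qed
    then have vp: "vproj (int k) E u = ?P E"
      by (simp add: vproj_def[abs_def])
    have 0: "AE x in lebesgue_on (region E). u x - ?P E x = 0"
      using uE[OF E] by eventually_elim simp
    have "is_dof_bases k {E} B"
      using B E by (simp add: is_dof_bases_def)
    from stab_zero[OF sub(2)[OF E] this L2_diff[OF u[OF E] PL2[OF E]] 0]
    show ?thesis
      by (simp add: m_local_def vp)
  qed
  have sq: "?G x \<bullet> ?G x = (\<Sum>E\<in>\<Omega>h. indicator (region E) x *\<^sub>R (?P E x \<bullet> ?P E x))" for x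
  proof (cases "\<exists>E\<in>\<Omega>h. x \<in> region E")
    case True
    then obtain E where E: "E \<in> \<Omega>h" "x \<in> region E" by blast
    show ?thesis
      by (simp only: G[OF E] sum_region_indicator[OF D E, of "\<lambda>E. ?P E x \<bullet> ?P E x"])
  next
    case False
    then show ?thesis
      by (simp add: global_vproj_def)
  qed
  have restrict: "restrict_space (lebesgue_on \<Omega>) (region E) = lebesgue_on (region E)" if "E \<in> \<Omega>h" for E
    using sub(1)[OF that] Em \<Omega>m by (subst restrict_restrict_space) (auto simp: Int_absorb1)
  have mem: "region E \<inter> space (lebesgue_on \<Omega>) \<in> sets (lebesgue_on \<Omega>)" if "E \<in> \<Omega>h" for E
    using sub(1)[OF that] Em \<Omega>m by (auto simp: sets_restrict_space_iff Int_absorb2)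
  have int: "integrable (lebesgue_on \<Omega>) (\<lambda>x. indicator (region E) x *\<^sub>R (?P E x \<bullet> ?P E x))"
    if "E \<in> \<Omega>h" for E
    using L2_inner_integrable[OF PL2[OF that] PL2[OF that]]
      integrable_restrict_space[OF mem[OF that], of "\<lambda>x. ?P E x \<bullet> ?P E x"]
    by (simp add: restrict[OF that])
  have "(l2_norm \<Omega> ?G)\<^sup>2 = (\<Sum>E\<in>\<Omega>h. LINT x|lebesgue_on \<Omega>. indicator (region E) x *\<^sub>R (?P E x \<bullet> ?P E x))"
    unfolding l2_norm_power2 l2_inner_def sq by (rule Bochner_Integration.integral_sum) (rule int)
  also have "\<dots> = (\<Sum>E\<in>\<Omega>h. l2_inner (region E) (?P E) (?P E))"
  proof (rule sum.cong[OF refl])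
    fix E assume E: "E \<in> \<Omega>h"
    show "(LINT x|lebesgue_on \<Omega>. indicator (region E) x *\<^sub>R (?P E x \<bullet> ?P E x)) =
        l2_inner (region E) (?P E) (?P E)"
      using integral_restrict_space[OF mem[OF E], of "\<lambda>x. ?P E x \<bullet> ?P E x"]
      by (simp add: l2_inner_def restrict[OF E])
  qed
  finally show ?thesis
    by (simp add: m_form_def loc)
qed

theorem mainTheorem3:
  fixes k N :: nat and \<tau> \<theta> \<rho> :: real
    and \<Omega> \<Gamma>D \<Gamma>N \<Gamma>R :: "(real^2) set"
    and \<Omega>h :: "polygon set"
    and B :: dof_bases
    and c p\<^sub>0 :: "real^2 \<Rightarrow> real"
    and u\<^sub>0 :: "real^2 \<Rightarrow> real^2"
    and u :: "nat \<Rightarrow> real^2 \<Rightarrow> real^2"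
    and p :: "nat \<Rightarrow> real^2 \<Rightarrow> real"
  assumes "\<tau> > 0" and "N \<ge> 1" and "0 \<le> \<theta>" and "\<theta> \<le> 1"
    and "polygonal_lipschitz_domain \<Omega>"
    and "boundary_partition \<Omega> \<Gamma>D \<Gamma>N \<Gamma>R" and "\<Gamma>R = {}"
    and "is_decomposition \<Omega> \<Omega>h"
    and "mesh_matches \<Omega>h \<Gamma>D" and "mesh_matches \<Omega>h \<Gamma>N" and "mesh_matches \<Omega>h \<Gamma>R"
    and "\<rho> > 0" and "mesh_regular \<rho> \<Omega>h"
    and "positive_piecewise_constant \<Omega> \<Omega>h c"
    and "is_dof_bases k \<Omega>h B"
    and "u\<^sub>0 \<in> L2 \<Omega>" and "p\<^sub>0 \<in> L2 \<Omega>"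
    and "\<And>n. n \<le> N \<Longrightarrow> u n \<in> V_disc k \<Omega> \<Gamma>N \<Omega>h"
    and "\<And>n. n \<le> N \<Longrightarrow> p n \<in> Q_disc k \<Omega> \<Omega>h"
    and "theta_initial k \<Omega> \<Omega>h u\<^sub>0 p\<^sub>0 (u 0) (p 0)"
    and "\<And>n. n < N \<Longrightarrow>
           theta_step k B \<Omega> \<Gamma>N \<Omega>h c \<tau> \<theta> (u n) (p n) (u (Suc n)) (p (Suc n))"
  shows "(\<theta> = 1 / 2 \<longrightarrow>
           (\<forall>n\<le>N. disc_energy_norm k B \<Omega> \<Omega>h c (u n) (p n)
                     = disc_energy_norm k B \<Omega> \<Omega>h c (u 0) (p 0)) \<and>
           disc_energy_norm k B \<Omega> \<Omega>h c (u 0) (p 0)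
             = energy_norm \<Omega> c (global_vproj (int k) \<Omega>h u\<^sub>0) (global_proj (int k) \<Omega>h p\<^sub>0)) \<and>
         (1 / 2 < \<theta> \<longrightarrow>
           (\<forall>n<N. (disc_energy_norm k B \<Omega> \<Omega>h c (u (Suc n)) (p (Suc n)))\<^sup>2
                    \<le> (disc_energy_norm k B \<Omega> \<Omega>h c (u n) (p n))\<^sup>2)) \<and>
         (\<theta> < 1 / 2 \<longrightarrow>
           (\<forall>n<N. (disc_energy_norm k B \<Omega> \<Omega>h c (u (Suc n)) (p (Suc n)))\<^sup>2
                    \<ge> (disc_energy_norm k B \<Omega> \<Omega>h c (u n) (p n))\<^sup>2))"
proof -
  have \<Omega>: "open \<Omega>" "bounded \<Omega>"
    using assms(5) by (auto simp: polygonal_lipschitz_domain_def)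
  then have \<Omega>m: "\<Omega> \<in> sets lebesgue"
    by (simp add: borel_open)
  note D = assms(8) and c = assms(14) and B = assms(15) and uV = assms(18) and pQ = assms(19)
    and init = assms(20)
  let ?en = "\<lambda>n. disc_energy_norm k B \<Omega> \<Omega>h c (u n) (p n)"
  have step: "\<exists>\<delta>\<ge>0. (?en (Suc n))\<^sup>2 = (?en n)\<^sup>2 - (2 * \<theta> - 1) * \<delta>" if "n < N" for n
    using theta_step_energy[OF assms(1) \<Omega> D c B uV[of n] uV[of "Suc n"] pQ[of n] pQ[of "Suc n"]
        assms(21)[OF that]] that
    by (metis Suc_leI less_imp_le)
  have en_nonneg: "0 \<le> ?en n" for n
    unfolding disc_energy_norm_def by (intro real_sqrt_ge_zero add_nonneg_nonneg m_form_nonneg) simp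
  have conserved: "?en n = ?en 0" if "\<theta> = 1 / 2" "n \<le> N" for n
    using that(2)
  proof (induction n)
    case (Suc n)
    have "(?en (Suc n))\<^sup>2 = (?en n)\<^sup>2"
      using step[of n] Suc.prems that(1) by auto
    then have "?en (Suc n) = ?en n"
      using en_nonneg by (simp only: power2_eq_iff_nonneg)
    then show ?case
      using Suc by simp
  qed simp
  have initial: "?en 0 = energy_norm \<Omega> c (global_vproj (int k) \<Omega>h u\<^sub>0) (global_proj (int k) \<Omega>h p\<^sub>0)"
  proof -
    have u0: "AE x in lebesgue_on \<Omega>. u 0 x = global_vproj (int k) \<Omega>h u\<^sub>0 x"
      and p0: "AE x in lebesgue_on \<Omega>. p 0 x = global_proj (int k) \<Omega>h p\<^sub>0 x"
      using init by (auto simp: theta_initial_def)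
    have "u 0 \<in> L2 (region E)" if "E \<in> \<Omega>h" for E
      using uV[of 0] that by (auto simp: V_disc_def intro: dof_spaceD vem_local_dof_space)
    then have m: "m_form k B \<Omega>h (u 0) (u 0) = (l2_norm \<Omega> (global_vproj (int k) \<Omega>h u\<^sub>0))\<^sup>2"
      by (rule initial_m_form[OF \<Omega>(1) D B assms(16) _ u0])
    have pL2: "p 0 \<in> L2 \<Omega>"
      using pQ[of 0] by (simp add: Q_disc_def)
    have gL2: "global_proj (int k) \<Omega>h p\<^sub>0 \<in> L2 \<Omega>"
      by (rule L2_cong_AE[OF \<Omega>m pL2]) (use p0 in \<open>eventually_elim, simp\<close>)
    let ?q = "\<lambda>x. p 0 x / c x" and ?g = "\<lambda>x. global_proj (int k) \<Omega>h p\<^sub>0 x / c x"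
    have q: "?q \<in> L2 \<Omega>" and g: "?g \<in> L2 \<Omega>"
      by (rule L2_divide_coefficient[OF D c \<Omega>m pL2], rule L2_divide_coefficient[OF D c \<Omega>m gL2])
    have qg: "AE x in lebesgue_on \<Omega>. ?q x = ?g x"
      using p0 by eventually_elim simp
    have "l2_inner \<Omega> ?q ?q = l2_inner \<Omega> ?g ?g"
      using l2_inner_cong_AE[OF qg q g q] l2_inner_cong_AE[OF qg q g g]
      by (simp add: l2_inner_commute[of \<Omega> ?g ?q])
    then show ?thesis
      by (simp add: disc_energy_norm_def energy_norm_def m l2_norm_power2)
  qed
  have "(?en (Suc n))\<^sup>2 \<le> (?en n)\<^sup>2" if "1 / 2 < \<theta>" "n < N" for n
  proof -
    obtain \<delta> where "\<delta> \<ge> 0" "(?en (Suc n))\<^sup>2 = (?en n)\<^sup>2 - (2 * \<theta> - 1) * \<delta>"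
      using step[OF \<open>n < N\<close>] by blast
    with that(1) show ?thesis
      using mult_nonneg_nonneg[of "2 * \<theta> - 1" \<delta>] by simp
  qed
  moreover have "(?en (Suc n))\<^sup>2 \<ge> (?en n)\<^sup>2" if "\<theta> < 1 / 2" "n < N" for n
  proof -
    obtain \<delta> where "\<delta> \<ge> 0" "(?en (Suc n))\<^sup>2 = (?en n)\<^sup>2 - (2 * \<theta> - 1) * \<delta>"
      using step[OF \<open>n < N\<close>] by blast
    with that(1) show ?thesis
      using mult_nonneg_nonneg[of "1 - 2 * \<theta>" \<delta>] by (simp add: algebra_simps)
  qed
  ultimately show ?thesis
    using conserved initial by blast
qed

end
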